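(* Let $R$ be a commutative Noetherian ring with identity, $\mathfrak{a}$ an ideal of $R$, $X$ an arbitrary $R$-module, $t$ a non-negative integer, and $\delta$ a Serre subcategory of the category $\mathcal{C}(R)$ of $R$-modules. Let $\mathfrak{b}$ be an ideal of $R$ containing $\mathfrak{a}$. Then: (i) If $\operatorname{Ext}^{i}_{R}(R/\mathfrak{a},X)\in\delta$ for all $0\le i\le t$, then $\operatorname{Ext}^{i}_{R}(N,X)\in\delta$ for all $0\le i\le t$ and all $N\in\mathcal{C}^{\mathfrak{a}}(R)$. In particular, $\operatorname{Ext}^{i}_{R}(R/\mathfrak{b},X)\in\delta$ for all $0\le i\le t$. (ii) If $\operatorname{Tor}_{i}^{R}(R/\mathfrak{a},X)\in\delta$ for all $0\le i\le t$, then $\operatorname{Tor}_{i}^{R}(N,X)\in\delta$ for all $0\le i\le t$ and all $N\in\mathcal{C}^{\mathfrak{a}}(R)$. In particular, $\operatorname{Tor}_{i}^{R}(R/\mathfrak{b},X)\in\delta$ for all $0\le i\le t$.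
   Context: A Serre subcategory of $\mathcal{C}(R)$ is a subcategory closed under taking subobjects, quotients and extensions. $\mathcal{C}^{\mathfrak{a}}(R)$ denotes the category of finitely generated $R$-modules whose support is contained in $V(\mathfrak{a})$. *)

theory Defs
  imports "HOL-Algebra.Module" "HOL-Algebra.Ring_Divisibility"
begin

text \<open>
  The multiplicative fields \<open>mult\<close> and \<open>one\<close> of the library's module records play no role in the
  locale \<open>module\<close>; they are left \<open>undefined\<close> in the constructions below.
\<close>

section \<open>Homomorphisms, quotients, generated submodules\<close>

text \<open>Homomorphisms are extensional, so that they form an \<open>R\<close>-module themselves.\<close>

definition mod_hom ::
    "('r, 'e) ring_scheme \<Rightarrow> ('r, 'm) module \<Rightarrow> ('r, 'n) module \<Rightarrow> ('m \<Rightarrow> 'n) set" where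
  "mod_hom R M N = {f \<in> carrier M \<rightarrow>\<^sub>E carrier N.
     (\<forall>x\<in>carrier M. \<forall>y\<in>carrier M. f (x \<oplus>\<^bsub>M\<^esub> y) = f x \<oplus>\<^bsub>N\<^esub> f y) \<and>
     (\<forall>r\<in>carrier R. \<forall>x\<in>carrier M. f (r \<odot>\<^bsub>M\<^esub> x) = r \<odot>\<^bsub>N\<^esub> f x)}"

definition mod_iso :: "('r, 'e) ring_scheme \<Rightarrow> ('r, 'm) module \<Rightarrow> ('r, 'n) module \<Rightarrow> bool" where
  "mod_iso R M N \<longleftrightarrow> (\<exists>f \<in> mod_hom R M N. bij_betw f (carrier M) (carrier N))"

definition Hom_module ::
    "('r, 'e) ring_scheme \<Rightarrow> ('r, 'm) module \<Rightarrow> ('r, 'n) module \<Rightarrow> ('r, 'm \<Rightarrow> 'n) module" where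
  "Hom_module R M N =
    \<lparr>carrier = mod_hom R M N, monoid.mult = undefined, one = undefined,
     ring.zero = (\<lambda>x\<in>carrier M. \<zero>\<^bsub>N\<^esub>),
     ring.add = (\<lambda>f g. \<lambda>x\<in>carrier M. f x \<oplus>\<^bsub>N\<^esub> g x),
     smult = (\<lambda>r f. \<lambda>x\<in>carrier M. r \<odot>\<^bsub>N\<^esub> f x)\<rparr>"

definition quot_module :: "('r, 'm) module \<Rightarrow> 'm set \<Rightarrow> ('r, 'm set) module" where
  "quot_module M K =
    \<lparr>carrier = a_rcosets\<^bsub>M\<^esub> K, monoid.mult = undefined, one = undefined,
     ring.zero = K,
     ring.add = (\<lambda>A B. A <+>\<^bsub>M\<^esub> B),
     smult = (\<lambda>r A. \<Union>x\<in>A. K +>\<^bsub>M\<^esub> (r \<odot>\<^bsub>M\<^esub> x))\<rparr>"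

definition ring_module :: "('r, 'e) ring_scheme \<Rightarrow> ('r, 'r) module" where
  "ring_module R =
    \<lparr>carrier = carrier R, monoid.mult = undefined, one = undefined,
     ring.zero = \<zero>\<^bsub>R\<^esub>, ring.add = (\<oplus>\<^bsub>R\<^esub>), smult = (\<otimes>\<^bsub>R\<^esub>)\<rparr>"

definition cyclic_module :: "('r, 'e) ring_scheme \<Rightarrow> 'r set \<Rightarrow> ('r, 'r set) module" where
  "cyclic_module R I = quot_module (ring_module R) I"

definition mod_span :: "('r, 'e) ring_scheme \<Rightarrow> ('r, 'm) module \<Rightarrow> 'm set \<Rightarrow> 'm set" where
  "mod_span R M S = \<Inter>{K. submodule K R M \<and> S \<subseteq> K}"

definition finitely_generated :: "('r, 'e) ring_scheme \<Rightarrow> ('r, 'm) module \<Rightarrow> bool" where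
  "finitely_generated R M \<longleftrightarrow>
     (\<exists>S. finite S \<and> S \<subseteq> carrier M \<and> mod_span R M S = carrier M)"


section \<open>Localization and support\<close>

definition loc_rel ::
    "('r, 'e) ring_scheme \<Rightarrow> 'r set \<Rightarrow> ('r, 'm) module \<Rightarrow> (('m \<times> 'r) \<times> ('m \<times> 'r)) set" where
  "loc_rel R S M = {((x, s), (y, t)). x \<in> carrier M \<and> y \<in> carrier M \<and> s \<in> S \<and> t \<in> S \<and>
     (\<exists>u\<in>S. u \<odot>\<^bsub>M\<^esub> (t \<odot>\<^bsub>M\<^esub> x) = u \<odot>\<^bsub>M\<^esub> (s \<odot>\<^bsub>M\<^esub> y))}"

definition localization ::
    "('r, 'e) ring_scheme \<Rightarrow> 'r set \<Rightarrow> ('r, 'm) module \<Rightarrow> ('r, ('m \<times> 'r) set) module" where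
  "localization R S M =
    \<lparr>carrier = (carrier M \<times> S) // loc_rel R S M, monoid.mult = undefined, one = undefined,
     ring.zero = loc_rel R S M `` {(\<zero>\<^bsub>M\<^esub>, \<one>\<^bsub>R\<^esub>)},
     ring.add = (\<lambda>A B. \<Union>(x, s)\<in>A. \<Union>(y, t)\<in>B.
              loc_rel R S M `` {(t \<odot>\<^bsub>M\<^esub> x \<oplus>\<^bsub>M\<^esub> s \<odot>\<^bsub>M\<^esub> y, s \<otimes>\<^bsub>R\<^esub> t)}),
     smult = (\<lambda>r A. \<Union>(x, s)\<in>A. loc_rel R S M `` {(r \<odot>\<^bsub>M\<^esub> x, s)})\<rparr>"

definition support :: "('r, 'e) ring_scheme \<Rightarrow> ('r, 'm) module \<Rightarrow> 'r set set" where
  "support R M = {p. primeideal p R \<and>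
     carrier (localization R (carrier R - p) M) \<noteq> {\<zero>\<^bsub>localization R (carrier R - p) M\<^esub>}}"

definition zero_locus :: "('r, 'e) ring_scheme \<Rightarrow> 'r set \<Rightarrow> 'r set set" where
  "zero_locus R I = {p. primeideal p R \<and> I \<subseteq> p}"

definition fg_supported :: "('r, 'e) ring_scheme \<Rightarrow> 'r set \<Rightarrow> ('r, 'm) module \<Rightarrow> bool" where
  "fg_supported R I N \<longleftrightarrow>
     module R N \<and> finitely_generated R N \<and> support R N \<subseteq> zero_locus R I"


section \<open>Free modules and the standard free resolution\<close>

definition free_module :: "('r, 'e) ring_scheme \<Rightarrow> 'b set \<Rightarrow> ('r, 'b \<Rightarrow> 'r) module" where
  "free_module R B =
    \<lparr>carrier = {c. range c \<subseteq> carrier R \<and> finite {b. c b \<noteq> \<zero>\<^bsub>R\<^esub>} \<and> {b. c b \<noteq> \<zero>\<^bsub>R\<^esub>} \<subseteq> B},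
     monoid.mult = undefined, one = undefined,
     ring.zero = (\<lambda>b. \<zero>\<^bsub>R\<^esub>),
     ring.add = (\<lambda>c d b. c b \<oplus>\<^bsub>R\<^esub> d b),
     smult = (\<lambda>r c b. r \<otimes>\<^bsub>R\<^esub> c b)\<rparr>"

definition free_gen :: "('r, 'e) ring_scheme \<Rightarrow> 'b \<Rightarrow> 'b \<Rightarrow> 'r" where
  "free_gen R b = (\<lambda>b'. if b' = b then \<one>\<^bsub>R\<^esub> else \<zero>\<^bsub>R\<^esub>)"

definition lin_ext ::
    "('r, 'e) ring_scheme \<Rightarrow> 'b set \<Rightarrow> ('r, 'm) module \<Rightarrow> ('b \<Rightarrow> 'm) \<Rightarrow> ('b \<Rightarrow> 'r) \<Rightarrow> 'm" where
  "lin_ext R B M \<phi> =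
     (\<lambda>c\<in>carrier (free_module R B). \<Oplus>\<^bsub>M\<^esub>b\<in>{b. c b \<noteq> \<zero>\<^bsub>R\<^esub>}. c b \<odot>\<^bsub>M\<^esub> \<phi> b)"

text \<open>
  The standard resolution covers \<open>N\<close> by the free module on its elements, and each successive kernel by
  the free module on all formal linear combinations that represent an element of it. Naming the generators by formal linear combinations of earlier ones
  keeps all terms of the resolution in one type: \<open>Gen x\<close> is mapped to \<open>x \<in> N\<close>, and
  \<open>Syz [(r\<^sub>1, b\<^sub>1), \<dots>, (r\<^sub>k, b\<^sub>k)]\<close> to \<open>r\<^sub>1 b\<^sub>1 + \<dots> + r\<^sub>k b\<^sub>k\<close>, where that combination lies in the
  kernel of the preceding map.
\<close>

datatype ('r, 'n) syz = Gen 'n | Syz "('r \<times> ('r, 'n) syz) list"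

primrec lin_comb :: "('r, 'e) ring_scheme \<Rightarrow> ('r \<times> 'b) list \<Rightarrow> 'b \<Rightarrow> 'r" where
  "lin_comb R [] = (\<lambda>b. \<zero>\<^bsub>R\<^esub>)"
| "lin_comb R (p # l) =
     (\<lambda>b. if b = snd p then fst p \<oplus>\<^bsub>R\<^esub> lin_comb R l b else lin_comb R l b)"

primrec gen_value :: "('r, 'n) syz \<Rightarrow> 'n" where
  "gen_value (Gen x) = x"

primrec syz_value :: "('r, 'e) ring_scheme \<Rightarrow> ('r, 'n) syz \<Rightarrow> ('r, 'n) syz \<Rightarrow> 'r" where
  "syz_value R (Syz l) = lin_comb R l"

fun res_basis :: "('r, 'e) ring_scheme \<Rightarrow> ('r, 'n) module \<Rightarrow> nat \<Rightarrow> ('r, 'n) syz set" where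
  "res_basis R N 0 = Gen ` carrier N"
| "res_basis R N (Suc 0) = {Syz l | l. set l \<subseteq> carrier R \<times> res_basis R N 0 \<and>
     lin_ext R (res_basis R N 0) N gen_value (lin_comb R l) = \<zero>\<^bsub>N\<^esub>}"
| "res_basis R N (Suc (Suc n)) = {Syz l | l. set l \<subseteq> carrier R \<times> res_basis R N (Suc n) \<and>
     lin_ext R (res_basis R N (Suc n)) (free_module R (res_basis R N n)) (syz_value R)
       (lin_comb R l) = \<zero>\<^bsub>free_module R (res_basis R N n)\<^esub>}"

definition res_mod ::
    "('r, 'e) ring_scheme \<Rightarrow> ('r, 'n) module \<Rightarrow> nat \<Rightarrow> ('r, ('r, 'n) syz \<Rightarrow> 'r) module" where
  "res_mod R N n = free_module R (res_basis R N n)"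

definition res_aug ::
    "('r, 'e) ring_scheme \<Rightarrow> ('r, 'n) module \<Rightarrow> (('r, 'n) syz \<Rightarrow> 'r) \<Rightarrow> 'n" where
  "res_aug R N = lin_ext R (res_basis R N 0) N gen_value"

text \<open>\<open>res_diff R N n\<close> maps the term of degree \<open>n + 1\<close> to the term of degree \<open>n\<close>.\<close>

definition res_diff ::
    "('r, 'e) ring_scheme \<Rightarrow> ('r, 'n) module \<Rightarrow> nat
       \<Rightarrow> (('r, 'n) syz \<Rightarrow> 'r) \<Rightarrow> (('r, 'n) syz \<Rightarrow> 'r)" where
  "res_diff R N n = lin_ext R (res_basis R N (Suc n)) (res_mod R N n) (syz_value R)"


lemma free_module_is_module:
  fixes R :: "('r, 'e) ring_scheme" and B :: "'b set"
  assumes "cring R"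
  shows "module R (free_module R B)"
proof -
  interpret R: cring R by (rule assms)
  have supp: "finite {b. h b \<noteq> \<zero>\<^bsub>R\<^esub>} \<and> {b. h b \<noteq> \<zero>\<^bsub>R\<^esub>} \<subseteq> B"
    if "finite {b. c b \<noteq> \<zero>\<^bsub>R\<^esub>} \<and> {b. c b \<noteq> \<zero>\<^bsub>R\<^esub>} \<subseteq> B"
      "finite {b. d b \<noteq> \<zero>\<^bsub>R\<^esub>} \<and> {b. d b \<noteq> \<zero>\<^bsub>R\<^esub>} \<subseteq> B"
      "\<And>b. c b = \<zero>\<^bsub>R\<^esub> \<Longrightarrow> d b = \<zero>\<^bsub>R\<^esub> \<Longrightarrow> h b = \<zero>\<^bsub>R\<^esub>" for c d h :: "'b \<Rightarrow> 'r"
  proof -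
    have "{b. h b \<noteq> \<zero>\<^bsub>R\<^esub>} \<subseteq> {b. c b \<noteq> \<zero>\<^bsub>R\<^esub>} \<union> {b. d b \<noteq> \<zero>\<^bsub>R\<^esub>}"
      using that(3) by auto
    then show ?thesis
      using that(1,2) by (meson finite_Un finite_subset le_sup_iff order_trans)
  qed
  have mem: "c \<in> carrier (free_module R B) \<longleftrightarrow> (\<forall>b. c b \<in> carrier R) \<and>
      finite {b. c b \<noteq> \<zero>\<^bsub>R\<^esub>} \<and> {b. c b \<noteq> \<zero>\<^bsub>R\<^esub>} \<subseteq> B" for c
    by (auto simp: free_module_def)
  have neg: "\<exists>d\<in>carrier (free_module R B). d \<oplus>\<^bsub>free_module R B\<^esub> c = \<zero>\<^bsub>free_module R B\<^esub>"
    if c: "c \<in> carrier (free_module R B)" for c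
  proof (rule bexI[where x = "\<lambda>b. \<ominus>\<^bsub>R\<^esub> c b"])
    show "(\<lambda>b. \<ominus>\<^bsub>R\<^esub> c b) \<in> carrier (free_module R B)"
      using c supp[of c c "\<lambda>b. \<ominus>\<^bsub>R\<^esub> c b"] by (auto simp: mem)
    show "(\<lambda>b. \<ominus>\<^bsub>R\<^esub> c b) \<oplus>\<^bsub>free_module R B\<^esub> c = \<zero>\<^bsub>free_module R B\<^esub>"
      using c by (auto simp: mem free_module_def R.l_neg fun_eq_iff image_subset_iff)
  qed
  have add: "c \<oplus>\<^bsub>free_module R B\<^esub> d \<in> carrier (free_module R B)"
    if "c \<in> carrier (free_module R B)" "d \<in> carrier (free_module R B)" for c d
    using that supp[of c d "\<lambda>b. c b \<oplus>\<^bsub>R\<^esub> d b"]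
    unfolding mem by (simp add: free_module_def)
  have zero: "\<zero>\<^bsub>free_module R B\<^esub> \<in> carrier (free_module R B)"
    by (auto simp: free_module_def)
  have smult: "r \<odot>\<^bsub>free_module R B\<^esub> c \<in> carrier (free_module R B)"
    if "r \<in> carrier R" "c \<in> carrier (free_module R B)" for r c
    using that supp[of c c "\<lambda>b. r \<otimes>\<^bsub>R\<^esub> c b"]
    unfolding mem by (simp add: free_module_def)
  show ?thesis
  proof (rule moduleI)
    show "abelian_group (free_module R B)"
    proof (rule abelian_groupI[OF add zero _ _ _ neg])
    qed (auto simp: mem free_module_def R.a_ac fun_eq_iff image_subset_iff)
  qed (use assms smult in \<open>auto simp: mem free_module_def R.l_distr R.r_distr R.m_assoc
      fun_eq_iff image_subset_iff\<close>)
qed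

lemma lin_ext_superset:
  assumes "module R M" "\<phi> \<in> B \<rightarrow> carrier M" "c \<in> carrier (free_module R B)"
    and A: "finite A" "{b. c b \<noteq> \<zero>\<^bsub>R\<^esub>} \<subseteq> A" "A \<subseteq> B"
  shows "lin_ext R B M \<phi> c = (\<Oplus>\<^bsub>M\<^esub>b\<in>A. c b \<odot>\<^bsub>M\<^esub> \<phi> b)"
proof -
  interpret module R M by (rule assms(1))
  have c: "\<And>b. c b \<in> carrier R" using assms(3) by (auto simp: free_module_def)
  have "(\<Oplus>\<^bsub>M\<^esub>b\<in>{b. c b \<noteq> \<zero>\<^bsub>R\<^esub>}. c b \<odot>\<^bsub>M\<^esub> \<phi> b) = (\<Oplus>\<^bsub>M\<^esub>b\<in>A. c b \<odot>\<^bsub>M\<^esub> \<phi> b)"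
    using A assms(2) c
    by (intro M.add.finprod_mono_neutral_cong_left) (auto simp: Pi_iff subset_iff)
  then show ?thesis using assms(3) by (simp add: lin_ext_def)
qed

lemma lin_ext_closed:
  assumes "module R M" "\<phi> \<in> B \<rightarrow> carrier M" "c \<in> carrier (free_module R B)"
  shows "lin_ext R B M \<phi> c \<in> carrier M"
proof -
  interpret module R M by (rule assms(1))
  show ?thesis
    using assms(2,3) unfolding lin_ext_def
    by (auto simp: free_module_def Pi_iff subset_iff image_subset_iff intro!: M.finsum_closed)
qed

lemma lin_ext_hom:
  assumes "module R M" "\<phi> \<in> B \<rightarrow> carrier M"
  shows "lin_ext R B M \<phi> \<in> mod_hom R (free_module R B) M"
proof -
  interpret module R M by (rule assms(1))
  interpret F: module R "free_module R B" by (rule free_module_is_module[OF R.is_cring])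
  let ?s = "\<lambda>c. {b. c b \<noteq> \<zero>\<^bsub>R\<^esub>}"
  have mem: "c \<in> carrier (free_module R B) \<longleftrightarrow> (\<forall>b. c b \<in> carrier R) \<and> finite (?s c) \<and> ?s c \<subseteq> B" for c
    by (auto simp: free_module_def)
  have add: "lin_ext R B M \<phi> (c \<oplus>\<^bsub>free_module R B\<^esub> d) = lin_ext R B M \<phi> c \<oplus>\<^bsub>M\<^esub> lin_ext R B M \<phi> d"
    if c: "c \<in> carrier (free_module R B)" and d: "d \<in> carrier (free_module R B)" for c d
  proof -
    let ?A = "?s c \<union> ?s d"
    have A: "finite ?A" "?A \<subseteq> B" using c d by (auto simp: mem)
    have cd: "?s (c \<oplus>\<^bsub>free_module R B\<^esub> d) \<subseteq> ?A" by (auto simp: free_module_def)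
    have cl: "\<And>b. c b \<in> carrier R" "\<And>b. d b \<in> carrier R" "\<And>b. b \<in> ?A \<Longrightarrow> \<phi> b \<in> carrier M"
      using c d assms(2) A by (auto simp: mem)
    have "lin_ext R B M \<phi> (c \<oplus>\<^bsub>free_module R B\<^esub> d) = (\<Oplus>\<^bsub>M\<^esub>b\<in>?A. (c b \<oplus>\<^bsub>R\<^esub> d b) \<odot>\<^bsub>M\<^esub> \<phi> b)"
      using lin_ext_superset[OF assms F.a_closed[OF c d] A(1) cd A(2)] by (simp add: free_module_def)
    also have "\<dots> = (\<Oplus>\<^bsub>M\<^esub>b\<in>?A. c b \<odot>\<^bsub>M\<^esub> \<phi> b \<oplus>\<^bsub>M\<^esub> d b \<odot>\<^bsub>M\<^esub> \<phi> b)"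
      using cl by (intro M.finsum_cong') (auto simp: smult_l_distr)
    also have "\<dots> = (\<Oplus>\<^bsub>M\<^esub>b\<in>?A. c b \<odot>\<^bsub>M\<^esub> \<phi> b) \<oplus>\<^bsub>M\<^esub> (\<Oplus>\<^bsub>M\<^esub>b\<in>?A. d b \<odot>\<^bsub>M\<^esub> \<phi> b)"
      using cl by (intro M.finsum_addf) auto
    finally show ?thesis
      using lin_ext_superset[OF assms c A(1) _ A(2)] lin_ext_superset[OF assms d A(1) _ A(2)] by simp
  qed
  have smult: "lin_ext R B M \<phi> (r \<odot>\<^bsub>free_module R B\<^esub> c) = r \<odot>\<^bsub>M\<^esub> lin_ext R B M \<phi> c"
    if r: "r \<in> carrier R" and c: "c \<in> carrier (free_module R B)" for r c
  proof -
    let ?A = "?s c"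
    have A: "finite ?A" "?A \<subseteq> B" using c by (auto simp: mem)
    have rc: "?s (r \<odot>\<^bsub>free_module R B\<^esub> c) \<subseteq> ?A" using r by (auto simp: free_module_def)
    have cl: "\<And>b. c b \<in> carrier R" "\<And>b. b \<in> ?A \<Longrightarrow> \<phi> b \<in> carrier M"
      using c assms(2) A by (auto simp: mem)
    have "lin_ext R B M \<phi> (r \<odot>\<^bsub>free_module R B\<^esub> c) = (\<Oplus>\<^bsub>M\<^esub>b\<in>?A. (r \<otimes>\<^bsub>R\<^esub> c b) \<odot>\<^bsub>M\<^esub> \<phi> b)"
      using lin_ext_superset[OF assms F.smult_closed[OF r c] A(1) rc A(2)] by (simp add: free_module_def)
    also have "\<dots> = (\<Oplus>\<^bsub>M\<^esub>b\<in>?A. r \<odot>\<^bsub>M\<^esub> (c b \<odot>\<^bsub>M\<^esub> \<phi> b))"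
      using cl r by (intro M.finsum_cong') (auto simp: smult_assoc1)
    also have "\<dots> = r \<odot>\<^bsub>M\<^esub> (\<Oplus>\<^bsub>M\<^esub>b\<in>?A. c b \<odot>\<^bsub>M\<^esub> \<phi> b)"
      using cl r A by (intro finsum_smult_ldistr[symmetric]) auto
    finally show ?thesis using lin_ext_superset[OF assms c A(1) _ A(2)] by simp
  qed
  have ext: "lin_ext R B M \<phi> \<in> carrier (free_module R B) \<rightarrow>\<^sub>E carrier M"
    using lin_ext_closed[OF assms] by (auto simp: PiE_iff lin_ext_def)
  show ?thesis unfolding mod_hom_def using ext add smult by simp
qed

lemma free_gen_closed:
  assumes "cring R" "b \<in> B"
  shows "free_gen R b \<in> carrier (free_module R B)"
proof -
  interpret cring R by (rule assms)
  have "{b'. free_gen R b b' \<noteq> \<zero>\<^bsub>R\<^esub>} \<subseteq> {b}" by (auto simp: free_gen_def)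
  then show ?thesis
    using assms(2) by (auto simp: free_module_def free_gen_def intro: finite_subset split: if_splits)
qed

lemma lin_ext_free_gen:
  assumes "module R M" "\<phi> \<in> B \<rightarrow> carrier M" "b \<in> B"
  shows "lin_ext R B M \<phi> (free_gen R b) = \<phi> b"
proof -
  interpret module R M by (rule assms(1))
  have s: "{b'. free_gen R b b' \<noteq> \<zero>\<^bsub>R\<^esub>} \<subseteq> {b}" by (auto simp: free_gen_def)
  have "lin_ext R B M \<phi> (free_gen R b) = (\<Oplus>\<^bsub>M\<^esub>b'\<in>{b}. free_gen R b b' \<odot>\<^bsub>M\<^esub> \<phi> b')"
    using lin_ext_superset[OF assms(1,2) free_gen_closed[OF R.is_cring assms(3)] _ s] assms(3) by simp
  also have "\<dots> = \<phi> b" using assms(2,3) by (simp add: free_gen_def Pi_iff)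
  finally show ?thesis .
qed

lemma lin_comb_closed:
  assumes "cring R" "set l \<subseteq> carrier R \<times> B"
  shows "lin_comb R l \<in> carrier (free_module R B)"
  using assms(2)
proof (induction l)
  case Nil
  interpret cring R by (rule assms)
  show ?case by (auto simp: free_module_def)
next
  case (Cons p l)
  interpret cring R by (rule assms)
  have IH: "lin_comb R l \<in> carrier (free_module R B)" and p: "fst p \<in> carrier R" "snd p \<in> B"
    using Cons by auto
  have "{b. lin_comb R (p # l) b \<noteq> \<zero>\<^bsub>R\<^esub>} \<subseteq> insert (snd p) {b. lin_comb R l b \<noteq> \<zero>\<^bsub>R\<^esub>}" by auto
  moreover have "\<And>b. lin_comb R (p # l) b \<in> carrier R"
    using IH p by (auto simp: free_module_def)
  ultimately show ?case
    using IH p unfolding free_module_def by (auto intro: finite_subset simp del: lin_comb.simps)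
qed

lemma lin_comb_surj:
  assumes "cring R" "c \<in> carrier (free_module R B)"
  shows "\<exists>l. set l \<subseteq> carrier R \<times> B \<and> lin_comb R l = c"
proof -
  interpret cring R by (rule assms)
  have "finite {b. c b \<noteq> \<zero>\<^bsub>R\<^esub>}" using assms(2) by (auto simp: free_module_def)
  then obtain bs where bs: "set bs = {b. c b \<noteq> \<zero>\<^bsub>R\<^esub>}" "distinct bs"
    using finite_distinct_list by blast
  have c: "\<And>b. c b \<in> carrier R" "{b. c b \<noteq> \<zero>\<^bsub>R\<^esub>} \<subseteq> B"
    using assms(2) by (auto simp: free_module_def)
  have "lin_comb R (map (\<lambda>b. (c b, b)) bs) = (\<lambda>b. if b \<in> set bs then c b else \<zero>\<^bsub>R\<^esub>)"
    using bs(2) c(1) by (induction bs) (auto simp: fun_eq_iff)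
  moreover have "\<dots> = c" using bs(1) by auto
  ultimately show ?thesis
    using bs c by (intro exI[of _ "map (\<lambda>b. (c b, b)) bs"]) auto
qed

lemma syz_cover:
  fixes B :: "('r, 'n) syz set"
  assumes "module R M" "\<phi> \<in> B \<rightarrow> carrier M"
    and B': "B' = {Syz l | l. set l \<subseteq> carrier R \<times> B \<and> lin_ext R B M \<phi> (lin_comb R l) = \<zero>\<^bsub>M\<^esub>}"
  shows "syz_value R \<in> B' \<rightarrow> carrier (free_module R B)"
    and "lin_ext R B' (free_module R B) (syz_value R) ` carrier (free_module R B')
           = a_kernel (free_module R B) M (lin_ext R B M \<phi>)"
proof -
  interpret module R M by (rule assms(1))
  interpret F: module R "free_module R B" by (rule free_module_is_module[OF R.is_cring])
  let ?F = "free_module R B" and ?f = "lin_ext R B M \<phi>"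
  let ?d = "lin_ext R B' ?F (syz_value R)"
  show val: "syz_value R \<in> B' \<rightarrow> carrier ?F"
    using lin_comb_closed[OF R.is_cring] unfolding B' by auto
  have f: "?f \<in> mod_hom R ?F M" by (rule lin_ext_hom[OF assms(1,2)])
  have ker: "a_kernel ?F M ?f = {c \<in> carrier ?F. ?f c = \<zero>\<^bsub>M\<^esub>}"
    by (simp add: a_kernel_def kernel_def)
  have sum0: "?f (\<Oplus>\<^bsub>?F\<^esub>b\<in>A. c b \<odot>\<^bsub>?F\<^esub> syz_value R b) = \<zero>\<^bsub>M\<^esub>"
    if "finite A" "A \<subseteq> B'" "\<And>b. c b \<in> carrier R" for A c
    using that
  proof (induction A)
    case empty
    have "?f (\<zero>\<^bsub>R\<^esub> \<odot>\<^bsub>?F\<^esub> \<zero>\<^bsub>?F\<^esub>) = \<zero>\<^bsub>R\<^esub> \<odot>\<^bsub>M\<^esub> ?f \<zero>\<^bsub>?F\<^esub>"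
      using f unfolding mod_hom_def by blast
    then show ?case using lin_ext_closed[OF assms(1,2) F.zero_closed] by simp
  next
    case (insert b A)
    have b: "syz_value R b \<in> carrier ?F" "?f (syz_value R b) = \<zero>\<^bsub>M\<^esub>"
      using insert.prems val by (auto simp: B')
    have A: "(\<lambda>b. c b \<odot>\<^bsub>?F\<^esub> syz_value R b) \<in> A \<rightarrow> carrier ?F"
      using insert.prems val by auto
    have "?f (c b \<odot>\<^bsub>?F\<^esub> syz_value R b) = \<zero>\<^bsub>M\<^esub>"
      using f b insert.prems by (auto simp: mod_hom_def)
    moreover have "?f (\<Oplus>\<^bsub>?F\<^esub>b\<in>insert b A. c b \<odot>\<^bsub>?F\<^esub> syz_value R b)
        = ?f (c b \<odot>\<^bsub>?F\<^esub> syz_value R b) \<oplus>\<^bsub>M\<^esub> ?f (\<Oplus>\<^bsub>?F\<^esub>b\<in>A. c b \<odot>\<^bsub>?F\<^esub> syz_value R b)"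
    proof -
      have "(\<Oplus>\<^bsub>?F\<^esub>b\<in>insert b A. c b \<odot>\<^bsub>?F\<^esub> syz_value R b)
          = c b \<odot>\<^bsub>?F\<^esub> syz_value R b \<oplus>\<^bsub>?F\<^esub> (\<Oplus>\<^bsub>?F\<^esub>b\<in>A. c b \<odot>\<^bsub>?F\<^esub> syz_value R b)"
        using insert.hyps A b insert.prems by (intro F.finsum_insert) auto
      moreover have "c b \<odot>\<^bsub>?F\<^esub> syz_value R b \<in> carrier ?F"
          "(\<Oplus>\<^bsub>?F\<^esub>b\<in>A. c b \<odot>\<^bsub>?F\<^esub> syz_value R b) \<in> carrier ?F"
        using b insert.prems A by auto
      ultimately show ?thesis using f unfolding mod_hom_def by simp
    qed
    ultimately show ?case using insert by simp
  qed
  show "?d ` carrier (free_module R B') = a_kernel ?F M ?f"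
  proof (intro equalityI subsetI)
    fix c assume "c \<in> ?d ` carrier (free_module R B')"
    then obtain e where e: "e \<in> carrier (free_module R B')" "c = ?d e" by blast
    then have "c = (\<Oplus>\<^bsub>?F\<^esub>b\<in>{b. e b \<noteq> \<zero>\<^bsub>R\<^esub>}. e b \<odot>\<^bsub>?F\<^esub> syz_value R b)" by (simp add: lin_ext_def)
    moreover have "finite {b. e b \<noteq> \<zero>\<^bsub>R\<^esub>}" "{b. e b \<noteq> \<zero>\<^bsub>R\<^esub>} \<subseteq> B'" "\<And>b. e b \<in> carrier R"
      using e by (auto simp: free_module_def)
    ultimately show "c \<in> a_kernel ?F M ?f"
      using sum0 lin_ext_closed[OF F.module_axioms val e(1)] e(2) by (auto simp: ker)
  next
    fix c assume c: "c \<in> a_kernel ?F M ?f"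
    then obtain l where l: "set l \<subseteq> carrier R \<times> B" "lin_comb R l = c"
      using lin_comb_surj[OF R.is_cring] by (auto simp: ker)
    then have "Syz l \<in> B'" using c by (auto simp: ker B')
    then have "?d (free_gen R (Syz l)) = c" "free_gen R (Syz l) \<in> carrier (free_module R B')"
      using lin_ext_free_gen[OF F.module_axioms val] l free_gen_closed[OF R.is_cring] by auto
    then show "c \<in> ?d ` carrier (free_module R B')" by blast
  qed
qed

theorem standard_resolution:
  assumes "module R N"
  shows "module R (res_mod R N n)"
    and "res_aug R N \<in> mod_hom R (res_mod R N 0) N"
    and "res_diff R N n \<in> mod_hom R (res_mod R N (Suc n)) (res_mod R N n)"
    and "res_aug R N ` carrier (res_mod R N 0) = carrier N"
    and "res_diff R N 0 ` carrier (res_mod R N (Suc 0))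
           = a_kernel (res_mod R N 0) N (res_aug R N)"
    and "res_diff R N (Suc n) ` carrier (res_mod R N (Suc (Suc n)))
           = a_kernel (res_mod R N (Suc n)) (res_mod R N n) (res_diff R N n)"
proof -
  interpret module R N by (rule assms)
  have mod: "module R (res_mod R N n)" for n
    unfolding res_mod_def by (rule free_module_is_module[OF R.is_cring])
  show "module R (res_mod R N n)" by (rule mod)
  have gv: "gen_value \<in> res_basis R N 0 \<rightarrow> carrier N" by auto
  show aug: "res_aug R N \<in> mod_hom R (res_mod R N 0) N"
    unfolding res_aug_def res_mod_def by (rule lin_ext_hom[OF assms gv])
  have sv: "syz_value R \<in> res_basis R N (Suc n) \<rightarrow> carrier (free_module R (res_basis R N n))" for n
  proof (induction n)
    case 0
    show ?case by (rule syz_cover(1)[OF assms gv]) simp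
  next
    case (Suc n)
    show ?case
      by (rule syz_cover(1)[OF free_module_is_module[OF R.is_cring] Suc.IH]) simp
  qed
  show "res_diff R N n \<in> mod_hom R (res_mod R N (Suc n)) (res_mod R N n)"
    unfolding res_diff_def res_mod_def
    by (rule lin_ext_hom[OF free_module_is_module[OF R.is_cring] sv])
  show "res_aug R N ` carrier (res_mod R N 0) = carrier N"
  proof
    show "res_aug R N ` carrier (res_mod R N 0) \<subseteq> carrier N"
      using aug by (auto simp: mod_hom_def)
    show "carrier N \<subseteq> res_aug R N ` carrier (res_mod R N 0)"
    proof
      fix x assume "x \<in> carrier N"
      then have "Gen x \<in> res_basis R N 0" by simp
      then have "res_aug R N (free_gen R (Gen x)) = x"
          "free_gen R (Gen x) \<in> carrier (res_mod R N 0)"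
        unfolding res_aug_def res_mod_def
        using lin_ext_free_gen[OF assms gv] free_gen_closed[OF R.is_cring]
        by (simp_all del: res_basis.simps)
      then show "x \<in> res_aug R N ` carrier (res_mod R N 0)" by (metis imageI)
    qed
  qed
  show "res_diff R N 0 ` carrier (res_mod R N (Suc 0))
      = a_kernel (res_mod R N 0) N (res_aug R N)"
    unfolding res_diff_def res_mod_def res_aug_def by (rule syz_cover(2)[OF assms gv]) simp
  show "res_diff R N (Suc n) ` carrier (res_mod R N (Suc (Suc n)))
      = a_kernel (res_mod R N (Suc n)) (res_mod R N n) (res_diff R N n)"
    unfolding res_diff_def res_mod_def
    by (rule syz_cover(2)[OF free_module_is_module[OF R.is_cring] sv]) simp
qed


section \<open>Tensor products\<close>

definition tensor_rels ::
    "('r, 'e) ring_scheme \<Rightarrow> ('r, 'm) module \<Rightarrow> ('r, 'n) module \<Rightarrow> ('m \<times> 'n \<Rightarrow> 'r) set" where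
  "tensor_rels R M N = (let F = free_module R (carrier M \<times> carrier N); e = free_gen R in
     {e (x \<oplus>\<^bsub>M\<^esub> x', y) \<ominus>\<^bsub>F\<^esub> (e (x, y) \<oplus>\<^bsub>F\<^esub> e (x', y)) | x x' y.
        x \<in> carrier M \<and> x' \<in> carrier M \<and> y \<in> carrier N} \<union>
     {e (x, y \<oplus>\<^bsub>N\<^esub> y') \<ominus>\<^bsub>F\<^esub> (e (x, y) \<oplus>\<^bsub>F\<^esub> e (x, y')) | x y y'.
        x \<in> carrier M \<and> y \<in> carrier N \<and> y' \<in> carrier N} \<union>
     {e (r \<odot>\<^bsub>M\<^esub> x, y) \<ominus>\<^bsub>F\<^esub> r \<odot>\<^bsub>F\<^esub> e (x, y) | r x y.
        r \<in> carrier R \<and> x \<in> carrier M \<and> y \<in> carrier N} \<union>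
     {e (x, r \<odot>\<^bsub>N\<^esub> y) \<ominus>\<^bsub>F\<^esub> r \<odot>\<^bsub>F\<^esub> e (x, y) | r x y.
        r \<in> carrier R \<and> x \<in> carrier M \<and> y \<in> carrier N})"

definition tensor_null ::
    "('r, 'e) ring_scheme \<Rightarrow> ('r, 'm) module \<Rightarrow> ('r, 'n) module \<Rightarrow> ('m \<times> 'n \<Rightarrow> 'r) set" where
  "tensor_null R M N =
     mod_span R (free_module R (carrier M \<times> carrier N)) (tensor_rels R M N)"

definition tensor_module ::
    "('r, 'e) ring_scheme \<Rightarrow> ('r, 'm) module \<Rightarrow> ('r, 'n) module
       \<Rightarrow> ('r, ('m \<times> 'n \<Rightarrow> 'r) set) module" where
  "tensor_module R M N =
     quot_module (free_module R (carrier M \<times> carrier N)) (tensor_null R M N)"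

definition pure_tensor ::
    "('r, 'e) ring_scheme \<Rightarrow> ('r, 'm) module \<Rightarrow> ('r, 'n) module
       \<Rightarrow> 'm \<Rightarrow> 'n \<Rightarrow> ('m \<times> 'n \<Rightarrow> 'r) set" where
  "pure_tensor R M N x y =
     tensor_null R M N +>\<^bsub>free_module R (carrier M \<times> carrier N)\<^esub> free_gen R (x, y)"

text \<open>The homomorphism \<open>f \<otimes> id\<close> from \<open>M \<otimes> N\<close> to \<open>M' \<otimes> N\<close>, for a homomorphism \<open>f\<close> from \<open>M\<close> to \<open>M'\<close>.\<close>

definition tensor_map ::
    "('r, 'e) ring_scheme \<Rightarrow> ('r, 'm) module \<Rightarrow> ('r, 'k) module \<Rightarrow> ('r, 'n) module
       \<Rightarrow> ('m \<Rightarrow> 'k) \<Rightarrow> ('m \<times> 'n \<Rightarrow> 'r) set \<Rightarrow> ('k \<times> 'n \<Rightarrow> 'r) set" where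
  "tensor_map R M M' N f =
     (THE h. h \<in> mod_hom R (tensor_module R M N) (tensor_module R M' N) \<and>
        (\<forall>x\<in>carrier M. \<forall>y\<in>carrier N.
           h (pure_tensor R M N x y) = pure_tensor R M' N (f x) y))"


section \<open>Ext and Tor\<close>

definition res_codiff ::
    "('r, 'e) ring_scheme \<Rightarrow> ('r, 'n) module \<Rightarrow> nat
       \<Rightarrow> ((('r, 'n) syz \<Rightarrow> 'r) \<Rightarrow> 'x) \<Rightarrow> ((('r, 'n) syz \<Rightarrow> 'r) \<Rightarrow> 'x)" where
  "res_codiff R N n f = compose (carrier (res_mod R N (Suc n))) f (res_diff R N n)"

definition ext_cocycles ::
    "('r, 'e) ring_scheme \<Rightarrow> nat \<Rightarrow> ('r, 'n) module \<Rightarrow> ('r, 'x) module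
       \<Rightarrow> ((('r, 'n) syz \<Rightarrow> 'r) \<Rightarrow> 'x) set" where
  "ext_cocycles R i N X =
     a_kernel (Hom_module R (res_mod R N i) X) (Hom_module R (res_mod R N (Suc i)) X)
       (res_codiff R N i)"

definition ext_coboundaries ::
    "('r, 'e) ring_scheme \<Rightarrow> nat \<Rightarrow> ('r, 'n) module \<Rightarrow> ('r, 'x) module
       \<Rightarrow> ((('r, 'n) syz \<Rightarrow> 'r) \<Rightarrow> 'x) set" where
  "ext_coboundaries R i N X =
     (case i of
        0 \<Rightarrow> {\<zero>\<^bsub>Hom_module R (res_mod R N 0) X\<^esub>}
      | Suc j \<Rightarrow> res_codiff R N j ` carrier (Hom_module R (res_mod R N j) X))"

definition Ext ::
    "('r, 'e) ring_scheme \<Rightarrow> nat \<Rightarrow> ('r, 'n) module \<Rightarrow> ('r, 'x) module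
       \<Rightarrow> ('r, ((('r, 'n) syz \<Rightarrow> 'r) \<Rightarrow> 'x) set) module" where
  "Ext R i N X =
     quot_module ((Hom_module R (res_mod R N i) X)\<lparr>carrier := ext_cocycles R i N X\<rparr>)
       (ext_coboundaries R i N X)"

definition tor_diff ::
    "('r, 'e) ring_scheme \<Rightarrow> ('r, 'n) module \<Rightarrow> ('r, 'x) module \<Rightarrow> nat
       \<Rightarrow> ((('r, 'n) syz \<Rightarrow> 'r) \<times> 'x \<Rightarrow> 'r) set \<Rightarrow> ((('r, 'n) syz \<Rightarrow> 'r) \<times> 'x \<Rightarrow> 'r) set" where
  "tor_diff R N X n =
     tensor_map R (res_mod R N (Suc n)) (res_mod R N n) X (res_diff R N n)"

definition tor_cycles ::
    "('r, 'e) ring_scheme \<Rightarrow> nat \<Rightarrow> ('r, 'n) module \<Rightarrow> ('r, 'x) module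
       \<Rightarrow> ((('r, 'n) syz \<Rightarrow> 'r) \<times> 'x \<Rightarrow> 'r) set set" where
  "tor_cycles R i N X =
     (case i of
        0 \<Rightarrow> carrier (tensor_module R (res_mod R N 0) X)
      | Suc j \<Rightarrow> a_kernel (tensor_module R (res_mod R N (Suc j)) X)
                  (tensor_module R (res_mod R N j) X) (tor_diff R N X j))"

definition tor_boundaries ::
    "('r, 'e) ring_scheme \<Rightarrow> nat \<Rightarrow> ('r, 'n) module \<Rightarrow> ('r, 'x) module
       \<Rightarrow> ((('r, 'n) syz \<Rightarrow> 'r) \<times> 'x \<Rightarrow> 'r) set set" where
  "tor_boundaries R i N X =
     tor_diff R N X i ` carrier (tensor_module R (res_mod R N (Suc i)) X)"

definition Tor ::
    "('r, 'e) ring_scheme \<Rightarrow> nat \<Rightarrow> ('r, 'n) module \<Rightarrow> ('r, 'x) module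
       \<Rightarrow> ('r, ((('r, 'n) syz \<Rightarrow> 'r) \<times> 'x \<Rightarrow> 'r) set set) module" where
  "Tor R i N X =
     quot_module ((tensor_module R (res_mod R N i) X)\<lparr>carrier := tor_cycles R i N X\<rparr>)
       (tor_boundaries R i N X)"


section \<open>Serre subcategories\<close>

text \<open>
  The category of \<open>R\<close>-modules is represented by the modules whose carrier lies in one type \<open>'u\<close>,
  a full subcategory by the set of its objects. The first two closure conditions refer to arbitrary
  injective and surjective homomorphisms, so such a class is closed under isomorphism.
  Over a finite type \<open>'u\<close> an extension of two modules need not have a copy in \<open>'u\<close>, so that \<open>'u\<close> has to
  be infinite for the closure under extensions to have its usual meaning.
\<close>

definition serre_subcategory :: "('r, 'e) ring_scheme \<Rightarrow> ('r, 'u) module set \<Rightarrow> bool" where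
  "serre_subcategory R \<D> \<longleftrightarrow>
     (\<forall>M\<in>\<D>. module R M) \<and>
     (\<forall>A B f. module R A \<and> B \<in> \<D> \<and> f \<in> mod_hom R A B \<and> inj_on f (carrier A) \<longrightarrow> A \<in> \<D>) \<and>
     (\<forall>B C g. B \<in> \<D> \<and> module R C \<and> g \<in> mod_hom R B C \<and> g ` carrier B = carrier C \<longrightarrow> C \<in> \<D>) \<and>
     (\<forall>A B C f g. A \<in> \<D> \<and> module R B \<and> C \<in> \<D> \<and>
        f \<in> mod_hom R A B \<and> inj_on f (carrier A) \<and>
        g \<in> mod_hom R B C \<and> g ` carrier B = carrier C \<and>
        f ` carrier A = a_kernel B C g \<longrightarrow> B \<in> \<D>)"

text \<open>
  Membership of a module over another carrier type (such as \<open>Ext R i N X\<close>) means that it is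
  isomorphic to an object of the class.
\<close>

definition belongs_to :: "('r, 'e) ring_scheme \<Rightarrow> ('r, 'm) module \<Rightarrow> ('r, 'u) module set \<Rightarrow> bool" where
  "belongs_to R M \<D> \<longleftrightarrow> (\<exists>D\<in>\<D>. mod_iso R M D)"

end

theory Submission
  imports Defs
begin

text \<open>
  A finitely generated module has a finite chain of submodules with cyclic quotients \<open>R/J\<close>, and the
  support condition forces every element of \<open>\<aa>\<close> to be nilpotent modulo each such \<open>J\<close>. Since \<open>\<delta>\<close> is a Serre
  subcategory, exactness of \<open>Ext\<^sup>i(C, X) \<rightarrow> Ext\<^sup>i(B, X) \<rightarrow> Ext\<^sup>i(A, X)\<close> for a short exact sequence
  \<open>0 \<rightarrow> A \<rightarrow> B \<rightarrow> C \<rightarrow> 0\<close> reduces the claim to \<open>N = R/J\<close>.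

  Both remaining steps use the sequences \<open>0 \<rightarrow> R/(J : x) \<rightarrow> R/J \<rightarrow> R/(J + x R) \<rightarrow> 0\<close>. If \<open>\<aa> \<subseteq> J\<close>, one climbs
  from \<open>\<aa>\<close> to \<open>J\<close>, one generator at a time, by exactness of
  \<open>Ext\<^sup>i\<^sup>-\<^sup>1(R/(K : x), X) \<rightarrow> Ext\<^sup>i(R/(K + x R), X) \<rightarrow> Ext\<^sup>i(R/K, X)\<close> and induction on \<open>i\<close>. If \<open>J\<close> is a maximal
  counterexample with \<open>\<aa>\<close> not contained in \<open>J\<close>, a power \<open>y\<close> of an element of \<open>\<aa>\<close> satisfies \<open>y \<notin> J\<close> and
  \<open>y\<^sup>2 \<in> J\<close>, so that \<open>J : y\<close> and \<open>J + y R\<close> are strictly larger than \<open>J\<close>. The argument for Tor is the same.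

  The two exactness properties come from the standard resolution: for \<open>A \<subseteq> B\<close>, the standard resolution of
  \<open>A\<close> is spanned by a subset of the basis of that of \<open>B\<close>. The quotient is therefore a free resolution of
  \<open>B/A\<close>, the three resolutions form a degreewise split sequence, and any two free resolutions of \<open>B/A\<close>
  are homotopy equivalent.
\<close>

section \<open>Linear maps and submodules\<close>

text \<open>A Serre class consists of modules over one type, while \<open>Ext\<close>,
  \<open>Tor\<close> and the modules on the way have types of their own. The closure properties are
  therefore first transferred to \<open>belongs_to\<close>; every later exactness claim reduces to
  \<open>belongs_to_exact\<close>, which is checked on representatives, that is, on cocycles and
  cycles.

  In the climb from \<open>\<aa>\<close> to \<open>J\<close>, degree i at K + xR costs degree i - 1
  at K : x, an ideal that again contains \<open>\<aa>\<close>; hence the hypothesis in all degrees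
  up to t. Ext is contravariant and Tor covariant in the resolved module, yet in both the subobject
  A contributes degree i - 1 to degree i of the quotient C. This shared shape lets one locale,
  \<open>half_exact\<close>, carry the ideal-theoretic part.

  The inclusion of standard resolutions rests on the naming of generators: a formal linear
  combination of elements of A means the same in A and in B. Quotients have no such compatibility,
  so B/A is resolved by the leftover generators and then compared with its own standard
  resolution.\<close>

text \<open>Unlike \<open>mod_hom\<close>, this does not constrain the values outside the carrier.\<close>

definition linmap ::
    "('r, 'e) ring_scheme \<Rightarrow> ('r, 'm) module \<Rightarrow> ('r, 'n) module \<Rightarrow> ('m \<Rightarrow> 'n) \<Rightarrow> bool" where
  "linmap R M N f \<longleftrightarrow>
     (\<forall>x\<in>carrier M. f x \<in> carrier N) \<and>
     (\<forall>x\<in>carrier M. \<forall>y\<in>carrier M. f (x \<oplus>\<^bsub>M\<^esub> y) = f x \<oplus>\<^bsub>N\<^esub> f y) \<and>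
     (\<forall>r\<in>carrier R. \<forall>x\<in>carrier M. f (r \<odot>\<^bsub>M\<^esub> x) = r \<odot>\<^bsub>N\<^esub> f x)"

lemma linmapI:
  assumes "\<And>x. x \<in> carrier M \<Longrightarrow> f x \<in> carrier N"
    and "\<And>x y. x \<in> carrier M \<Longrightarrow> y \<in> carrier M \<Longrightarrow> f (x \<oplus>\<^bsub>M\<^esub> y) = f x \<oplus>\<^bsub>N\<^esub> f y"
    and "\<And>r x. r \<in> carrier R \<Longrightarrow> x \<in> carrier M \<Longrightarrow> f (r \<odot>\<^bsub>M\<^esub> x) = r \<odot>\<^bsub>N\<^esub> f x"
  shows "linmap R M N f"
  using assms by (auto simp: linmap_def)

lemma linmap_closed: "linmap R M N f \<Longrightarrow> x \<in> carrier M \<Longrightarrow> f x \<in> carrier N"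
  and linmap_add: "linmap R M N f \<Longrightarrow> x \<in> carrier M \<Longrightarrow> y \<in> carrier M \<Longrightarrow>
    f (x \<oplus>\<^bsub>M\<^esub> y) = f x \<oplus>\<^bsub>N\<^esub> f y"
  and linmap_smult: "linmap R M N f \<Longrightarrow> r \<in> carrier R \<Longrightarrow> x \<in> carrier M \<Longrightarrow>
    f (r \<odot>\<^bsub>M\<^esub> x) = r \<odot>\<^bsub>N\<^esub> f x"
  by (auto simp: linmap_def)

lemma linmap_zero:
  assumes "linmap R M N f" "module R M" "module R N"
  shows "f \<zero>\<^bsub>M\<^esub> = \<zero>\<^bsub>N\<^esub>"
proof -
  interpret M: module R M by (rule assms)
  interpret N: module R N by (rule assms)
  have "f (\<zero>\<^bsub>R\<^esub> \<odot>\<^bsub>M\<^esub> \<zero>\<^bsub>M\<^esub>) = \<zero>\<^bsub>R\<^esub> \<odot>\<^bsub>N\<^esub> f \<zero>\<^bsub>M\<^esub>"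
    using assms(1) by (intro linmap_smult) auto
  then show ?thesis using linmap_closed[OF assms(1)] by simp
qed

lemma (in abelian_group) minus_add_cancel:
  "x \<in> carrier G \<Longrightarrow> y \<in> carrier G \<Longrightarrow> (x \<ominus> y) \<oplus> y = x"
  by (simp add: minus_eq a_assoc l_neg)

lemma (in abelian_group) minus_self: "x \<in> carrier G \<Longrightarrow> x \<ominus> x = \<zero>"
  by (simp add: minus_eq r_neg)

lemma (in abelian_group) minus_eq_zeroD:
  assumes "x \<ominus> y = \<zero>" "x \<in> carrier G" "y \<in> carrier G"
  shows "x = y"
  using minus_add_cancel[OF assms(2,3)] assms by simp

lemma linmap_minus:
  assumes "linmap R M N f" "module R M" "module R N" "x \<in> carrier M" "y \<in> carrier M"
  shows "f (x \<ominus>\<^bsub>M\<^esub> y) = f x \<ominus>\<^bsub>N\<^esub> f y"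
proof -
  interpret M: module R M by (rule assms)
  interpret N: module R N by (rule assms)
  have "f ((x \<ominus>\<^bsub>M\<^esub> y) \<oplus>\<^bsub>M\<^esub> y) = f (x \<ominus>\<^bsub>M\<^esub> y) \<oplus>\<^bsub>N\<^esub> f y"
    using assms by (intro linmap_add) auto
  moreover have "(x \<ominus>\<^bsub>M\<^esub> y) \<oplus>\<^bsub>M\<^esub> y = x"
    using assms by (simp add: M.minus_eq M.a_assoc M.l_neg)
  moreover have "f x \<in> carrier N" "f y \<in> carrier N" "f (x \<ominus>\<^bsub>M\<^esub> y) \<in> carrier N"
    using assms linmap_closed[OF assms(1)] by auto
  ultimately show ?thesis by (simp add: N.minus_eq N.a_assoc N.r_neg)
qed

lemma linmap_mod_hom: "f \<in> mod_hom R M N \<Longrightarrow> linmap R M N f"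
  by (auto simp: mod_hom_def linmap_def)

lemma mod_hom_linmap: "linmap R M N f \<Longrightarrow> f \<in> extensional (carrier M) \<Longrightarrow> f \<in> mod_hom R M N"
  by (auto simp: mod_hom_def linmap_def PiE_def)

text \<open>The way back to \<open>mod_hom\<close>, whose members are \<open>undefined\<close> off
  the carrier. Maps can thus be written as plain lambda terms and restricted only where a Serre
  axiom or a Hom module asks for it.\<close>

lemma restrict_mod_hom:
  assumes "linmap R M N f" "module R M"
  shows "restrict f (carrier M) \<in> mod_hom R M N"
proof -
  interpret module R M by (rule assms)
  show ?thesis using assms(1) by (auto simp: mod_hom_def linmap_def)
qed

lemma linmap_comp:
  "linmap R M N f \<Longrightarrow> linmap R N P g \<Longrightarrow> linmap R M P (\<lambda>x. g (f x))"
  by (auto simp: linmap_def)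

lemma linmap_id: "linmap R M M (\<lambda>x. x)"
  by (auto simp: linmap_def)

lemma linmap_zero_fun:
  assumes "module R N"
  shows "linmap R M N (\<lambda>x. \<zero>\<^bsub>N\<^esub>)"
proof -
  interpret N: module R N by (rule assms)
  show ?thesis by (rule linmapI) auto
qed

lemma linmap_add_fun:
  assumes "linmap R M N f" "linmap R M N g" "module R N"
  shows "linmap R M N (\<lambda>x. f x \<oplus>\<^bsub>N\<^esub> g x)"
proof -
  interpret N: module R N by (rule assms)
  show ?thesis using assms(1,2)
    by (intro linmapI) (auto simp: linmap_def N.a_ac N.smult_r_distr)
qed

lemma linmap_minus_fun:
  assumes "linmap R M N f" "linmap R M N g" "module R N"
  shows "linmap R M N (\<lambda>x. f x \<ominus>\<^bsub>N\<^esub> g x)"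
proof -
  interpret N: module R N by (rule assms)
  show ?thesis using assms(1,2)
    by (intro linmapI)
      (auto simp: linmap_def N.a_ac N.smult_r_distr N.minus_eq N.minus_add N.smult_r_minus)
qed

lemma linmap_cong:
  assumes "linmap R M N f" "module R M" "\<And>x. x \<in> carrier M \<Longrightarrow> f x = g x"
  shows "linmap R M N g"
proof -
  interpret M: module R M by (rule assms)
  show ?thesis using assms(1)
    by (intro linmapI) (auto simp: linmap_def assms(3)[symmetric])
qed

section \<open>Submodules, their images and preimages\<close>

lemma submodule_subset: "submodule H R M \<Longrightarrow> H \<subseteq> carrier M"
  and submodule_zero: "submodule H R M \<Longrightarrow> \<zero>\<^bsub>M\<^esub> \<in> H"
  and submodule_add: "submodule H R M \<Longrightarrow> x \<in> H \<Longrightarrow> y \<in> H \<Longrightarrow> x \<oplus>\<^bsub>M\<^esub> y \<in> H"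
  and submodule_smult: "submodule H R M \<Longrightarrow> r \<in> carrier R \<Longrightarrow> x \<in> H \<Longrightarrow> r \<odot>\<^bsub>M\<^esub> x \<in> H"
  unfolding submodule_def submodule_axioms_def subgroup_def by auto

text \<open>Negatives are multiples by minus one, so closure under scalars already covers
  them.\<close>

lemma submoduleI':
  assumes "module R M" "H \<subseteq> carrier M" "\<zero>\<^bsub>M\<^esub> \<in> H"
    and "\<And>x y. x \<in> H \<Longrightarrow> y \<in> H \<Longrightarrow> x \<oplus>\<^bsub>M\<^esub> y \<in> H"
    and "\<And>r x. r \<in> carrier R \<Longrightarrow> x \<in> H \<Longrightarrow> r \<odot>\<^bsub>M\<^esub> x \<in> H"
  shows "submodule H R M"
proof -
  interpret module R M by (rule assms)
  have "\<ominus>\<^bsub>M\<^esub> x \<in> H" if "x \<in> H" for x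
  proof -
    have "(\<ominus>\<^bsub>R\<^esub> \<one>\<^bsub>R\<^esub>) \<odot>\<^bsub>M\<^esub> x \<in> H" using assms(5) that by simp
    then show ?thesis using that assms(2) by (auto simp: smult_l_minus)
  qed
  then show ?thesis using assms by (intro submoduleI) auto
qed

lemma submodule_minus:
  assumes "submodule H R M" "module R M" "x \<in> H" "y \<in> H"
  shows "x \<ominus>\<^bsub>M\<^esub> y \<in> H"
proof -
  interpret module R M by (rule assms)
  show ?thesis using submoduleE[OF assms(1)] assms by (simp add: minus_eq)
qed

lemma submodule_carrier: "module R M \<Longrightarrow> submodule (carrier M) R M"
  by (rule module.carrier_is_submodule)

lemma submodule_module: "submodule H R M \<Longrightarrow> module R M \<Longrightarrow> module R (M\<lparr>carrier := H\<rparr>)"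
  by (rule submodule.submodule_is_module)

lemma submodule_zero_set: "module R M \<Longrightarrow> submodule {\<zero>\<^bsub>M\<^esub>} R M"
proof -
  assume M: "module R M"
  interpret module R M by (rule M)
  show ?thesis by (rule submoduleI'[OF M]) auto
qed

lemma submodule_image:
  assumes "linmap R M N f" "module R M" "module R N" "submodule H R M"
  shows "submodule (f ` H) R N"
proof (rule submoduleI'[OF assms(3)])
  have H: "\<And>x. x \<in> H \<Longrightarrow> x \<in> carrier M" using submodule_subset[OF assms(4)] by auto
  show "f ` H \<subseteq> carrier N" using H linmap_closed[OF assms(1)] by auto
  show "\<zero>\<^bsub>N\<^esub> \<in> f ` H"
    using submodule_zero[OF assms(4)] linmap_zero[OF assms(1-3)] by (metis imageI)
  show "x \<oplus>\<^bsub>N\<^esub> y \<in> f ` H" if "x \<in> f ` H" "y \<in> f ` H" for x y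
    using that H submodule_add[OF assms(4)]
    by (auto simp flip: linmap_add[OF assms(1)])
  show "r \<odot>\<^bsub>N\<^esub> x \<in> f ` H" if "r \<in> carrier R" "x \<in> f ` H" for r x
    using that H submodule_smult[OF assms(4)] by (auto simp flip: linmap_smult[OF assms(1)])
qed

lemma a_kernel_eq: "a_kernel M N f = {x \<in> carrier M. f x = \<zero>\<^bsub>N\<^esub>}"
  by (simp add: a_kernel_def kernel_def)

lemma submodule_preimage:
  assumes "linmap R M N f" "module R M" "module R N" "submodule H R N"
  shows "submodule {x \<in> carrier M. f x \<in> H} R M"
proof -
  interpret M: module R M by (rule assms)
  show ?thesis
    by (rule submoduleI'[OF assms(2)])
      (auto simp: linmap_add[OF assms(1)] linmap_smult[OF assms(1)] linmap_zero[OF assms(1-3)]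
        submodule_zero[OF assms(4)] submodule_add[OF assms(4)] submodule_smult[OF assms(4)])
qed

lemma submodule_kernel:
  assumes "linmap R M N f" "module R M" "module R N"
  shows "submodule (a_kernel M N f) R M"
  using submodule_preimage[OF assms submodule_zero_set[OF assms(3)]] by (simp add: a_kernel_eq)

lemma linmap_inj_iff:
  assumes "linmap R M N f" "module R M" "module R N"
    and "\<And>x. x \<in> carrier M \<Longrightarrow> f x = \<zero>\<^bsub>N\<^esub> \<Longrightarrow> x = \<zero>\<^bsub>M\<^esub>"
  shows "inj_on f (carrier M)"
proof (rule inj_onI)
  interpret M: module R M by (rule assms)
  interpret N: module R N by (rule assms)
  fix x y assume xy: "x \<in> carrier M" "y \<in> carrier M" "f x = f y"
  then have "f (x \<ominus>\<^bsub>M\<^esub> y) = \<zero>\<^bsub>N\<^esub>"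
    using linmap_closed[OF assms(1)] by (simp add: linmap_minus[OF assms(1-3)] N.r_neg N.minus_eq)
  then have "x \<ominus>\<^bsub>M\<^esub> y = \<zero>\<^bsub>M\<^esub>" using assms(4) xy by auto
  then show "x = y" using M.minus_eq_zeroD xy by simp
qed

section \<open>Quotient modules\<close>

lemma submodule_abelian_subgroup:
  assumes "submodule K R M" "module R M"
  shows "abelian_subgroup K M"
proof -
  interpret M: module R M by (rule assms)
  show ?thesis
    using assms(1) unfolding submodule_def
    by (intro abelian_subgroupI3 additive_subgroup.intro) (auto simp: M.abelian_group_axioms)
qed

lemma coset_eq_iff:
  assumes "submodule K R M" "module R M" "x \<in> carrier M" "y \<in> carrier M"
  shows "K +>\<^bsub>M\<^esub> x = K +>\<^bsub>M\<^esub> y \<longleftrightarrow> x \<ominus>\<^bsub>M\<^esub> y \<in> K"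
proof -
  interpret M: module R M by (rule assms)
  interpret abelian_subgroup K M by (rule submodule_abelian_subgroup[OF assms(1,2)])
  have "x \<in> K +>\<^bsub>M\<^esub> y \<longleftrightarrow> x \<ominus>\<^bsub>M\<^esub> y \<in> K"
    using a_rcos_module[OF assms(4,3)] by (simp add: M.minus_eq)
  moreover have "K +>\<^bsub>M\<^esub> y = K +>\<^bsub>M\<^esub> x" if "x \<in> K +>\<^bsub>M\<^esub> y"
    using that assms(4) by (rule a_repr_independence')
  ultimately show ?thesis using a_rcos_self[OF assms(3)] by auto
qed

lemma coset_eq_self_iff:
  assumes "submodule K R M" "module R M" "x \<in> carrier M"
  shows "K +>\<^bsub>M\<^esub> x = K \<longleftrightarrow> x \<in> K"
proof -
  interpret M: module R M by (rule assms)
  interpret abelian_subgroup K M by (rule submodule_abelian_subgroup[OF assms(1,2)])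
  show ?thesis using a_rcos_self[OF assms(3)] a_rcos_const by auto
qed

lemma coset_memD:
  assumes "submodule K R M" "module R M" "x \<in> carrier M" "y \<in> K +>\<^bsub>M\<^esub> x"
  shows "y \<in> carrier M" "K +>\<^bsub>M\<^esub> y = K +>\<^bsub>M\<^esub> x"
proof -
  interpret M: module R M by (rule assms)
  interpret abelian_subgroup K M by (rule submodule_abelian_subgroup[OF assms(1,2)])
  show "y \<in> carrier M" using a_elemrcos_carrier[OF assms(3,4)] .
  show "K +>\<^bsub>M\<^esub> y = K +>\<^bsub>M\<^esub> x" using a_repr_independence'[OF assms(4,3)] by simp
qed

lemma coset_self:
  assumes "submodule K R M" "module R M" "x \<in> carrier M"
  shows "x \<in> K +>\<^bsub>M\<^esub> x"
proof -
  interpret abelian_subgroup K M by (rule submodule_abelian_subgroup[OF assms(1,2)])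
  show ?thesis using a_rcos_self[OF assms(3)] .
qed

lemma quot_carrier: "carrier (quot_module M K) = (\<lambda>x. K +>\<^bsub>M\<^esub> x) ` carrier M"
  by (auto simp: quot_module_def A_RCOSETS_def' )

lemma quot_zero: "\<zero>\<^bsub>quot_module M K\<^esub> = K"
  by (simp add: quot_module_def)

lemma quot_add:
  assumes "submodule K R M" "module R M" "x \<in> carrier M" "y \<in> carrier M"
  shows "(K +>\<^bsub>M\<^esub> x) \<oplus>\<^bsub>quot_module M K\<^esub> (K +>\<^bsub>M\<^esub> y) = K +>\<^bsub>M\<^esub> (x \<oplus>\<^bsub>M\<^esub> y)"
proof -
  interpret abelian_subgroup K M by (rule submodule_abelian_subgroup[OF assms(1,2)])
  show ?thesis using a_rcos_sum[OF assms(3,4)] by (simp add: quot_module_def)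
qed

lemma quot_smult:
  assumes "submodule K R M" "module R M" "r \<in> carrier R" "x \<in> carrier M"
  shows "r \<odot>\<^bsub>quot_module M K\<^esub> (K +>\<^bsub>M\<^esub> x) = K +>\<^bsub>M\<^esub> (r \<odot>\<^bsub>M\<^esub> x)"
proof -
  interpret M: module R M by (rule assms)
  have "K +>\<^bsub>M\<^esub> (r \<odot>\<^bsub>M\<^esub> y) = K +>\<^bsub>M\<^esub> (r \<odot>\<^bsub>M\<^esub> x)" if "y \<in> K +>\<^bsub>M\<^esub> x" for y
  proof -
    have y: "y \<in> carrier M" by (rule coset_memD(1)[OF assms(1,2,4) that])
    have "y \<ominus>\<^bsub>M\<^esub> x \<in> K"
      using coset_memD(2)[OF assms(1,2,4) that] coset_eq_iff[OF assms(1,2) y assms(4)] by blast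
    then have "r \<odot>\<^bsub>M\<^esub> (y \<ominus>\<^bsub>M\<^esub> x) \<in> K" by (rule submodule_smult[OF assms(1,3)])
    moreover have "r \<odot>\<^bsub>M\<^esub> (y \<ominus>\<^bsub>M\<^esub> x) = r \<odot>\<^bsub>M\<^esub> y \<ominus>\<^bsub>M\<^esub> r \<odot>\<^bsub>M\<^esub> x"
      using y assms(3,4) by (simp add: M.minus_eq M.smult_r_distr M.smult_r_minus)
    ultimately show ?thesis
      using coset_eq_iff[OF assms(1,2) M.smult_closed[OF assms(3) y] M.smult_closed[OF assms(3,4)]]
      by metis
  qed
  \<comment> \<open>The union over the coset collapses to its common value only because the coset is
    nonempty.\<close>
  moreover have "K +>\<^bsub>M\<^esub> x \<noteq> {}" using coset_self[OF assms(1,2,4)] by blast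
  ultimately have "(\<Union>y\<in>K +>\<^bsub>M\<^esub> x. K +>\<^bsub>M\<^esub> (r \<odot>\<^bsub>M\<^esub> y)) = K +>\<^bsub>M\<^esub> (r \<odot>\<^bsub>M\<^esub> x)"
    by (rule SUP_eq_const[rotated])
  then show ?thesis by (simp add: quot_module_def)
qed

lemma quot_module_module:
  assumes K: "submodule K R M" and M: "module R M"
  shows "module R (quot_module M K)"
proof -
  interpret M: module R M by (rule M)
  note q = quot_add[OF K M] quot_smult[OF K M]
  have z: "\<zero>\<^bsub>quot_module M K\<^esub> = K +>\<^bsub>M\<^esub> \<zero>\<^bsub>M\<^esub>"
    using coset_eq_self_iff[OF K M M.zero_closed] submodule_zero[OF K] by (simp add: quot_zero)
  show ?thesis
  proof (rule moduleI)
    show "abelian_group (quot_module M K)"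
    proof (rule abelian_groupI)
      fix x assume "x \<in> carrier (quot_module M K)"
      then obtain a where a: "a \<in> carrier M" "x = K +>\<^bsub>M\<^esub> a" by (auto simp: quot_carrier)
      then show "\<exists>y\<in>carrier (quot_module M K). y \<oplus>\<^bsub>quot_module M K\<^esub> x = \<zero>\<^bsub>quot_module M K\<^esub>"
        by (intro bexI[of _ "K +>\<^bsub>M\<^esub> (\<ominus>\<^bsub>M\<^esub> a)"]) (auto simp: q z quot_carrier M.l_neg)
    qed (auto simp: quot_carrier q z M.a_ac)
  qed (auto simp: quot_carrier q M.smult_l_distr M.smult_r_distr M.smult_assoc1 M.is_cring)
qed

lemma linmap_coset:
  assumes "submodule K R M" "module R M"
  shows "linmap R M (quot_module M K) (\<lambda>x. K +>\<^bsub>M\<^esub> x)"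
  by (rule linmapI) (auto simp: quot_carrier quot_add[OF assms] quot_smult[OF assms])

text \<open>Evaluating \<open>f\<close> at a representative picked by \<open>SOME\<close> is
  harmless: two representatives differ by an element of \<open>K\<close>, on which \<open>f\<close>
  vanishes.\<close>

lemma quot_induced:
  assumes f: "linmap R M N f" and M: "module R M" and N: "module R N" and K: "submodule K R M"
    and K0: "\<And>x. x \<in> K \<Longrightarrow> f x = \<zero>\<^bsub>N\<^esub>"
  obtains g where "g \<in> mod_hom R (quot_module M K) N"
    "\<And>x. x \<in> carrier M \<Longrightarrow> g (K +>\<^bsub>M\<^esub> x) = f x"
proof -
  interpret M: module R M by (rule M)
  interpret N: module R N by (rule N)
  let ?Q = "quot_module M K"
  define g where "g = restrict (\<lambda>A. f (SOME y. y \<in> A)) (carrier ?Q)"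
  have g: "g (K +>\<^bsub>M\<^esub> x) = f x" if x: "x \<in> carrier M" for x
  proof -
    define y where "y = (SOME y. y \<in> K +>\<^bsub>M\<^esub> x)"
    have "y \<in> K +>\<^bsub>M\<^esub> x" unfolding y_def using coset_self[OF K M x] by (rule someI)
    then have y: "y \<in> carrier M" and "K +>\<^bsub>M\<^esub> y = K +>\<^bsub>M\<^esub> x"
      using coset_memD[OF K M x] by blast+
    then have "y \<ominus>\<^bsub>M\<^esub> x \<in> K" using coset_eq_iff[OF K M y x] by blast
    then have "f y \<ominus>\<^bsub>N\<^esub> f x = \<zero>\<^bsub>N\<^esub>" using K0 linmap_minus[OF f M N y x] by metis
    then have "f y = f x" using N.minus_eq_zeroD x y linmap_closed[OF f] by simp
    then show ?thesis using x by (auto simp: g_def quot_carrier y_def)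
  qed
  have "linmap R ?Q N g"
    by (rule linmapI)
      (auto simp: quot_carrier g quot_add[OF K M] quot_smult[OF K M] linmap_closed[OF f]
        linmap_add[OF f] linmap_smult[OF f])
  then have "g \<in> mod_hom R ?Q N" by (rule mod_hom_linmap) (simp add: g_def)
  then show ?thesis using that g by blast
qed

section \<open>Serre subcategories up to isomorphism\<close>

lemma serre_module: "serre_subcategory R \<D> \<Longrightarrow> M \<in> \<D> \<Longrightarrow> module R M"
  unfolding serre_subcategory_def by (drule conjunct1) (rule bspec)

lemma serre_sub:
  assumes "serre_subcategory R \<D>" "module R A" "B \<in> \<D>" "f \<in> mod_hom R A B" "inj_on f (carrier A)"
  shows "A \<in> \<D>"
  by (rule assms(1)[unfolded serre_subcategory_def, THEN conjunct2, THEN conjunct1,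
        THEN spec[of _ A], THEN spec[of _ B], THEN spec[of _ f], THEN mp]) (intro conjI assms(2-))

lemma serre_quot:
  assumes "serre_subcategory R \<D>" "B \<in> \<D>" "module R C" "g \<in> mod_hom R B C"
    "g ` carrier B = carrier C"
  shows "C \<in> \<D>"
  by (rule assms(1)[unfolded serre_subcategory_def, THEN conjunct2, THEN conjunct2, THEN conjunct1,
        THEN spec[of _ B], THEN spec[of _ C], THEN spec[of _ g], THEN mp]) (intro conjI assms(2-))

lemma serre_extension:
  assumes "serre_subcategory R \<D>" "A \<in> \<D>" "module R B" "C \<in> \<D>"
    "f \<in> mod_hom R A B" "inj_on f (carrier A)" "g \<in> mod_hom R B C" "g ` carrier B = carrier C"
    "f ` carrier A = a_kernel B C g"
  shows "B \<in> \<D>"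
  by (rule assms(1)[unfolded serre_subcategory_def, THEN conjunct2, THEN conjunct2, THEN conjunct2,
        THEN spec[of _ A], THEN spec[of _ B], THEN spec[of _ C], THEN spec[of _ f],
        THEN spec[of _ g], THEN mp]) (intro conjI assms(2-))

text \<open>A Serre class can only contain a module whose carrier lies in its own type. A mere
  injection of the carrier into that type is enough to manufacture such a copy, because the
  structure is carried along it.\<close>

lemma transport_module:
  fixes M :: "('r, 'm) module" and j :: "'m \<Rightarrow> 'u"
  assumes M: "module R M" and j: "inj_on j (carrier M)"
  obtains M' :: "('r, 'u) module" where "module R M'" "carrier M' = j ` carrier M" "linmap R M M' j"
    "linmap R M' M (inv_into (carrier M) j)"
proof -
  interpret M: module R M by (rule M)
  define k where "k = inv_into (carrier M) j"
  define M' :: "('r, 'u) module" where "M' =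
    \<lparr>carrier = j ` carrier M, monoid.mult = undefined, one = undefined,
     ring.zero = j \<zero>\<^bsub>M\<^esub>, ring.add = (\<lambda>x y. j (k x \<oplus>\<^bsub>M\<^esub> k y)),
     smult = (\<lambda>r x. j (r \<odot>\<^bsub>M\<^esub> k x))\<rparr>"
  have k: "\<And>x. x \<in> carrier M \<Longrightarrow> k (j x) = x" using j by (simp add: k_def)
  have "module R M'"
  proof (rule moduleI)
    show "abelian_group M'"
    proof (rule abelian_groupI)
      fix x assume "x \<in> carrier M'"
      then obtain a where "a \<in> carrier M" "x = j a" by (auto simp: M'_def)
      then show "\<exists>y\<in>carrier M'. y \<oplus>\<^bsub>M'\<^esub> x = \<zero>\<^bsub>M'\<^esub>"
        by (intro bexI[of _ "j (\<ominus>\<^bsub>M\<^esub> a)"]) (auto simp: M'_def k M.l_neg)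
    qed (auto simp: M'_def k M.a_ac)
  qed (auto simp: M'_def k M.smult_l_distr M.smult_r_distr M.smult_assoc1 M.is_cring)
  moreover have "carrier M' = j ` carrier M" by (simp add: M'_def)
  moreover have "linmap R M M' j" by (rule linmapI) (auto simp: M'_def k)
  moreover have "linmap R M' M k" by (rule linmapI) (auto simp: M'_def k)
  ultimately show ?thesis using that unfolding k_def by blast
qed

lemma belongs_toI:
  assumes "module R M" "linmap R M D f" "inj_on f (carrier M)" "f ` carrier M = carrier D" "D \<in> \<D>"
  shows "belongs_to R M \<D>"
proof -
  have "bij_betw (restrict f (carrier M)) (carrier M) (carrier D)"
    using assms(3,4) by (simp add: bij_betw_def inj_on_def)
  then show ?thesis
    using restrict_mod_hom[OF assms(2,1)] assms(5) unfolding belongs_to_def mod_iso_def by blast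
qed

lemma belongs_toE:
  assumes "belongs_to R M \<D>" "module R M" "serre_subcategory R \<D>"
  obtains D f k where "D \<in> \<D>" "module R D" "linmap R M D f" "linmap R D M k"
    "\<And>x. x \<in> carrier M \<Longrightarrow> k (f x) = x" "\<And>y. y \<in> carrier D \<Longrightarrow> f (k y) = y"
proof -
  interpret M: module R M by (rule assms)
  obtain D f where D: "D \<in> \<D>" "f \<in> mod_hom R M D" and bij: "bij_betw f (carrier M) (carrier D)"
    using assms(1) unfolding belongs_to_def mod_iso_def by blast
  note f = linmap_mod_hom[OF D(2)]
  interpret D: module R D by (rule serre_module[OF assms(3) D(1)])
  define k where "k = inv_into (carrier M) f"
  have kf: "\<And>x. x \<in> carrier M \<Longrightarrow> k (f x) = x"
    using bij by (simp add: k_def bij_betw_def)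
  have surj: "\<And>y. y \<in> carrier D \<Longrightarrow> \<exists>x\<in>carrier M. y = f x"
    using bij unfolding bij_betw_def by blast
  have "linmap R D M k"
  proof (rule linmapI)
    fix x assume "x \<in> carrier D"
    then show "k x \<in> carrier M" using surj kf by metis
  next
    fix x y assume "x \<in> carrier D" "y \<in> carrier D"
    then obtain a b where ab: "a \<in> carrier M" "x = f a" "b \<in> carrier M" "y = f b"
      using surj by metis
    then show "k (x \<oplus>\<^bsub>D\<^esub> y) = k x \<oplus>\<^bsub>M\<^esub> k y"
      using kf linmap_add[OF f, of a b] M.a_closed by metis
  next
    fix r x assume r: "r \<in> carrier R" and "x \<in> carrier D"
    then obtain a where "a \<in> carrier M" "x = f a" using surj by metis
    then show "k (r \<odot>\<^bsub>D\<^esub> x) = r \<odot>\<^bsub>M\<^esub> k x"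
      using kf linmap_smult[OF f r, of a] M.smult_closed[OF r] by metis
  qed
  moreover have "\<And>y. y \<in> carrier D \<Longrightarrow> f (k y) = y" using surj kf by metis
  ultimately show ?thesis using that D(1) D.module_axioms f kf by blast
qed

text \<open>The copy is found inside the representative \<open>D\<close> of \<open>B\<close>, as the
  image of \<open>A\<close>.\<close>

lemma belongs_to_sub:
  assumes S: "serre_subcategory R \<D>" and B: "belongs_to R B \<D>" "module R B" and A: "module R A"
    and f: "linmap R A B f" "inj_on f (carrier A)"
  shows "belongs_to R A \<D>"
proof -
  obtain D h k where D: "D \<in> \<D>" "module R D" "linmap R B D h"
    and k: "\<And>x. x \<in> carrier B \<Longrightarrow> k (h x) = x"
    using belongs_toE[OF B S] by metis
  let ?I = "(\<lambda>x. h (f x)) ` carrier A"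
  have hf: "linmap R A D (\<lambda>x. h (f x))" by (rule linmap_comp[OF f(1) D(3)])
  have sub: "submodule ?I R D"
    by (rule submodule_image[OF hf A D(2) submodule_carrier[OF A]])
  have mod: "module R (D\<lparr>carrier := ?I\<rparr>)" by (rule submodule_module[OF sub D(2)])
  have incl: "linmap R (D\<lparr>carrier := ?I\<rparr>) D (\<lambda>x. x)"
    using submodule_subset[OF sub] by (intro linmapI) auto
  have "D\<lparr>carrier := ?I\<rparr> \<in> \<D>"
    by (rule serre_sub[OF S mod D(1) restrict_mod_hom[OF incl mod]]) (simp add: inj_on_def)
  moreover have "linmap R A (D\<lparr>carrier := ?I\<rparr>) (\<lambda>x. h (f x))"
    using hf by (auto simp: linmap_def)
  moreover have "inj_on (\<lambda>x. h (f x)) (carrier A)"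
  proof (rule inj_onI)
    fix x y assume xy: "x \<in> carrier A" "y \<in> carrier A" and "h (f x) = h (f y)"
    then have "f x = f y" using k linmap_closed[OF f(1)] by metis
    then show "x = y" using inj_onD[OF f(2)] xy by blast
  qed
  ultimately show ?thesis by (intro belongs_toI[OF A]) auto
qed

text \<open>A set-theoretic section of \<open>g\<close> places \<open>C\<close> inside the carrier
  of \<open>D\<close>. This injection \<open>j\<close> need not be linear; the structure transported
  along it turns the copy \<open>C'\<close> into a quotient of \<open>D\<close>.\<close>

lemma belongs_to_quot:
  fixes R :: "('r, 'e) ring_scheme" and \<D> :: "('r, 'u) module set"
  assumes S: "serre_subcategory R \<D>" and B: "belongs_to R B \<D>" "module R B" and C: "module R C"
    and g: "linmap R B C g" "g ` carrier B = carrier C"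
  shows "belongs_to R C \<D>"
proof -
  obtain D h k where D: "D \<in> \<D>" "module R D" "linmap R B D h" "linmap R D B k"
    and kh: "\<And>x. x \<in> carrier B \<Longrightarrow> k (h x) = x"
    using belongs_toE[OF B S] by metis
  define j where "j c = h (inv_into (carrier B) g c)" for c
  have gj: "g (k (j c)) = c" "j c \<in> carrier D" if "c \<in> carrier C" for c
    using that g(2) linmap_closed[OF D(3)] inv_into_into[of c g "carrier B"]
    by (auto simp: j_def kh f_inv_into_f)
  then have "inj_on j (carrier C)" by (metis inj_onI)
  then obtain C' :: "('r, 'u) module" where C': "module R C'" "carrier C' = j ` carrier C"
    "linmap R C C' j"
    using transport_module[OF C] by metis
  have lin: "linmap R D C' (\<lambda>x. j (g (k x)))"
    by (intro linmap_comp[OF linmap_comp[OF D(4) g(1)] C'(3)])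
  have "(\<lambda>x. j (g (k x))) ` carrier D = carrier C'"
    using gj linmap_closed[OF D(4)] linmap_closed[OF g(1)] unfolding C'(2)
    by (auto simp: image_iff) metis
  then have "C' \<in> \<D>"
    using restrict_mod_hom[OF lin D(2)] by (intro serre_quot[OF S D(1) C'(1), of "restrict _ _"]) auto
  then show ?thesis
    using \<open>inj_on j (carrier C)\<close> C' by (intro belongs_toI[OF C C'(3)]) auto
qed

text \<open>Fix a set-theoretic section \<open>s\<close> of \<open>g\<close>. Every \<open>b\<close>
  is \<open>f (a b)\<close> plus \<open>s (g b)\<close>, so it is determined by its two coordinates
  in the representatives of \<open>A\<close> and \<open>C\<close>. Coding this pair by one element
  of \<open>'u\<close> gives room for a copy of \<open>B\<close>.\<close>

lemma belongs_to_extension: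
  fixes R :: "('r, 'e) ring_scheme" and \<D> :: "('r, 'u) module set"
  assumes S: "serre_subcategory R \<D>" and inf: "infinite (UNIV :: 'u set)"
    and A: "belongs_to R A \<D>" "module R A" and B: "module R B" and C: "belongs_to R C \<D>" "module R C"
    and f: "linmap R A B f" "inj_on f (carrier A)" and g: "linmap R B C g" "g ` carrier B = carrier C"
    and ex: "f ` carrier A = a_kernel B C g"
  shows "belongs_to R B \<D>"
proof -
  interpret B: module R B by (rule B)
  interpret C: module R C by (rule C)
  obtain D h k where D: "D \<in> \<D>" "module R D" "linmap R A D h" "linmap R D A k"
    and kh: "\<And>x. x \<in> carrier A \<Longrightarrow> k (h x) = x" and hk: "\<And>x. x \<in> carrier D \<Longrightarrow> h (k x) = x"
    using belongs_toE[OF A S] by metis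
  obtain D' h' k' where D': "D' \<in> \<D>" "module R D'" "linmap R C D' h'" "linmap R D' C k'"
    and kh': "\<And>x. x \<in> carrier C \<Longrightarrow> k' (h' x) = x" and hk': "\<And>x. x \<in> carrier D' \<Longrightarrow> h' (k' x) = x"
    using belongs_toE[OF C S] by metis
  \<comment> \<open>Infinity of \<open>'u\<close> enters here: the square of an infinite set is no
    larger than the set, which yields the pairing \<open>p\<close>.\<close>
  have "(card_of (UNIV \<times> UNIV :: ('u \<times> 'u) set), card_of (UNIV :: 'u set)) \<in> ordLeq"
    using card_of_Times_same_infinite[OF inf] ordIso_iff_ordLeq by blast
  then obtain p :: "'u \<times> 'u \<Rightarrow> 'u" where p: "inj p"
    using card_of_ordLeq[of "UNIV \<times> UNIV :: ('u \<times> 'u) set" "UNIV :: 'u set"] by auto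
  define s where "s = inv_into (carrier B) g"
  have s: "s c \<in> carrier B" "g (s c) = c" if "c \<in> carrier C" for c
    using that g(2) by (auto simp: s_def inv_into_into f_inv_into_f)
  define a where "a b = inv_into (carrier A) f (b \<ominus>\<^bsub>B\<^esub> s (g b))" for b
  have a: "a b \<in> carrier A" "f (a b) = b \<ominus>\<^bsub>B\<^esub> s (g b)" if b: "b \<in> carrier B" for b
  proof -
    have gb: "g b \<in> carrier C" by (rule linmap_closed[OF g(1) b])
    have "b \<ominus>\<^bsub>B\<^esub> s (g b) \<in> f ` carrier A"
      using b s[OF gb] gb unfolding ex a_kernel_eq
      by (auto simp: linmap_minus[OF g(1) B C(2)] C.minus_eq C.r_neg)
    then show "a b \<in> carrier A" "f (a b) = b \<ominus>\<^bsub>B\<^esub> s (g b)"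
      unfolding a_def by (auto intro: inv_into_into f_inv_into_f)
  qed
  define j where "j b = p (h (a b), h' (g b))" for b
  have "inj_on j (carrier B)"
  proof (rule inj_onI)
    fix x y assume xy: "x \<in> carrier B" "y \<in> carrier B" and "j x = j y"
    then have "h (a x) = h (a y)" "h' (g x) = h' (g y)" using injD[OF p] by (auto simp: j_def)
    then have "a x = a y" "g x = g y" using a(1) xy kh kh' linmap_closed[OF g(1)] by metis+
    then have "x \<ominus>\<^bsub>B\<^esub> s (g x) = y \<ominus>\<^bsub>B\<^esub> s (g x)" using a(2) xy by metis
    then show "x = y"
      using B.minus_add_cancel[OF _ s(1)[OF linmap_closed[OF g(1) xy(1)]]] xy by metis
  qed
  then obtain B' :: "('r, 'u) module" where B': "module R B'" "carrier B' = j ` carrier B"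
    "linmap R B B' j" "linmap R B' B (inv_into (carrier B) j)"
    using transport_module[OF B] by metis
  define i where "i = inv_into (carrier B) j"
  have ij: "i (j b) = b" if "b \<in> carrier B" for b
    using that \<open>inj_on j (carrier B)\<close> by (simp add: i_def)
  have i: "linmap R B' B i" unfolding i_def by (rule B'(4))
  have f': "linmap R D B' (\<lambda>x. j (f (k x)))" by (intro linmap_comp[OF linmap_comp[OF D(4) f(1)] B'(3)])
  have g': "linmap R B' D' (\<lambda>x. h' (g (i x)))" by (intro linmap_comp[OF linmap_comp[OF i g(1)] D'(3)])
  have "B' \<in> \<D>"
  proof (rule serre_extension[OF S D(1) B'(1) D'(1) restrict_mod_hom[OF f' D(2)] _ restrict_mod_hom[OF g' B'(1)]])
    show "inj_on (\<lambda>x\<in>carrier D. j (f (k x))) (carrier D)"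
    proof (rule inj_onI)
      fix x y assume xy: "x \<in> carrier D" "y \<in> carrier D"
        and "(\<lambda>x\<in>carrier D. j (f (k x))) x = (\<lambda>x\<in>carrier D. j (f (k x))) y"
      then have "j (f (k x)) = j (f (k y))" by simp
      then have "f (k x) = f (k y)"
        using ij xy linmap_closed[OF f(1)] linmap_closed[OF D(4)] by metis
      then have "k x = k y" using inj_onD[OF f(2)] xy linmap_closed[OF D(4)] by blast
      then show "x = y" using hk xy by metis
    qed
    have "carrier D' \<subseteq> (\<lambda>x. h' (g (i x))) ` carrier B'"
    proof
      fix y assume y: "y \<in> carrier D'"
      then have "k' y \<in> g ` carrier B" using linmap_closed[OF D'(4)] g(2) by auto
      then obtain b where "b \<in> carrier B" "g b = k' y" by auto
      then show "y \<in> (\<lambda>x. h' (g (i x))) ` carrier B'"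
        using hk'[OF y] ij by (auto simp: B'(2) image_iff intro!: bexI[of _ b])
    qed
    then show "(\<lambda>x\<in>carrier B'. h' (g (i x))) ` carrier B' = carrier D'"
      using linmap_closed[OF g'] by auto
    have h0: "h' (g x) = \<zero>\<^bsub>D'\<^esub> \<longleftrightarrow> x \<in> f ` carrier A" if x: "x \<in> carrier B" for x
    proof -
      have "h' (g x) = \<zero>\<^bsub>D'\<^esub> \<longleftrightarrow> g x = \<zero>\<^bsub>C\<^esub>"
        using kh'[OF linmap_closed[OF g(1) x]] linmap_zero[OF D'(3) C(2) D'(2)]
          linmap_zero[OF D'(4) D'(2) C(2)] by metis
      then show ?thesis using x by (simp add: ex a_kernel_eq)
    qed
    have kA: "k ` carrier D = carrier A"
      using kh linmap_closed[OF D(3)] linmap_closed[OF D(4)] by force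
    have "(\<lambda>x. j (f (k x))) ` carrier D = j ` (f ` carrier A)"
      unfolding kA[symmetric] by (simp add: image_image)
    also have "\<dots> = {x \<in> carrier B'. h' (g (i x)) = \<zero>\<^bsub>D'\<^esub>}"
      using h0 ij linmap_closed[OF f(1)] unfolding B'(2) by auto
    finally show "(\<lambda>x\<in>carrier D. j (f (k x))) ` carrier D =
        a_kernel B' D' (\<lambda>x\<in>carrier B'. h' (g (i x)))"
      by (auto simp: a_kernel_eq)
  qed
  then show ?thesis
    using \<open>inj_on j (carrier B)\<close> B' by (intro belongs_toI[OF B B'(3)]) auto
qed

text \<open>The middle term is an extension of a submodule of the third term by a quotient of a
  submodule of the first. The condition \<open>ex\<close> expresses exactness on representatives:
  whatever \<open>\<beta>\<close> sends into \<open>K3\<close> comes from \<open>\<alpha>\<close> up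
  to \<open>K2\<close>.\<close>

lemma belongs_to_exact:
  fixes R :: "('r, 'e) ring_scheme" and \<D> :: "('r, 'u) module set"
  assumes S: "serre_subcategory R \<D>" and inf: "infinite (UNIV :: 'u set)"
    and M: "module R M1" "module R M2" "module R M3"
    and K: "submodule K1 R M1" "submodule K2 R M2" "submodule K3 R M3"
    and a: "linmap R M1 M2 \<alpha>" "\<And>x. x \<in> K1 \<Longrightarrow> \<alpha> x \<in> K2"
    and b: "linmap R M2 M3 \<beta>" "\<And>x. x \<in> K2 \<Longrightarrow> \<beta> x \<in> K3"
    and ex: "\<And>z. z \<in> carrier M2 \<Longrightarrow> \<beta> z \<in> K3 \<Longrightarrow>
      \<exists>y\<in>carrier M1. \<exists>k\<in>K2. z = \<alpha> y \<oplus>\<^bsub>M2\<^esub> k"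
    and bel: "belongs_to R (quot_module M1 K1) \<D>" "belongs_to R (quot_module M3 K3) \<D>"
  shows "belongs_to R (quot_module M2 K2) \<D>"
proof -
  let ?Q1 = "quot_module M1 K1" and ?Q2 = "quot_module M2 K2" and ?Q3 = "quot_module M3 K3"
  have Q: "module R ?Q1" "module R ?Q2" "module R ?Q3"
    using quot_module_module M K by blast+
  interpret M2: module R M2 by (rule M)
  obtain A where A: "A \<in> mod_hom R ?Q1 ?Q2" "\<And>x. x \<in> carrier M1 \<Longrightarrow> A (K1 +>\<^bsub>M1\<^esub> x) = K2 +>\<^bsub>M2\<^esub> \<alpha> x"
  proof (rule quot_induced[OF linmap_comp[OF a(1) linmap_coset[OF K(2) M(2)]] M(1) Q(2) K(1)])
    fix x assume "x \<in> K1"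
    then show "K2 +>\<^bsub>M2\<^esub> \<alpha> x = \<zero>\<^bsub>?Q2\<^esub>"
      using a(2) coset_eq_self_iff[OF K(2) M(2)] submodule_subset[OF K(2)] by (auto simp: quot_zero)
  qed blast
  obtain B where B: "B \<in> mod_hom R ?Q2 ?Q3" "\<And>x. x \<in> carrier M2 \<Longrightarrow> B (K2 +>\<^bsub>M2\<^esub> x) = K3 +>\<^bsub>M3\<^esub> \<beta> x"
  proof (rule quot_induced[OF linmap_comp[OF b(1) linmap_coset[OF K(3) M(3)]] M(2) Q(3) K(2)])
    fix x assume "x \<in> K2"
    then show "K3 +>\<^bsub>M3\<^esub> \<beta> x = \<zero>\<^bsub>?Q3\<^esub>"
      using b(2) coset_eq_self_iff[OF K(3) M(3)] submodule_subset[OF K(3)] by (auto simp: quot_zero)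
  qed blast
  note AL = linmap_mod_hom[OF A(1)] and BL = linmap_mod_hom[OF B(1)]
  let ?N = "a_kernel ?Q2 ?Q3 B" and ?I = "B ` carrier ?Q2"
  have N: "submodule ?N R ?Q2" by (rule submodule_kernel[OF BL Q(2,3)])
  have I: "submodule ?I R ?Q3" by (rule submodule_image[OF BL Q(2,3) submodule_carrier[OF Q(2)]])
  have bI: "belongs_to R (?Q3\<lparr>carrier := ?I\<rparr>) \<D>"
    by (rule belongs_to_sub[OF S bel(2) Q(3) submodule_module[OF I Q(3)], of "\<lambda>x. x"])
      (use submodule_subset[OF I] in \<open>auto intro!: linmapI simp: inj_on_def\<close>)
  \<comment> \<open>\<open>ex\<close> puts the kernel inside the image of \<open>A\<close> but does
    not bound the image, so the kernel is covered by just the part of \<open>?Q1\<close> that lands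
    in it.\<close>
  let ?P = "{x \<in> carrier ?Q1. A x \<in> ?N}"
  have P: "submodule ?P R ?Q1" by (rule submodule_preimage[OF AL Q(1,2) N])
  have bP: "belongs_to R (?Q1\<lparr>carrier := ?P\<rparr>) \<D>"
    by (rule belongs_to_sub[OF S bel(1) Q(1) submodule_module[OF P Q(1)], of "\<lambda>x. x"])
      (auto intro!: linmapI simp: inj_on_def)
  have bN: "belongs_to R (?Q2\<lparr>carrier := ?N\<rparr>) \<D>"
  proof (rule belongs_to_quot[OF S bP submodule_module[OF P Q(1)] submodule_module[OF N Q(2)], of A])
    show "linmap R (?Q1\<lparr>carrier := ?P\<rparr>) (?Q2\<lparr>carrier := ?N\<rparr>) A"
      using AL by (auto simp: linmap_def)
    have "?N \<subseteq> A ` ?P"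
    proof
      fix w assume w: "w \<in> ?N"
      then obtain z where z: "z \<in> carrier M2" "w = K2 +>\<^bsub>M2\<^esub> z" by (auto simp: a_kernel_eq quot_carrier)
      then have "K3 +>\<^bsub>M3\<^esub> \<beta> z = K3" using w B(2) by (simp add: a_kernel_eq quot_zero)
      then have "\<beta> z \<in> K3" using coset_eq_self_iff[OF K(3) M(3)] linmap_closed[OF b(1) z(1)] by simp
      then obtain y k where y: "y \<in> carrier M1" "k \<in> K2" "z = \<alpha> y \<oplus>\<^bsub>M2\<^esub> k" using ex z by blast
      have c: "\<alpha> y \<in> carrier M2" "k \<in> carrier M2"
        using linmap_closed[OF a(1)] y submodule_subset[OF K(2)] by auto
      have "z \<ominus>\<^bsub>M2\<^esub> \<alpha> y = k" using c y(3) by (simp add: M2.minus_eq M2.a_ac M2.r_neg2 M2.r_neg1 M2.r_neg)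
      then have "A (K1 +>\<^bsub>M1\<^esub> y) = w"
        using coset_eq_iff[OF K(2) M(2) z(1) c(1)] y z A(2) by simp
      then show "w \<in> A ` ?P" using w y by (auto simp: quot_carrier)
    qed
    then show "A ` carrier (?Q1\<lparr>carrier := ?P\<rparr>) = carrier (?Q2\<lparr>carrier := ?N\<rparr>)" by auto
  qed
  show ?thesis
  proof (rule belongs_to_extension[OF S inf bN submodule_module[OF N Q(2)] Q(2) bI submodule_module[OF I Q(3)], of "\<lambda>x. x" B])
    show "linmap R (?Q2\<lparr>carrier := ?N\<rparr>) ?Q2 (\<lambda>x. x)"
      using submodule_subset[OF N] by (intro linmapI) auto
    show "linmap R ?Q2 (?Q3\<lparr>carrier := ?I\<rparr>) B" using BL by (auto simp: linmap_def)
  qed (auto simp: inj_on_def a_kernel_eq)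
qed

section \<open>Chain maps between free resolutions\<close>

lemma lin_comb_Cons:
  assumes "cring R" "set (p # l) \<subseteq> carrier R \<times> B"
  shows "lin_comb R (p # l) = fst p \<odot>\<^bsub>free_module R B\<^esub> free_gen R (snd p) \<oplus>\<^bsub>free_module R B\<^esub> lin_comb R l"
proof -
  interpret cring R by (rule assms)
  have "lin_comb R l b \<in> carrier R" for b
    using lin_comb_closed[OF assms(1), of l B] assms(2) by (auto simp: free_module_def)
  moreover have "fst p \<in> carrier R" using assms(2) by auto
  ultimately show ?thesis by (auto simp: free_module_def free_gen_def fun_eq_iff)
qed

text \<open>Every element of a free module is the value of some list under \<open>lin_comb\<close>,
  so agreement on generators spreads by induction on that list.\<close>

lemma free_linmap_eq:
  assumes "cring R" "module R N" "linmap R (free_module R B) N f" "linmap R (free_module R B) N g"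
    and eq: "\<And>b. b \<in> B \<Longrightarrow> f (free_gen R b) = g (free_gen R b)"
    and c: "c \<in> carrier (free_module R B)"
  shows "f c = g c"
proof -
  note F = free_module_is_module[OF assms(1), of B]
  have "f (lin_comb R l) = g (lin_comb R l)" if "set l \<subseteq> carrier R \<times> B" for l
    using that
  proof (induction l)
    case Nil
    have "lin_comb R [] = \<zero>\<^bsub>free_module R B\<^esub>" by (simp add: free_module_def)
    then show ?case
      using linmap_zero[OF assms(3) F assms(2)] linmap_zero[OF assms(4) F assms(2)] by metis
  next
    case (Cons p l)
    have p: "fst p \<in> carrier R" "free_gen R (snd p) \<in> carrier (free_module R B)"
      using Cons.prems free_gen_closed[OF assms(1), of "snd p" B] by auto
    have l: "lin_comb R l \<in> carrier (free_module R B)"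
      using lin_comb_closed[OF assms(1), of l B] Cons.prems by auto
    have s: "fst p \<odot>\<^bsub>free_module R B\<^esub> free_gen R (snd p) \<in> carrier (free_module R B)"
      using p by (rule module.smult_closed[OF F])
    have "f (free_gen R (snd p)) = g (free_gen R (snd p))" using Cons.prems by (intro eq) auto
    then show ?case
      using Cons unfolding lin_comb_Cons[OF assms(1) Cons.prems] linmap_add[OF assms(3) s l]
        linmap_add[OF assms(4) s l] linmap_smult[OF assms(3) p] linmap_smult[OF assms(4) p]
      by simp
  qed
  then show ?thesis using lin_comb_surj[OF assms(1) c] by metis
qed

text \<open>Projectivity of free modules relative to the image of \<open>p\<close>: differentials
  are onto kernels only, so the lift is asked for just where \<open>g\<close> has its values in that
  image.\<close>

lemma free_lift:
  assumes M: "module R M" and N: "module R N" and g: "linmap R (free_module R B) N g"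
    and p: "linmap R M N p"
    and im: "\<And>c. c \<in> carrier (free_module R B) \<Longrightarrow> g c \<in> p ` carrier M"
  shows "\<exists>f. linmap R (free_module R B) M f \<and> (\<forall>c\<in>carrier (free_module R B). p (f c) = g c)"
proof -
  interpret M: module R M by (rule M)
  note cr = M.is_cring
  define \<phi> where "\<phi> b = inv_into (carrier M) p (g (free_gen R b))" for b
  have \<phi>: "\<phi> b \<in> carrier M" "p (\<phi> b) = g (free_gen R b)" if "b \<in> B" for b
    using im[OF free_gen_closed[OF cr that]] unfolding \<phi>_def
    by (auto intro: inv_into_into f_inv_into_f)
  then have \<phi>B: "\<phi> \<in> B \<rightarrow> carrier M" by auto
  have f: "linmap R (free_module R B) M (lin_ext R B M \<phi>)"
    by (rule linmap_mod_hom[OF lin_ext_hom[OF M \<phi>B]])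
  have "p (lin_ext R B M \<phi> c) = g c" if "c \<in> carrier (free_module R B)" for c
    by (rule free_linmap_eq[OF cr N linmap_comp[OF f p] g _ that])
      (simp add: lin_ext_free_gen[OF M \<phi>B] \<phi>)
  then show ?thesis using f by blast
qed

text \<open>All bases are subsets of one type, as in the standard resolution, so that a
  subresolution is given by smaller subsets and a quotient by their complements.\<close>

definition free_resolution ::
    "('r, 'e) ring_scheme \<Rightarrow> (nat \<Rightarrow> 'b set) \<Rightarrow> (nat \<Rightarrow> ('b \<Rightarrow> 'r) \<Rightarrow> ('b \<Rightarrow> 'r)) \<Rightarrow>
      ('r, 'c) module \<Rightarrow> (('b \<Rightarrow> 'r) \<Rightarrow> 'c) \<Rightarrow> bool" where
  "free_resolution R Bs d C \<epsilon> \<longleftrightarrow> module R C \<and>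
     linmap R (free_module R (Bs 0)) C \<epsilon> \<and>
     \<epsilon> ` carrier (free_module R (Bs 0)) = carrier C \<and>
     (\<forall>n. linmap R (free_module R (Bs (Suc n))) (free_module R (Bs n)) (d n)) \<and>
     d 0 ` carrier (free_module R (Bs (Suc 0))) = a_kernel (free_module R (Bs 0)) C \<epsilon> \<and>
     (\<forall>n. d (Suc n) ` carrier (free_module R (Bs (Suc (Suc n)))) =
        a_kernel (free_module R (Bs (Suc n))) (free_module R (Bs n)) (d n))"

locale free_res =
  fixes R :: "('r, 'e) ring_scheme" and Bs :: "nat \<Rightarrow> 'b set" and d and C :: "('r, 'c) module" and \<epsilon>
  assumes res: "free_resolution R Bs d C \<epsilon>"
begin

abbreviation F :: "nat \<Rightarrow> ('r, 'b \<Rightarrow> 'r) module" where "F n \<equiv> free_module R (Bs n)"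

lemma C: "module R C" and aug: "linmap R (F 0) C \<epsilon>" and aug_surj: "\<epsilon> ` carrier (F 0) = carrier C"
  and d: "linmap R (F (Suc n)) (F n) (d n)"
  and ex0: "d 0 ` carrier (F (Suc 0)) = a_kernel (F 0) C \<epsilon>"
  and ex: "d (Suc n) ` carrier (F (Suc (Suc n))) = a_kernel (F (Suc n)) (F n) (d n)"
  using res unfolding free_resolution_def by blast+

lemma cring: "cring R"
  using C by (simp add: module_def)

lemma F: "module R (F n)"
  by (rule free_module_is_module[OF cring])

lemma aug_d: "x \<in> carrier (F (Suc 0)) \<Longrightarrow> \<epsilon> (d 0 x) = \<zero>\<^bsub>C\<^esub>"
  using ex0 by (auto simp: a_kernel_eq)

lemma dd: "x \<in> carrier (F (Suc (Suc n))) \<Longrightarrow> d n (d (Suc n) x) = \<zero>\<^bsub>F n\<^esub>"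
  using ex[of n] by (auto simp: a_kernel_eq)

lemma ex0D: "x \<in> carrier (F 0) \<Longrightarrow> \<epsilon> x = \<zero>\<^bsub>C\<^esub> \<Longrightarrow> x \<in> d 0 ` carrier (F (Suc 0))"
  using ex0 by (auto simp: a_kernel_eq)

lemma exD: "x \<in> carrier (F (Suc n)) \<Longrightarrow> d n x = \<zero>\<^bsub>F n\<^esub> \<Longrightarrow> x \<in> d (Suc n) ` carrier (F (Suc (Suc n)))"
  using ex[of n] by (auto simp: a_kernel_eq)

end

text \<open>Comparison theorem over the identity of \<open>C\<close>: exactness of the target lets
  each component be lifted through \<open>d'\<close> from the preceding one.\<close>

lemma chain_lift:
  assumes P: "free_resolution R Ps d C \<epsilon>" and Q: "free_resolution R Qs d' C \<epsilon>'"
  obtains f where "\<And>n. linmap R (free_module R (Ps n)) (free_module R (Qs n)) (f n)"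
    "\<And>x. x \<in> carrier (free_module R (Ps 0)) \<Longrightarrow> \<epsilon>' (f 0 x) = \<epsilon> x"
    "\<And>n x. x \<in> carrier (free_module R (Ps (Suc n))) \<Longrightarrow> d' n (f (Suc n) x) = f n (d n x)"
proof -
  interpret P: free_res R Ps d C \<epsilon> by unfold_locales (rule P)
  interpret Q: free_res R Qs d' C \<epsilon>' by unfold_locales (rule Q)
  \<comment> \<open>The clause on images is what makes the next lift possible: \<open>f\<close>
    after \<open>d n\<close> must land where \<open>d' n\<close> can be inverted. The clause for
    \<open>n = 0\<close> carries the compatibility with the augmentations through the choice
    principle.\<close>
  define ok where "ok n f \<longleftrightarrow> linmap R (P.F n) (Q.F n) f \<and>
    (\<forall>x\<in>carrier (P.F (Suc n)). f (d n x) \<in> d' n ` carrier (Q.F (Suc n))) \<and>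
    (n = 0 \<longrightarrow> (\<forall>x\<in>carrier (P.F 0). \<epsilon>' (f x) = \<epsilon> x))" for n f
  have "\<exists>f. \<forall>n. ok n (f n) \<and> (\<forall>x\<in>carrier (P.F (Suc n)). d' n (f (Suc n) x) = f n (d n x))"
  proof (rule dependent_nat_choice)
    have "\<epsilon> c \<in> \<epsilon>' ` carrier (Q.F 0)" if "c \<in> carrier (P.F 0)" for c
      using linmap_closed[OF P.aug that] unfolding Q.aug_surj .
    from free_lift[OF Q.F Q.C P.aug Q.aug this]
    obtain f where f: "linmap R (P.F 0) (Q.F 0) f" "\<And>c. c \<in> carrier (P.F 0) \<Longrightarrow> \<epsilon>' (f c) = \<epsilon> c"
      by blast
    have "f (d 0 x) \<in> d' 0 ` carrier (Q.F (Suc 0))" if x: "x \<in> carrier (P.F (Suc 0))" for x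
    proof (rule Q.ex0D)
      have dx: "d 0 x \<in> carrier (P.F 0)" by (rule linmap_closed[OF P.d x])
      show "f (d 0 x) \<in> carrier (Q.F 0)" by (rule linmap_closed[OF f(1) dx])
      show "\<epsilon>' (f (d 0 x)) = \<zero>\<^bsub>C\<^esub>" using f(2)[OF dx] P.aug_d[OF x] by simp
    qed
    then have "ok 0 f" unfolding ok_def by (intro conjI ballI impI f)
    then show "\<exists>f. ok 0 f" by (intro exI)
  next
    fix f n assume "ok n f"
    then have f: "linmap R (P.F n) (Q.F n) f"
      and im: "\<And>x. x \<in> carrier (P.F (Suc n)) \<Longrightarrow> f (d n x) \<in> d' n ` carrier (Q.F (Suc n))"
      unfolding ok_def by blast+
    from free_lift[OF Q.F Q.F linmap_comp[OF P.d f] Q.d im]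
    obtain g where g: "linmap R (P.F (Suc n)) (Q.F (Suc n)) g"
      "\<And>c. c \<in> carrier (P.F (Suc n)) \<Longrightarrow> d' n (g c) = f (d n c)" by blast
    have "g (d (Suc n) x) \<in> d' (Suc n) ` carrier (Q.F (Suc (Suc n)))"
      if x: "x \<in> carrier (P.F (Suc (Suc n)))" for x
    proof (rule Q.exD)
      have dx: "d (Suc n) x \<in> carrier (P.F (Suc n))" by (rule linmap_closed[OF P.d x])
      show "g (d (Suc n) x) \<in> carrier (Q.F (Suc n))" by (rule linmap_closed[OF g(1) dx])
      show "d' n (g (d (Suc n) x)) = \<zero>\<^bsub>Q.F n\<^esub>"
        using g(2)[OF dx] P.dd[OF x] linmap_zero[OF f P.F Q.F] by simp
    qed
    then have "ok (Suc n) g" unfolding ok_def by (intro conjI ballI impI g) simp_all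
    then show "\<exists>y. ok (Suc n) y \<and> (\<forall>x\<in>carrier (P.F (Suc n)). d' n (y x) = f (d n x))"
      using g(2) by (intro exI[of _ g] conjI ballI)
  qed
  then obtain f where f: "\<And>n. ok n (f n)"
    and df: "\<And>n x. x \<in> carrier (P.F (Suc n)) \<Longrightarrow> d' n (f (Suc n) x) = f n (d n x)" by blast
  have "linmap R (P.F n) (Q.F n) (f n)" for n using f[of n] unfolding ok_def by (rule conjunct1)
  moreover have "\<epsilon>' (f 0 x) = \<epsilon> x" if "x \<in> carrier (P.F 0)" for x
    using f[of 0] that unfolding ok_def by simp
  ultimately show ?thesis using df by (rule that)
qed

text \<open>In each degree \<open>u - h d\<close> is a cycle of the target, hence a boundary, and
  the next \<open>h\<close> lifts it. Degree 0 has its own equation since no differential leaves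
  it.\<close>

lemma chain_null_homotopy:
  assumes P: "free_resolution R Ps d C \<epsilon>" and Q: "free_resolution R Qs d' C' \<epsilon>'"
    and u: "\<And>n. linmap R (free_module R (Ps n)) (free_module R (Qs n)) (u n)"
    and u0: "\<And>x. x \<in> carrier (free_module R (Ps 0)) \<Longrightarrow> \<epsilon>' (u 0 x) = \<zero>\<^bsub>C'\<^esub>"
    and ud: "\<And>n x. x \<in> carrier (free_module R (Ps (Suc n))) \<Longrightarrow> d' n (u (Suc n) x) = u n (d n x)"
  obtains h where "\<And>n. linmap R (free_module R (Ps n)) (free_module R (Qs (Suc n))) (h n)"
    "\<And>x. x \<in> carrier (free_module R (Ps 0)) \<Longrightarrow> u 0 x = d' 0 (h 0 x)"
    "\<And>n x. x \<in> carrier (free_module R (Ps (Suc n))) \<Longrightarrow>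
       u (Suc n) x = d' (Suc n) (h (Suc n) x) \<oplus>\<^bsub>free_module R (Qs (Suc n))\<^esub> h n (d n x)"
proof -
  interpret P: free_res R Ps d C \<epsilon> by unfold_locales (rule P)
  interpret Q: free_res R Qs d' C' \<epsilon>' by unfold_locales (rule Q)
  define ok where "ok n h \<longleftrightarrow> linmap R (P.F n) (Q.F (Suc n)) h \<and>
    (\<forall>x\<in>carrier (P.F (Suc n)). d' n (u (Suc n) x \<ominus>\<^bsub>Q.F (Suc n)\<^esub> h (d n x)) = \<zero>\<^bsub>Q.F n\<^esub>) \<and>
    (n = 0 \<longrightarrow> (\<forall>x\<in>carrier (P.F 0). d' 0 (h x) = u 0 x))" for n h
  have "\<exists>h. \<forall>n. ok n (h n) \<and> (\<forall>x\<in>carrier (P.F (Suc n)).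
     d' (Suc n) (h (Suc n) x) = u (Suc n) x \<ominus>\<^bsub>Q.F (Suc n)\<^esub> h n (d n x))"
  proof (rule dependent_nat_choice)
    interpret Q0: module R "Q.F 0" by (rule Q.F)
    have "u 0 c \<in> d' 0 ` carrier (Q.F (Suc 0))" if "c \<in> carrier (P.F 0)" for c
      using linmap_closed[OF u that] u0[OF that] by (rule Q.ex0D)
    from free_lift[OF Q.F Q.F u Q.d this]
    obtain h where h: "linmap R (P.F 0) (Q.F (Suc 0)) h" "\<And>c. c \<in> carrier (P.F 0) \<Longrightarrow> d' 0 (h c) = u 0 c"
      by blast
    have "d' 0 (u (Suc 0) x \<ominus>\<^bsub>Q.F (Suc 0)\<^esub> h (d 0 x)) = \<zero>\<^bsub>Q.F 0\<^esub>"
      if x: "x \<in> carrier (P.F (Suc 0))" for x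
    proof -
      have dx: "d 0 x \<in> carrier (P.F 0)" by (rule linmap_closed[OF P.d x])
      have "d' 0 (u (Suc 0) x \<ominus>\<^bsub>Q.F (Suc 0)\<^esub> h (d 0 x)) = d' 0 (u (Suc 0) x) \<ominus>\<^bsub>Q.F 0\<^esub> d' 0 (h (d 0 x))"
        by (rule linmap_minus[OF Q.d Q.F Q.F linmap_closed[OF u x] linmap_closed[OF h(1) dx]])
      then show ?thesis
        using h(2)[OF dx] ud[OF x] Q0.minus_self linmap_closed[OF u dx] by simp
    qed
    then have "ok 0 h" unfolding ok_def by (intro conjI ballI impI h)
    then show "\<exists>h. ok 0 h" by (intro exI)
  next
    fix h n assume "ok n h"
    then have h: "linmap R (P.F n) (Q.F (Suc n)) h"
      and im: "\<And>x. x \<in> carrier (P.F (Suc n)) \<Longrightarrow>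
        d' n (u (Suc n) x \<ominus>\<^bsub>Q.F (Suc n)\<^esub> h (d n x)) = \<zero>\<^bsub>Q.F n\<^esub>"
      unfolding ok_def by blast+
    interpret Q1: module R "Q.F (Suc n)" by (rule Q.F)
    let ?v = "\<lambda>x. u (Suc n) x \<ominus>\<^bsub>Q.F (Suc n)\<^esub> h (d n x)"
    have v: "linmap R (P.F (Suc n)) (Q.F (Suc n)) ?v"
      by (rule linmap_minus_fun[OF u linmap_comp[OF P.d h] Q.F])
    have "?v c \<in> d' (Suc n) ` carrier (Q.F (Suc (Suc n)))" if "c \<in> carrier (P.F (Suc n))" for c
      using linmap_closed[OF v that] im[OF that] by (rule Q.exD)
    from free_lift[OF Q.F Q.F v Q.d this]
    obtain k where k: "linmap R (P.F (Suc n)) (Q.F (Suc (Suc n))) k"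
      "\<And>c. c \<in> carrier (P.F (Suc n)) \<Longrightarrow> d' (Suc n) (k c) = ?v c" by blast
    have "d' (Suc n) (u (Suc (Suc n)) x \<ominus>\<^bsub>Q.F (Suc (Suc n))\<^esub> k (d (Suc n) x)) = \<zero>\<^bsub>Q.F (Suc n)\<^esub>"
      if x: "x \<in> carrier (P.F (Suc (Suc n)))" for x
    proof -
      have dx: "d (Suc n) x \<in> carrier (P.F (Suc n))" by (rule linmap_closed[OF P.d x])
      have "d' (Suc n) (u (Suc (Suc n)) x \<ominus>\<^bsub>Q.F (Suc (Suc n))\<^esub> k (d (Suc n) x)) =
          d' (Suc n) (u (Suc (Suc n)) x) \<ominus>\<^bsub>Q.F (Suc n)\<^esub> d' (Suc n) (k (d (Suc n) x))"
        by (rule linmap_minus[OF Q.d Q.F Q.F linmap_closed[OF u x] linmap_closed[OF k(1) dx]])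
      \<comment> \<open>\<open>k(2)\<close> at \<open>d (Suc n) x\<close> yields the inner
        difference; its last term is \<open>h\<close> applied to two consecutive differentials,
        hence zero.\<close>
      also have "\<dots> = u (Suc n) (d (Suc n) x) \<ominus>\<^bsub>Q.F (Suc n)\<^esub>
          (u (Suc n) (d (Suc n) x) \<ominus>\<^bsub>Q.F (Suc n)\<^esub> \<zero>\<^bsub>Q.F (Suc n)\<^esub>)"
        using k(2)[OF dx] ud[OF x] P.dd[OF x] linmap_zero[OF h P.F Q.F] by simp
      also have "\<dots> = \<zero>\<^bsub>Q.F (Suc n)\<^esub>"
        using linmap_closed[OF u dx] Q1.minus_add_cancel[OF linmap_closed[OF u dx] Q1.zero_closed]
        by (simp add: Q1.minus_self)
      finally show ?thesis .
    qed
    then have "ok (Suc n) k" unfolding ok_def by (intro conjI ballI impI k) simp_all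
    then show "\<exists>y. ok (Suc n) y \<and> (\<forall>x\<in>carrier (P.F (Suc n)). d' (Suc n) (y x) = ?v x)"
      using k(2) by (intro exI[of _ k] conjI ballI)
  qed
  then obtain h where h: "\<And>n. ok n (h n)"
    and dh: "\<And>n x. x \<in> carrier (P.F (Suc n)) \<Longrightarrow>
      d' (Suc n) (h (Suc n) x) = u (Suc n) x \<ominus>\<^bsub>Q.F (Suc n)\<^esub> h n (d n x)" by blast
  have hl: "linmap R (P.F n) (Q.F (Suc n)) (h n)" for n using h[of n] unfolding ok_def by (rule conjunct1)
  show ?thesis
  proof (rule that[OF hl])
    show "u 0 x = d' 0 (h 0 x)" if "x \<in> carrier (P.F 0)" for x
      using h[of 0] that unfolding ok_def by simp
    show "u (Suc n) x = d' (Suc n) (h (Suc n) x) \<oplus>\<^bsub>Q.F (Suc n)\<^esub> h n (d n x)"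
      if x: "x \<in> carrier (P.F (Suc n))" for n x
    proof -
      interpret Q1: module R "Q.F (Suc n)" by (rule Q.F)
      show ?thesis
        using dh[OF x] Q1.minus_add_cancel[OF linmap_closed[OF u x]
          linmap_closed[OF hl linmap_closed[OF P.d x]]] by simp
    qed
  qed
qed

text \<open>The chain map \<open>id - g f\<close> vanishes under the augmentation, hence is
  null-homotopic. One homotopy is enough for the later use: it makes the homology or cohomology of
  \<open>P\<close> a quotient of that of \<open>Q\<close>, and exchanging the resolutions gives the
  converse.\<close>

lemma resolution_comparison:
  assumes P: "free_resolution R Ps d C \<epsilon>" and Q: "free_resolution R Qs d' C \<epsilon>'"
  obtains f g h where
    "\<And>n. linmap R (free_module R (Ps n)) (free_module R (Qs n)) (f n)"
    "\<And>n. linmap R (free_module R (Qs n)) (free_module R (Ps n)) (g n)"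
    "\<And>n. linmap R (free_module R (Ps n)) (free_module R (Ps (Suc n))) (h n)"
    "\<And>n x. x \<in> carrier (free_module R (Ps (Suc n))) \<Longrightarrow> d' n (f (Suc n) x) = f n (d n x)"
    "\<And>n x. x \<in> carrier (free_module R (Qs (Suc n))) \<Longrightarrow> d n (g (Suc n) x) = g n (d' n x)"
    "\<And>x. x \<in> carrier (free_module R (Ps 0)) \<Longrightarrow> x = g 0 (f 0 x) \<oplus>\<^bsub>free_module R (Ps 0)\<^esub> d 0 (h 0 x)"
    "\<And>n x. x \<in> carrier (free_module R (Ps (Suc n))) \<Longrightarrow>
       x = g (Suc n) (f (Suc n) x) \<oplus>\<^bsub>free_module R (Ps (Suc n))\<^esub>
         (d (Suc n) (h (Suc n) x) \<oplus>\<^bsub>free_module R (Ps (Suc n))\<^esub> h n (d n x))"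
proof -
  interpret P: free_res R Ps d C \<epsilon> by unfold_locales (rule P)
  interpret Q: free_res R Qs d' C \<epsilon>' by unfold_locales (rule Q)
  obtain f where f: "\<And>n. linmap R (P.F n) (Q.F n) (f n)"
    "\<And>x. x \<in> carrier (P.F 0) \<Longrightarrow> \<epsilon>' (f 0 x) = \<epsilon> x"
    "\<And>n x. x \<in> carrier (P.F (Suc n)) \<Longrightarrow> d' n (f (Suc n) x) = f n (d n x)"
    using chain_lift[OF P Q] by blast
  obtain g where g: "\<And>n. linmap R (Q.F n) (P.F n) (g n)"
    "\<And>x. x \<in> carrier (Q.F 0) \<Longrightarrow> \<epsilon> (g 0 x) = \<epsilon>' x"
    "\<And>n x. x \<in> carrier (Q.F (Suc n)) \<Longrightarrow> d n (g (Suc n) x) = g n (d' n x)"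
    using chain_lift[OF Q P] by blast
  have gf: "linmap R (P.F n) (P.F n) (\<lambda>x. g n (f n x))" for n by (rule linmap_comp[OF f(1) g(1)])
  let ?u = "\<lambda>n x. x \<ominus>\<^bsub>P.F n\<^esub> g n (f n x)"
  have u: "linmap R (P.F n) (P.F n) (?u n)" for n
    by (rule linmap_minus_fun[OF linmap_id gf P.F])
  have "\<epsilon> (?u 0 x) = \<zero>\<^bsub>C\<^esub>" if x: "x \<in> carrier (P.F 0)" for x
  proof -
    interpret C: module R C by (rule P.C)
    show ?thesis
      using linmap_minus[OF P.aug P.F P.C x linmap_closed[OF gf x]] f(2)[OF x]
        g(2)[OF linmap_closed[OF f(1) x]] C.minus_self[OF linmap_closed[OF P.aug x]] by simp
  qed
  moreover have "d n (?u (Suc n) x) = ?u n (d n x)" if x: "x \<in> carrier (P.F (Suc n))" for n x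
    using linmap_minus[OF P.d P.F P.F x linmap_closed[OF gf x]] f(3)[OF x]
      g(3)[OF linmap_closed[OF f(1) x]] by simp
  ultimately obtain h where h: "\<And>n. linmap R (P.F n) (P.F (Suc n)) (h n)"
    "\<And>x. x \<in> carrier (P.F 0) \<Longrightarrow> ?u 0 x = d 0 (h 0 x)"
    "\<And>n x. x \<in> carrier (P.F (Suc n)) \<Longrightarrow>
      ?u (Suc n) x = d (Suc n) (h (Suc n) x) \<oplus>\<^bsub>P.F (Suc n)\<^esub> h n (d n x)"
    using chain_null_homotopy[OF P P u] by blast
  have e: "x = g n (f n x) \<oplus>\<^bsub>P.F n\<^esub> ?u n x" if x: "x \<in> carrier (P.F n)" for n x
  proof -
    interpret Pn: module R "P.F n" by (rule P.F)
    show ?thesis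
      using Pn.minus_add_cancel[OF x linmap_closed[OF gf x]] x linmap_closed[OF gf x]
      by (simp add: Pn.a_comm)
  qed
  show ?thesis
  proof (rule that[OF f(1) g(1) h(1) f(3) g(3)])
    show "x = g 0 (f 0 x) \<oplus>\<^bsub>P.F 0\<^esub> d 0 (h 0 x)" if "x \<in> carrier (P.F 0)" for x
      using e[OF that] h(2)[OF that] by metis
    show "x = g (Suc n) (f (Suc n) x) \<oplus>\<^bsub>P.F (Suc n)\<^esub>
        (d (Suc n) (h (Suc n) x) \<oplus>\<^bsub>P.F (Suc n)\<^esub> h n (d n x))"
      if "x \<in> carrier (P.F (Suc n))" for n x
      using e[OF that] h(3)[OF that] by metis
  qed
qed

text \<open>\<open>belongs_to_exact\<close> wants a third term in the class; the zero map to
  \<open>M1/K1\<close> provides one whose membership is already at hand.\<close>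

lemma belongs_to_surj:
  fixes R :: "('r, 'e) ring_scheme" and \<D> :: "('r, 'u) module set"
  assumes S: "serre_subcategory R \<D>" and inf: "infinite (UNIV :: 'u set)"
    and M: "module R M1" "module R M2" and K: "submodule K1 R M1" "submodule K2 R M2"
    and a: "linmap R M1 M2 \<alpha>" "\<And>x. x \<in> K1 \<Longrightarrow> \<alpha> x \<in> K2"
    and ex: "\<And>z. z \<in> carrier M2 \<Longrightarrow> \<exists>y\<in>carrier M1. \<exists>k\<in>K2. z = \<alpha> y \<oplus>\<^bsub>M2\<^esub> k"
    and bel: "belongs_to R (quot_module M1 K1) \<D>"
  shows "belongs_to R (quot_module M2 K2) \<D>"
proof (rule belongs_to_exact[OF S inf M M(1) K K(1) a linmap_zero_fun[OF M(1)] _ _ bel bel])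
  show "\<zero>\<^bsub>M1\<^esub> \<in> K1" by (rule submodule_zero[OF K(1)])
  show "\<exists>y\<in>carrier M1. \<exists>k\<in>K2. z = \<alpha> y \<oplus>\<^bsub>M2\<^esub> k" if "z \<in> carrier M2" for z
    by (rule ex[OF that])
qed

text \<open>Dually to \<open>belongs_to_surj\<close>, the zero map from \<open>M3/K3\<close> serves
  as the first map.\<close>

lemma belongs_to_inj:
  fixes R :: "('r, 'e) ring_scheme" and \<D> :: "('r, 'u) module set"
  assumes S: "serre_subcategory R \<D>" and inf: "infinite (UNIV :: 'u set)"
    and M: "module R M2" "module R M3" and K: "submodule K2 R M2" "submodule K3 R M3"
    and b: "linmap R M2 M3 \<beta>" "\<And>x. x \<in> K2 \<Longrightarrow> \<beta> x \<in> K3"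
    and ex: "\<And>z. z \<in> carrier M2 \<Longrightarrow> \<beta> z \<in> K3 \<Longrightarrow> z \<in> K2"
    and bel: "belongs_to R (quot_module M3 K3) \<D>"
  shows "belongs_to R (quot_module M2 K2) \<D>"
proof (rule belongs_to_exact[OF S inf M(2) M K(2) K linmap_zero_fun[OF M(1)] _ b _ bel bel])
  interpret M2: module R M2 by (rule M)
  interpret M3: module R M3 by (rule M)
  show "\<zero>\<^bsub>M2\<^esub> \<in> K2" by (rule submodule_zero[OF K(1)])
  show "\<exists>y\<in>carrier M3. \<exists>k\<in>K2. z = \<zero>\<^bsub>M2\<^esub> \<oplus>\<^bsub>M2\<^esub> k"
    if "z \<in> carrier M2" "\<beta> z \<in> K3" for z
    using ex[OF that] that(1) M3.zero_closed by (intro bexI[of _ "\<zero>\<^bsub>M3\<^esub>"] bexI[of _ z]) auto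
qed

lemma submodule_restrict_carrier:
  assumes "submodule K R M" "submodule Z R M" "K \<subseteq> Z" "module R M"
  shows "submodule K R (M\<lparr>carrier := Z\<rparr>)"
  by (rule submoduleI'[OF submodule_module[OF assms(2,4)]])
    (use assms(3) submodule_zero[OF assms(1)] submodule_add[OF assms(1)]
       submodule_smult[OF assms(1)] in auto)

section \<open>Ext from an arbitrary free resolution\<close>

lemma mod_hom_eqI:
  assumes "f \<in> mod_hom R M N" "g \<in> mod_hom R M N" "\<And>x. x \<in> carrier M \<Longrightarrow> f x = g x"
  shows "f = g"
proof -
  have "f \<in> extensional (carrier M)" "g \<in> extensional (carrier M)"
    using assms(1,2) by (auto simp: mod_hom_def PiE_def)
  then show ?thesis using assms(3) by (rule extensionalityI)
qed

lemma Hom_module_simps: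
  "carrier (Hom_module R M N) = mod_hom R M N"
  "\<zero>\<^bsub>Hom_module R M N\<^esub> = (\<lambda>x\<in>carrier M. \<zero>\<^bsub>N\<^esub>)"
  "f \<oplus>\<^bsub>Hom_module R M N\<^esub> g = (\<lambda>x\<in>carrier M. f x \<oplus>\<^bsub>N\<^esub> g x)"
  "r \<odot>\<^bsub>Hom_module R M N\<^esub> f = (\<lambda>x\<in>carrier M. r \<odot>\<^bsub>N\<^esub> f x)"
  by (simp_all add: Hom_module_def)

lemma linmap_smult_fun:
  assumes "linmap R M N f" "module R N" "r \<in> carrier R"
  shows "linmap R M N (\<lambda>x. r \<odot>\<^bsub>N\<^esub> f x)"
proof -
  interpret N: module R N by (rule assms)
  have "r \<odot>\<^bsub>N\<^esub> (s \<odot>\<^bsub>N\<^esub> f x) = s \<odot>\<^bsub>N\<^esub> (r \<odot>\<^bsub>N\<^esub> f x)"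
    if "s \<in> carrier R" "x \<in> carrier M" for s x
    using that assms(3) linmap_closed[OF assms(1)] N.smult_assoc1 N.R.m_comm by metis
  then show ?thesis
    using assms(1,3) by (intro linmapI) (auto simp: linmap_def N.smult_r_distr)
qed

lemma Hom_module_module:
  assumes M: "module R M" and N: "module R N"
  shows "module R (Hom_module R M N)"
proof -
  interpret M: module R M by (rule M)
  interpret N: module R N by (rule N)
  let ?H = "Hom_module R M N"
  note lin = linmap_mod_hom
  have cl: "f x \<in> carrier N" if "f \<in> mod_hom R M N" "x \<in> carrier M" for f x
    using linmap_closed[OF lin] that .
  have add: "(\<lambda>x\<in>carrier M. f x \<oplus>\<^bsub>N\<^esub> g x) \<in> mod_hom R M N"
    if "f \<in> mod_hom R M N" "g \<in> mod_hom R M N" for f g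
    by (rule restrict_mod_hom[OF linmap_add_fun[OF lin[OF that(1)] lin[OF that(2)] N] M])
  have zero: "(\<lambda>x\<in>carrier M. \<zero>\<^bsub>N\<^esub>) \<in> mod_hom R M N"
    by (rule restrict_mod_hom[OF linmap_zero_fun[OF N] M])
  have sm: "(\<lambda>x\<in>carrier M. r \<odot>\<^bsub>N\<^esub> f x) \<in> mod_hom R M N"
    if "r \<in> carrier R" "f \<in> mod_hom R M N" for f r
    by (rule restrict_mod_hom[OF linmap_smult_fun[OF lin[OF that(2)] N that(1)] M])
  have res: "(\<lambda>x\<in>carrier M. f x) = f" if "f \<in> mod_hom R M N" for f
    using that by (auto simp: mod_hom_def PiE_restrict)
  show ?thesis
  proof (rule moduleI)
    show "abelian_group ?H"
    proof (rule abelian_groupI)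
      fix f assume f: "f \<in> carrier ?H"
      let ?g = "\<lambda>x\<in>carrier M. (\<ominus>\<^bsub>R\<^esub> \<one>\<^bsub>R\<^esub>) \<odot>\<^bsub>N\<^esub> f x"
      have "?g \<oplus>\<^bsub>?H\<^esub> f = \<zero>\<^bsub>?H\<^esub>"
        using f cl by (auto simp: Hom_module_simps N.smult_l_minus N.l_neg intro!: restrict_ext)
      moreover have "?g \<in> carrier ?H" using sm f by (simp add: Hom_module_simps)
      ultimately show "\<exists>g\<in>carrier ?H. g \<oplus>\<^bsub>?H\<^esub> f = \<zero>\<^bsub>?H\<^esub>" by blast
    next
      fix f assume "f \<in> carrier ?H"
      then show "\<zero>\<^bsub>?H\<^esub> \<oplus>\<^bsub>?H\<^esub> f = f"
        using cl res[of f] by (simp add: Hom_module_simps cong: restrict_cong)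
    qed (auto simp: Hom_module_simps add zero cl N.a_ac intro!: restrict_ext)
  next
    fix f assume "f \<in> carrier ?H"
    then show "\<one>\<^bsub>R\<^esub> \<odot>\<^bsub>?H\<^esub> f = f"
      using cl res[of f] by (simp add: Hom_module_simps cong: restrict_cong)
  qed (auto simp: Hom_module_simps sm cl N.smult_l_distr N.smult_r_distr N.smult_assoc1 M.is_cring
      intro!: restrict_ext)
qed

lemma compose_mod_hom:
  assumes "linmap R M M' f" "module R M" "\<phi> \<in> mod_hom R M' N"
  shows "compose (carrier M) \<phi> f \<in> mod_hom R M N"
  using restrict_mod_hom[OF linmap_comp[OF assms(1) linmap_mod_hom[OF assms(3)]] assms(2)]
  by (simp add: compose_def)

lemma linmap_pull:
  assumes f: "linmap R M M' f" and M: "module R M"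
  shows "linmap R (Hom_module R M' N) (Hom_module R M N) (\<lambda>\<phi>. compose (carrier M) \<phi> f)"
proof (rule linmapI)
  show "compose (carrier M) \<phi> f \<in> carrier (Hom_module R M N)"
    if "\<phi> \<in> carrier (Hom_module R M' N)" for \<phi>
    using compose_mod_hom[OF f M] that by (simp add: Hom_module_simps)
qed (auto simp: Hom_module_simps compose_def linmap_closed[OF f] intro!: restrict_ext)

text \<open>The cocycles of \<open>Ext\<close> with the standard resolution replaced by any family
  of bases and differentials; the quotient of two standard resolutions is of this more general kind.
  \<open>ext_B\<close> and \<open>ext_res\<close> follow suit.\<close>

definition ext_Z where
  "ext_Z R X Bs d i = a_kernel (Hom_module R (free_module R (Bs i)) X)
     (Hom_module R (free_module R (Bs (Suc i))) X)
     (\<lambda>\<phi>. compose (carrier (free_module R (Bs (Suc i)))) \<phi> (d i))"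

definition ext_B where
  "ext_B R X Bs d i = (case i of
     0 \<Rightarrow> {\<zero>\<^bsub>Hom_module R (free_module R (Bs 0)) X\<^esub>}
   | Suc j \<Rightarrow> (\<lambda>\<phi>. compose (carrier (free_module R (Bs (Suc j)))) \<phi> (d j)) `
       carrier (Hom_module R (free_module R (Bs j)) X))"

definition ext_res where
  "ext_res R X Bs d i =
     quot_module ((Hom_module R (free_module R (Bs i)) X)\<lparr>carrier := ext_Z R X Bs d i\<rparr>)
       (ext_B R X Bs d i)"

lemma Ext_eq_ext_res: "Ext R i N X = ext_res R X (res_basis R N) (res_diff R N) i"
proof -
  have "ext_cocycles R i N X = ext_Z R X (res_basis R N) (res_diff R N) i"
    unfolding ext_cocycles_def ext_Z_def res_mod_def a_kernel_eq res_codiff_def by simp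
  moreover have "ext_coboundaries R i N X = ext_B R X (res_basis R N) (res_diff R N) i"
    unfolding ext_coboundaries_def ext_B_def res_mod_def res_codiff_def by simp
  ultimately show ?thesis by (simp add: Ext_def ext_res_def res_mod_def)
qed

locale coeff_res = free_res R Bs d C \<epsilon>
  for R :: "('r, 'e) ring_scheme" and Bs :: "nat \<Rightarrow> 'b set" and d and C :: "('r, 'c) module" and \<epsilon> +
  fixes X :: "('r, 'x) module"
  assumes X: "module R X"
begin

abbreviation H :: "nat \<Rightarrow> ('r, ('b \<Rightarrow> 'r) \<Rightarrow> 'x) module" where "H i \<equiv> Hom_module R (F i) X"
abbreviation Z where "Z i \<equiv> ext_Z R X Bs d i"
abbreviation B where "B i \<equiv> ext_B R X Bs d i"
abbreviation Zm where "Zm i \<equiv> (H i)\<lparr>carrier := Z i\<rparr>"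

lemma H: "module R (H i)"
  by (rule Hom_module_module[OF F X])

text \<open>Pointwise criteria such as this one let cocycle and coboundary conditions be checked on
  elements instead of extensional functions.\<close>

lemma mem_Z: "\<phi> \<in> Z i \<longleftrightarrow> \<phi> \<in> mod_hom R (F i) X \<and> (\<forall>x\<in>carrier (F (Suc i)). \<phi> (d i x) = \<zero>\<^bsub>X\<^esub>)"
  by (auto simp: ext_Z_def a_kernel_eq Hom_module_simps compose_def restrict_def fun_eq_iff)

lemma mem_B0: "\<phi> \<in> B 0 \<longleftrightarrow> \<phi> \<in> mod_hom R (F 0) X \<and> (\<forall>x\<in>carrier (F 0). \<phi> x = \<zero>\<^bsub>X\<^esub>)"
proof -
  have z: "(\<lambda>x\<in>carrier (F 0). \<zero>\<^bsub>X\<^esub>) \<in> mod_hom R (F 0) X"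
    by (rule restrict_mod_hom[OF linmap_zero_fun[OF X] F])
  have "\<phi> = (\<lambda>x\<in>carrier (F 0). \<zero>\<^bsub>X\<^esub>) \<longleftrightarrow>
      \<phi> \<in> mod_hom R (F 0) X \<and> (\<forall>x\<in>carrier (F 0). \<phi> x = \<zero>\<^bsub>X\<^esub>)" (is "?l \<longleftrightarrow> ?r")
  proof
    assume ?l then show ?r using z by simp
  next
    assume ?r then show ?l using mod_hom_eqI[OF _ z, of \<phi>] by simp
  qed
  then show ?thesis by (simp add: ext_B_def Hom_module_simps)
qed

lemma mem_BSuc: "\<phi> \<in> B (Suc j) \<longleftrightarrow> \<phi> \<in> mod_hom R (F (Suc j)) X \<and>
    (\<exists>\<psi>\<in>mod_hom R (F j) X. \<forall>x\<in>carrier (F (Suc j)). \<phi> x = \<psi> (d j x))" (is "?l \<longleftrightarrow> ?r")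
proof -
  have c: "compose (carrier (F (Suc j))) \<psi> (d j) \<in> mod_hom R (F (Suc j)) X"
    if "\<psi> \<in> mod_hom R (F j) X" for \<psi>
    by (rule compose_mod_hom[OF d F that])
  show ?thesis
  proof
    assume ?l then show ?r using c by (auto simp: ext_B_def Hom_module_simps compose_def)
  next
    assume ?r
    then obtain \<psi> where *: "\<phi> \<in> mod_hom R (F (Suc j)) X" "\<psi> \<in> mod_hom R (F j) X"
      "\<And>x. x \<in> carrier (F (Suc j)) \<Longrightarrow> \<phi> x = \<psi> (d j x)" by blast
    have "\<phi> = compose (carrier (F (Suc j))) \<psi> (d j)"
      by (rule mod_hom_eqI[OF *(1) c[OF *(2)]]) (simp add: *(3) compose_def)
    then show ?l using *(2) by (auto simp: ext_B_def Hom_module_simps)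
  qed
qed

lemma Z: "submodule (Z i) R (H i)"
  unfolding ext_Z_def by (rule submodule_kernel[OF linmap_pull[OF d F] H H])

lemma B_Z: "B i \<subseteq> Z i"
proof
  fix \<phi> assume "\<phi> \<in> B i"
  then show "\<phi> \<in> Z i"
  proof (cases i)
    case 0
    then show ?thesis using \<open>\<phi> \<in> B i\<close> mem_B0 linmap_closed[OF d] by (auto simp: mem_Z)
  next
    case (Suc j)
    then obtain \<psi> where *: "\<phi> \<in> mod_hom R (F (Suc j)) X" "\<psi> \<in> mod_hom R (F j) X"
      "\<And>x. x \<in> carrier (F (Suc j)) \<Longrightarrow> \<phi> x = \<psi> (d j x)" using mem_BSuc \<open>\<phi> \<in> B i\<close> by blast
    have "\<phi> (d (Suc j) x) = \<zero>\<^bsub>X\<^esub>" if "x \<in> carrier (F (Suc (Suc j)))" for x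
      using *(3)[OF linmap_closed[OF d that]] dd[OF that]
        linmap_zero[OF linmap_mod_hom[OF *(2)] F X] by simp
    then show ?thesis using * Suc by (simp add: mem_Z)
  qed
qed

lemma B: "submodule (B i) R (Zm i)"
proof (rule submodule_restrict_carrier[OF _ Z B_Z H])
  show "submodule (B i) R (H i)"
  proof (cases i)
    case 0
    then show ?thesis using submodule_zero_set[OF H[of 0]] by (simp add: ext_B_def)
  next
    case (Suc j)
    then show ?thesis
      using submodule_image[OF linmap_pull[OF d F] H H submodule_carrier[OF H]]
      by (simp add: ext_B_def)
  qed
qed

lemma HZ: "module R (Zm i)"
  by (rule submodule_module[OF Z H])

end

text \<open>A cocycle \<open>z\<close> satisfies \<open>z d = 0\<close>, so applying it to the
  homotopy identity \<open>id = g f + d h + h d\<close> leaves \<open>z = z g f + z h d\<close>. The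
  last term is the coboundary of \<open>z h\<close>; hence pulling back along \<open>f\<close>
  reaches every class.\<close>

lemma ext_res_comparison:
  fixes R :: "('r, 'e) ring_scheme" and \<D> :: "('r, 'u) module set"
  assumes S: "serre_subcategory R \<D>" and inf: "infinite (UNIV :: 'u set)" and X: "module R X"
    and P: "free_resolution R Ps d C \<epsilon>" and Q: "free_resolution R Qs d' C \<epsilon>'"
    and bel: "belongs_to R (ext_res R X Qs d' i) \<D>"
  shows "belongs_to R (ext_res R X Ps d i) \<D>"
proof -
  interpret P: coeff_res R Ps d C \<epsilon> X by (intro coeff_res.intro free_res.intro coeff_res_axioms.intro P X)
  interpret Q: coeff_res R Qs d' C \<epsilon>' X by (intro coeff_res.intro free_res.intro coeff_res_axioms.intro Q X)
  interpret X: module R X by (rule X)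
  obtain f g h where
    f: "\<And>n. linmap R (P.F n) (Q.F n) (f n)" and g: "\<And>n. linmap R (Q.F n) (P.F n) (g n)"
    and h: "\<And>n. linmap R (P.F n) (P.F (Suc n)) (h n)"
    and df: "\<And>n x. x \<in> carrier (P.F (Suc n)) \<Longrightarrow> d' n (f (Suc n) x) = f n (d n x)"
    and dg: "\<And>n x. x \<in> carrier (Q.F (Suc n)) \<Longrightarrow> d n (g (Suc n) x) = g n (d' n x)"
    and e0: "\<And>x. x \<in> carrier (P.F 0) \<Longrightarrow> x = g 0 (f 0 x) \<oplus>\<^bsub>P.F 0\<^esub> d 0 (h 0 x)"
    and eS: "\<And>n x. x \<in> carrier (P.F (Suc n)) \<Longrightarrow> x = g (Suc n) (f (Suc n) x) \<oplus>\<^bsub>P.F (Suc n)\<^esub>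
         (d (Suc n) (h (Suc n) x) \<oplus>\<^bsub>P.F (Suc n)\<^esub> h n (d n x))"
    using resolution_comparison[OF P Q] by blast
  let ?\<alpha> = "\<lambda>\<phi>. compose (carrier (P.F i)) \<phi> (f i)"
  have aH: "?\<alpha> \<phi> \<in> mod_hom R (P.F i) X" if "\<phi> \<in> mod_hom R (Q.F i) X" for \<phi>
    by (rule compose_mod_hom[OF f P.F that])
  have \<alpha>Z: "?\<alpha> \<phi> \<in> P.Z i" if \<phi>: "\<phi> \<in> Q.Z i" for \<phi>
  proof -
    have "\<phi> (f i (d i x)) = \<zero>\<^bsub>X\<^esub>" if x: "x \<in> carrier (P.F (Suc i))" for x
      using \<phi> linmap_closed[OF f x] unfolding df[OF x, symmetric] Q.mem_Z by blast
    then show ?thesis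
      using aH \<phi> linmap_closed[OF P.d] by (simp add: P.mem_Z Q.mem_Z compose_def)
  qed
  have \<alpha>B: "?\<alpha> \<phi> \<in> P.B i" if \<phi>: "\<phi> \<in> Q.B i" for \<phi>
  proof (cases i)
    case 0
    then show ?thesis
      using \<phi> aH[of \<phi>] linmap_closed[OF f] by (simp add: P.mem_B0 Q.mem_B0 compose_def)
  next
    case (Suc j)
    then obtain \<psi> where *: "\<phi> \<in> mod_hom R (Q.F (Suc j)) X" "\<psi> \<in> mod_hom R (Q.F j) X"
      "\<And>x. x \<in> carrier (Q.F (Suc j)) \<Longrightarrow> \<phi> x = \<psi> (d' j x)" using Q.mem_BSuc \<phi> by blast
    have "(\<lambda>x\<in>carrier (P.F j). \<psi> (f j x)) \<in> mod_hom R (P.F j) X"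
      by (rule restrict_mod_hom[OF linmap_comp[OF f linmap_mod_hom[OF *(2)]] P.F])
    moreover have "?\<alpha> \<phi> x = (\<lambda>x\<in>carrier (P.F j). \<psi> (f j x)) (d j x)"
      if "x \<in> carrier (P.F (Suc j))" for x
      using that *(3)[OF linmap_closed[OF f that]] linmap_closed[OF P.d that]
      by (simp add: compose_def df Suc)
    ultimately show ?thesis using aH[of \<phi>] *(1) unfolding Suc P.mem_BSuc by blast
  qed
  have "belongs_to R (quot_module (P.Zm i) (P.B i)) \<D>"
  proof (rule belongs_to_surj[OF S inf Q.HZ P.HZ Q.B P.B])
    show "linmap R (Q.Zm i) (P.Zm i) ?\<alpha>"
      using linmap_pull[OF f P.F, of i X] \<alpha>Z submodule_subset[OF Q.Z]
      by (auto simp: linmap_def subset_iff)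
    show "belongs_to R (quot_module (Q.Zm i) (Q.B i)) \<D>"
      using bel by (simp add: ext_res_def)
    fix z assume "z \<in> carrier (P.Zm i)"
    then have z: "z \<in> P.Z i" and zh: "z \<in> mod_hom R (P.F i) X"
      and z0: "\<And>x. x \<in> carrier (P.F (Suc i)) \<Longrightarrow> z (d i x) = \<zero>\<^bsub>X\<^esub>" by (auto simp: P.mem_Z)
    note zl = linmap_mod_hom[OF zh]
    let ?y = "compose (carrier (Q.F i)) z (g i)"
    have y: "?y \<in> Q.Z i"
    proof -
      have "z (g i (d' i x)) = \<zero>\<^bsub>X\<^esub>" if x: "x \<in> carrier (Q.F (Suc i))" for x
        using z0 linmap_closed[OF g x] unfolding dg[OF x, symmetric] by blast
      moreover have "?y \<in> mod_hom R (Q.F i) X"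
        using restrict_mod_hom[OF linmap_comp[OF g zl] Q.F] by (simp add: compose_def)
      ultimately show ?thesis
        using linmap_closed[OF Q.d] by (simp add: Q.mem_Z compose_def)
    qed
    have \<alpha>y: "?\<alpha> ?y x = z (g i (f i x))" if "x \<in> carrier (P.F i)" for x
      using that linmap_closed[OF f] by (simp add: compose_def)
    have "\<exists>k\<in>P.B i. \<forall>x\<in>carrier (P.F i). z x = ?\<alpha> ?y x \<oplus>\<^bsub>X\<^esub> k x"
    proof (cases i)
      case 0
      \<comment> \<open>In degree 0 the term \<open>h d\<close> is absent and zero is the only
        coboundary, which settles the choice of \<open>k\<close>.\<close>
      have "z x = ?\<alpha> ?y x \<oplus>\<^bsub>X\<^esub> (\<lambda>x\<in>carrier (P.F 0). \<zero>\<^bsub>X\<^esub>) x" if x: "x \<in> carrier (P.F 0)" for x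
      proof -
        have a: "g 0 (f 0 x) \<in> carrier (P.F 0)" "h 0 x \<in> carrier (P.F (Suc 0))"
          using x linmap_closed[OF f] linmap_closed[OF g] linmap_closed[OF h] by blast+
        have "z x = z (g 0 (f 0 x)) \<oplus>\<^bsub>X\<^esub> z (d 0 (h 0 x))"
          using arg_cong[OF e0[OF x], of z]
            linmap_add[OF zl[unfolded 0] a(1) linmap_closed[OF P.d a(2)]] by simp
        then show ?thesis using x \<alpha>y z0 a 0 by simp
      qed
      moreover have "(\<lambda>x\<in>carrier (P.F 0). \<zero>\<^bsub>X\<^esub>) \<in> P.B 0"
        using restrict_mod_hom[OF linmap_zero_fun[OF X] P.F] by (simp add: P.mem_B0)
      ultimately show ?thesis using 0 by blast
    next
      case (Suc j)
      let ?k = "\<lambda>x\<in>carrier (P.F (Suc j)). z (h j (d j x))"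
      have hl: "linmap R (P.F j) X (\<lambda>x. z (h j x))"
        by (rule linmap_comp[OF h zl[unfolded Suc]])
      have "z x = ?\<alpha> ?y x \<oplus>\<^bsub>X\<^esub> ?k x" if x: "x \<in> carrier (P.F (Suc j))" for x
      proof -
        have a: "g (Suc j) (f (Suc j) x) \<in> carrier (P.F (Suc j))"
          "h (Suc j) x \<in> carrier (P.F (Suc (Suc j)))" "h j (d j x) \<in> carrier (P.F (Suc j))"
          using x linmap_closed[OF f] linmap_closed[OF g] linmap_closed[OF h] linmap_closed[OF P.d]
          by blast+
        interpret FS: module R "P.F (Suc j)" by (rule P.F)
        have "z x = z (g (Suc j) (f (Suc j) x)) \<oplus>\<^bsub>X\<^esub>
            (z (d (Suc j) (h (Suc j) x)) \<oplus>\<^bsub>X\<^esub> z (h j (d j x)))"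
          using arg_cong[OF eS[OF x], of z] linmap_closed[OF P.d a(2)] a
            linmap_add[OF zl[unfolded Suc]] by simp
        moreover have "z (d (Suc j) (h (Suc j) x)) = \<zero>\<^bsub>X\<^esub>" using z0 a(2) Suc by simp
        ultimately show ?thesis
          using x \<alpha>y Suc a linmap_closed[OF zl[unfolded Suc]] by simp
      qed
      moreover have "?k \<in> P.B (Suc j)"
      proof -
        have "?k \<in> mod_hom R (P.F (Suc j)) X" by (rule restrict_mod_hom[OF linmap_comp[OF P.d hl] P.F])
        moreover have "\<forall>x\<in>carrier (P.F (Suc j)). ?k x = (\<lambda>x\<in>carrier (P.F j). z (h j x)) (d j x)"
          using linmap_closed[OF P.d] by simp
        ultimately show ?thesis
          using restrict_mod_hom[OF hl P.F] unfolding P.mem_BSuc by blast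
      qed
      ultimately show ?thesis using Suc by blast
    qed
    then obtain k where k: "k \<in> P.B i" "\<And>x. x \<in> carrier (P.F i) \<Longrightarrow> z x = ?\<alpha> ?y x \<oplus>\<^bsub>X\<^esub> k x" by blast
    have "z = (\<lambda>x\<in>carrier (P.F i). ?\<alpha> ?y x \<oplus>\<^bsub>X\<^esub> k x)"
    proof (rule mod_hom_eqI[OF zh])
      have "k \<in> mod_hom R (P.F i) X" using subsetD[OF P.B_Z k(1)] by (simp add: P.mem_Z)
      then show "(\<lambda>x\<in>carrier (P.F i). ?\<alpha> ?y x \<oplus>\<^bsub>X\<^esub> k x) \<in> mod_hom R (P.F i) X"
        using \<alpha>Z[OF y] linmap_mod_hom
        by (intro restrict_mod_hom[OF linmap_add_fun[OF _ _ X] P.F]) (auto simp: P.mem_Z)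
    qed (simp add: k(2))
    then show "\<exists>y\<in>carrier (Q.Zm i). \<exists>k\<in>P.B i.
        z = ?\<alpha> y \<oplus>\<^bsub>P.Zm i\<^esub> k"
      using y k(1) by (auto simp: Hom_module_simps)
  qed (use \<alpha>B in auto)
  then show ?thesis by (simp add: ext_res_def)
qed

section \<open>The tensor product as a functor\<close>

lemma mod_span_superset: "S \<subseteq> mod_span R M S"
  by (auto simp: mod_span_def)

lemma mod_span_least: "submodule K R M \<Longrightarrow> S \<subseteq> K \<Longrightarrow> mod_span R M S \<subseteq> K"
  by (auto simp: mod_span_def)

lemma mod_span_submodule:
  assumes M: "module R M" and S: "S \<subseteq> carrier M"
  shows "submodule (mod_span R M S) R M"
proof (rule submoduleI'[OF M])
  show "mod_span R M S \<subseteq> carrier M" by (rule mod_span_least[OF submodule_carrier[OF M] S])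
qed (auto simp: mod_span_def submodule_zero submodule_add submodule_smult)

locale tensor =
  fixes R :: "('r, 'e) ring_scheme" and M :: "('r, 'm) module" and N :: "('r, 'n) module"
  assumes M: "module R M" and N: "module R N"
begin

abbreviation F where "F \<equiv> free_module R (carrier M \<times> carrier N)"
abbreviation e where "e x y \<equiv> free_gen R (x, y)"
abbreviation T where "T \<equiv> tensor_module R M N"

sublocale M: module R M by (rule M)
sublocale N: module R N by (rule N)

lemma F: "module R F"
  by (rule free_module_is_module[OF M.is_cring])

sublocale F: module R F by (rule F)

lemma e: "x \<in> carrier M \<Longrightarrow> y \<in> carrier N \<Longrightarrow> e x y \<in> carrier F"
  by (rule free_gen_closed[OF M.is_cring]) simp

lemma rel_add_left: "x \<in> carrier M \<Longrightarrow> x' \<in> carrier M \<Longrightarrow> y \<in> carrier N \<Longrightarrow>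
    e (x \<oplus>\<^bsub>M\<^esub> x') y \<ominus>\<^bsub>F\<^esub> (e x y \<oplus>\<^bsub>F\<^esub> e x' y) \<in> tensor_rels R M N"
  and rel_add_right: "x \<in> carrier M \<Longrightarrow> y \<in> carrier N \<Longrightarrow> y' \<in> carrier N \<Longrightarrow>
    e x (y \<oplus>\<^bsub>N\<^esub> y') \<ominus>\<^bsub>F\<^esub> (e x y \<oplus>\<^bsub>F\<^esub> e x y') \<in> tensor_rels R M N"
  and rel_smult_left: "r \<in> carrier R \<Longrightarrow> x \<in> carrier M \<Longrightarrow> y \<in> carrier N \<Longrightarrow>
    e (r \<odot>\<^bsub>M\<^esub> x) y \<ominus>\<^bsub>F\<^esub> r \<odot>\<^bsub>F\<^esub> e x y \<in> tensor_rels R M N"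
  and rel_smult_right: "r \<in> carrier R \<Longrightarrow> x \<in> carrier M \<Longrightarrow> y \<in> carrier N \<Longrightarrow>
    e x (r \<odot>\<^bsub>N\<^esub> y) \<ominus>\<^bsub>F\<^esub> r \<odot>\<^bsub>F\<^esub> e x y \<in> tensor_rels R M N"
  unfolding tensor_rels_def Let_def by blast+

lemma tensor_relsE:
  assumes "w \<in> tensor_rels R M N"
  obtains (add_left) x x' y where "x \<in> carrier M" "x' \<in> carrier M" "y \<in> carrier N"
      "w = e (x \<oplus>\<^bsub>M\<^esub> x') y \<ominus>\<^bsub>F\<^esub> (e x y \<oplus>\<^bsub>F\<^esub> e x' y)"
    | (add_right) x y y' where "x \<in> carrier M" "y \<in> carrier N" "y' \<in> carrier N"
      "w = e x (y \<oplus>\<^bsub>N\<^esub> y') \<ominus>\<^bsub>F\<^esub> (e x y \<oplus>\<^bsub>F\<^esub> e x y')"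
    | (smult_left) r x y where "r \<in> carrier R" "x \<in> carrier M" "y \<in> carrier N"
      "w = e (r \<odot>\<^bsub>M\<^esub> x) y \<ominus>\<^bsub>F\<^esub> r \<odot>\<^bsub>F\<^esub> e x y"
    | (smult_right) r x y where "r \<in> carrier R" "x \<in> carrier M" "y \<in> carrier N"
      "w = e x (r \<odot>\<^bsub>N\<^esub> y) \<ominus>\<^bsub>F\<^esub> r \<odot>\<^bsub>F\<^esub> e x y"
  using assms unfolding tensor_rels_def Let_def
  by (elim UnE CollectE exE conjE)
    ((erule that(1)[rotated 3]; assumption) | (erule that(2)[rotated 3]; assumption) |
     (erule that(3)[rotated 3]; assumption) | (erule that(4)[rotated 3]; assumption))+

lemma rels_carrier: "tensor_rels R M N \<subseteq> carrier F"
proof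
  fix w assume "w \<in> tensor_rels R M N"
  then show "w \<in> carrier F" by (cases rule: tensor_relsE) (auto intro!: e)
qed

lemma null: "submodule (tensor_null R M N) R F"
  unfolding tensor_null_def by (rule mod_span_submodule[OF F rels_carrier])

lemma rel_null: "w \<in> tensor_rels R M N \<Longrightarrow> w \<in> tensor_null R M N"
  unfolding tensor_null_def by (rule subsetD[OF mod_span_superset])

lemma T: "module R T"
  unfolding tensor_module_def by (rule quot_module_module[OF null F])

lemma pure: "x \<in> carrier M \<Longrightarrow> y \<in> carrier N \<Longrightarrow> pure_tensor R M N x y \<in> carrier T"
  unfolding tensor_module_def pure_tensor_def quot_carrier by (rule imageI) (rule e)

lemma pure_add_left:
  assumes "x \<in> carrier M" "x' \<in> carrier M" "y \<in> carrier N"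
  shows "pure_tensor R M N (x \<oplus>\<^bsub>M\<^esub> x') y = pure_tensor R M N x y \<oplus>\<^bsub>T\<^esub> pure_tensor R M N x' y"
  unfolding pure_tensor_def tensor_module_def quot_add[OF null F e[OF assms(1,3)] e[OF assms(2,3)]]
  by (subst coset_eq_iff[OF null F]) (use assms e rel_null[OF rel_add_left[OF assms]] in auto)

lemma pure_add_right:
  assumes "x \<in> carrier M" "y \<in> carrier N" "y' \<in> carrier N"
  shows "pure_tensor R M N x (y \<oplus>\<^bsub>N\<^esub> y') = pure_tensor R M N x y \<oplus>\<^bsub>T\<^esub> pure_tensor R M N x y'"
  unfolding pure_tensor_def tensor_module_def quot_add[OF null F e[OF assms(1,2)] e[OF assms(1,3)]]
  by (subst coset_eq_iff[OF null F]) (use assms e rel_null[OF rel_add_right[OF assms]] in auto)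

lemma pure_smult_left:
  assumes "r \<in> carrier R" "x \<in> carrier M" "y \<in> carrier N"
  shows "pure_tensor R M N (r \<odot>\<^bsub>M\<^esub> x) y = r \<odot>\<^bsub>T\<^esub> pure_tensor R M N x y"
  unfolding pure_tensor_def tensor_module_def quot_smult[OF null F assms(1) e[OF assms(2,3)]]
  by (subst coset_eq_iff[OF null F]) (use assms e rel_null[OF rel_smult_left[OF assms]] in auto)

lemma pure_smult_right:
  assumes "r \<in> carrier R" "x \<in> carrier M" "y \<in> carrier N"
  shows "pure_tensor R M N x (r \<odot>\<^bsub>N\<^esub> y) = r \<odot>\<^bsub>T\<^esub> pure_tensor R M N x y"
  unfolding pure_tensor_def tensor_module_def quot_smult[OF null F assms(1) e[OF assms(2,3)]]
  by (subst coset_eq_iff[OF null F]) (use assms e rel_null[OF rel_smult_right[OF assms]] in auto)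

text \<open>The quotient map from the free module on pairs is onto and sends generators to pure
  tensors, so \<open>free_linmap_eq\<close> applies to the composites.\<close>

lemma tensor_linmap_eq:
  assumes P: "module R P" and fg: "linmap R T P f" "linmap R T P g"
    and eq: "\<And>x y. x \<in> carrier M \<Longrightarrow> y \<in> carrier N \<Longrightarrow>
      f (pure_tensor R M N x y) = g (pure_tensor R M N x y)"
    and z: "z \<in> carrier T"
  shows "f z = g z"
proof -
  let ?c = "\<lambda>w. tensor_null R M N +>\<^bsub>F\<^esub> w"
  have c: "linmap R F T ?c" unfolding tensor_module_def by (rule linmap_coset[OF null F])
  obtain w where w: "w \<in> carrier F" "z = ?c w" using z by (auto simp: tensor_module_def quot_carrier)
  have "f (?c w) = g (?c w)"
    by (rule free_linmap_eq[OF M.is_cring P linmap_comp[OF c fg(1)] linmap_comp[OF c fg(2)] _ w(1)])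
      (use eq in \<open>auto simp: pure_tensor_def\<close>)
  then show ?thesis using w by simp
qed

end

locale tensor_hom = A: tensor R M N + B: tensor R M' N
  for R :: "('r, 'e) ring_scheme" and M :: "('r, 'm) module" and M' :: "('r, 'k) module"
    and N :: "('r, 'n) module" +
  fixes f
  assumes f: "linmap R M M' f"
begin

text \<open>The linear extension of \<open>(x, y) \<mapsto> f x \<otimes> y\<close> annihilates the
  four families of relations, hence their span, and so descends to the quotient.\<close>

lemma tensor_map_exists:
  "\<exists>h. h \<in> mod_hom R A.T B.T \<and>
     (\<forall>x\<in>carrier M. \<forall>y\<in>carrier N. h (pure_tensor R M N x y) = pure_tensor R M' N (f x) y)"
proof -
  define \<phi> where "\<phi> = (\<lambda>(x, y). pure_tensor R M' N (f x) y)"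
  have \<phi>: "\<phi> \<in> carrier M \<times> carrier N \<rightarrow> carrier B.T"
    using linmap_closed[OF f] B.pure by (auto simp: \<phi>_def)
  define L where "L = lin_ext R (carrier M \<times> carrier N) B.T \<phi>"
  have L: "linmap R A.F B.T L" unfolding L_def by (rule linmap_mod_hom[OF lin_ext_hom[OF B.T \<phi>]])
  have Le: "L (A.e x y) = pure_tensor R M' N (f x) y" if "x \<in> carrier M" "y \<in> carrier N" for x y
    unfolding L_def using lin_ext_free_gen[OF B.T \<phi>, of "(x, y)"] that by (simp add: \<phi>_def)
  interpret T': module R B.T by (rule B.T)
  note Lm = linmap_minus[OF L A.F B.T] and La = linmap_add[OF L] and Ls = linmap_smult[OF L]
  have "tensor_rels R M N \<subseteq> a_kernel A.F B.T L"
  proof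
    fix w assume w: "w \<in> tensor_rels R M N"
    then have "L w = \<zero>\<^bsub>B.T\<^esub>"
    proof (cases rule: A.tensor_relsE)
      case (add_left x x' y)
      then show ?thesis
        using linmap_closed[OF f] by (simp add: A.e Lm La Le linmap_add[OF f] B.pure_add_left B.pure T'.minus_self)
    next
      case (add_right x y y')
      then show ?thesis
        using linmap_closed[OF f] by (simp add: A.e Lm La Le B.pure_add_right B.pure T'.minus_self)
    next
      case (smult_left r x y)
      then show ?thesis
        using linmap_closed[OF f] by (simp add: A.e Lm Ls Le linmap_smult[OF f] B.pure_smult_left B.pure T'.minus_self)
    next
      case (smult_right r x y)
      then show ?thesis
        using linmap_closed[OF f] by (simp add: A.e Lm Ls Le B.pure_smult_right B.pure T'.minus_self)
    qed
    then show "w \<in> a_kernel A.F B.T L" using w A.rels_carrier by (auto simp: a_kernel_eq)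
  qed
  then have "tensor_null R M N \<subseteq> a_kernel A.F B.T L"
    unfolding tensor_null_def by (rule mod_span_least[OF submodule_kernel[OF L A.F B.T]])
  then have L0: "\<And>x. x \<in> tensor_null R M N \<Longrightarrow> L x = \<zero>\<^bsub>B.T\<^esub>" by (auto simp: a_kernel_eq)
  obtain h where h: "h \<in> mod_hom R (quot_module A.F (tensor_null R M N)) B.T"
    "\<And>x. x \<in> carrier A.F \<Longrightarrow> h (tensor_null R M N +>\<^bsub>A.F\<^esub> x) = L x"
    using quot_induced[OF L A.F B.T A.null L0] by blast
  have "h (pure_tensor R M N x y) = pure_tensor R M' N (f x) y"
    if "x \<in> carrier M" "y \<in> carrier N" for x y
    unfolding pure_tensor_def[of R M N] h(2)[OF A.e[OF that]] by (rule Le[OF that])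
  then show ?thesis using h(1) unfolding tensor_module_def[of R M N] by (intro exI[of _ h] conjI ballI)
qed

text \<open>The \<open>THE\<close> in \<open>tensor_map\<close> is justified: pure tensors generate,
  and members of \<open>mod_hom\<close> that agree on the carrier are equal.\<close>

lemma tensor_map_props:
  "tensor_map R M M' N f \<in> mod_hom R A.T B.T \<and> (\<forall>x\<in>carrier M. \<forall>y\<in>carrier N.
     tensor_map R M M' N f (pure_tensor R M N x y) = pure_tensor R M' N (f x) y)"
proof -
  have "\<exists>!h. h \<in> mod_hom R A.T B.T \<and>
     (\<forall>x\<in>carrier M. \<forall>y\<in>carrier N. h (pure_tensor R M N x y) = pure_tensor R M' N (f x) y)"
  proof (rule ex_ex1I[OF tensor_map_exists])
    fix h k
    assume h: "h \<in> mod_hom R A.T B.T \<and>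
        (\<forall>x\<in>carrier M. \<forall>y\<in>carrier N. h (pure_tensor R M N x y) = pure_tensor R M' N (f x) y)"
      and k: "k \<in> mod_hom R A.T B.T \<and>
        (\<forall>x\<in>carrier M. \<forall>y\<in>carrier N. k (pure_tensor R M N x y) = pure_tensor R M' N (f x) y)"
    show "h = k"
    proof (rule mod_hom_eqI[OF conjunct1[OF h] conjunct1[OF k]])
      fix z assume z: "z \<in> carrier A.T"
      show "h z = k z"
        by (rule A.tensor_linmap_eq[OF B.T linmap_mod_hom[OF conjunct1[OF h]]
              linmap_mod_hom[OF conjunct1[OF k]] _ z])
          (simp add: conjunct2[OF h, rule_format] conjunct2[OF k, rule_format])
    qed
  qed
  then show ?thesis unfolding tensor_map_def by (rule theI')
qed

end

lemma tensor_module_module: "module R M \<Longrightarrow> module R N \<Longrightarrow> module R (tensor_module R M N)"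
  by (rule tensor.T[OF tensor.intro])

lemma tensor_map_linmap:
  assumes "module R M" "module R M'" "module R N" "linmap R M M' f"
  shows "linmap R (tensor_module R M N) (tensor_module R M' N) (tensor_map R M M' N f)"
    and "x \<in> carrier M \<Longrightarrow> y \<in> carrier N \<Longrightarrow>
      tensor_map R M M' N f (pure_tensor R M N x y) = pure_tensor R M' N (f x) y"
proof -
  interpret tensor_hom R M M' N f
    by (intro tensor_hom.intro tensor.intro tensor_hom_axioms.intro assms)
  show "linmap R (tensor_module R M N) (tensor_module R M' N) (tensor_map R M M' N f)"
    by (rule linmap_mod_hom[OF conjunct1[OF tensor_map_props]])
  show "x \<in> carrier M \<Longrightarrow> y \<in> carrier N \<Longrightarrow>
      tensor_map R M M' N f (pure_tensor R M N x y) = pure_tensor R M' N (f x) y"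
    using tensor_map_props by blast
qed

section \<open>Functoriality and additivity of the tensor product in its first argument\<close>

lemma tensor_map_id:
  assumes Ms: "module R M" and Ns: "module R N" and f: "\<And>x. x \<in> carrier M \<Longrightarrow> f x = x"
    and z: "z \<in> carrier (tensor_module R M N)"
  shows "tensor_map R M M N f z = z"
proof -
  have fl: "linmap R M M f" by (rule linmap_cong[OF linmap_id Ms]) (simp add: f)
  interpret tensor R M N by (intro tensor.intro Ms Ns)
  show ?thesis
    by (rule tensor_linmap_eq[OF T tensor_map_linmap(1)[OF Ms Ms Ns fl] linmap_id _ z])
      (simp add: tensor_map_linmap(2)[OF Ms Ms Ns fl] f)
qed

text \<open>The composite enters as any \<open>k\<close> that agrees with it on the carrier, so that
  chain-map and homotopy equations, which are known only there, can be tensored directly.\<close>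

lemma tensor_map_comp:
  assumes Ms: "module R M" "module R M'" "module R M''" and Ns: "module R N"
    and f: "linmap R M M' f" and g: "linmap R M' M'' g"
    and k: "\<And>x. x \<in> carrier M \<Longrightarrow> k x = g (f x)"
    and z: "z \<in> carrier (tensor_module R M N)"
  shows "tensor_map R M M'' N k z = tensor_map R M' M'' N g (tensor_map R M M' N f z)"
proof -
  have kl: "linmap R M M'' k" by (rule linmap_cong[OF linmap_comp[OF f g] Ms(1)]) (simp add: k)
  interpret tensor R M N by (intro tensor.intro Ms Ns)
  show ?thesis
    by (rule tensor_linmap_eq[OF tensor_module_module[OF Ms(3) Ns] tensor_map_linmap(1)[OF Ms(1,3) Ns kl]
          linmap_comp[OF tensor_map_linmap(1)[OF Ms(1,2) Ns f] tensor_map_linmap(1)[OF Ms(2,3) Ns g]] _ z])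
      (use linmap_closed[OF f] in \<open>simp add: tensor_map_linmap(2)[OF Ms(1,3) Ns kl]
        tensor_map_linmap(2)[OF Ms(1,2) Ns f] tensor_map_linmap(2)[OF Ms(2,3) Ns g] k\<close>)
qed

lemma tensor_map_add:
  assumes Ms: "module R M" "module R M'" and Ns: "module R N"
    and f: "linmap R M M' f" and g: "linmap R M M' g"
    and k: "\<And>x. x \<in> carrier M \<Longrightarrow> k x = f x \<oplus>\<^bsub>M'\<^esub> g x"
    and z: "z \<in> carrier (tensor_module R M N)"
  shows "tensor_map R M M' N k z =
    tensor_map R M M' N f z \<oplus>\<^bsub>tensor_module R M' N\<^esub> tensor_map R M M' N g z"
proof -
  have kl: "linmap R M M' k" by (rule linmap_cong[OF linmap_add_fun[OF f g Ms(2)] Ms(1)]) (simp add: k)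
  interpret tensor R M N by (intro tensor.intro Ms Ns)
  interpret T': tensor R M' N by (intro tensor.intro Ms Ns)
  show ?thesis
    by (rule tensor_linmap_eq[OF T'.T tensor_map_linmap(1)[OF Ms Ns kl]
          linmap_add_fun[OF tensor_map_linmap(1)[OF Ms Ns f] tensor_map_linmap(1)[OF Ms Ns g] T'.T] _ z])
      (use linmap_closed[OF f] linmap_closed[OF g] in \<open>simp add: tensor_map_linmap(2)[OF Ms Ns kl]
        tensor_map_linmap(2)[OF Ms Ns f] tensor_map_linmap(2)[OF Ms Ns g] k T'.pure_add_left\<close>)
qed

lemma tensor_map_zero:
  assumes Ms: "module R M" "module R M'" and Ns: "module R N"
    and k: "\<And>x. x \<in> carrier M \<Longrightarrow> k x = \<zero>\<^bsub>M'\<^esub>"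
    and z: "z \<in> carrier (tensor_module R M N)"
  shows "tensor_map R M M' N k z = \<zero>\<^bsub>tensor_module R M' N\<^esub>"
proof -
  interpret M': module R M' by (rule Ms)
  have kl: "linmap R M M' k" by (rule linmap_cong[OF linmap_zero_fun[OF Ms(2)] Ms(1)]) (simp add: k)
  interpret T': module R "tensor_module R M' N" by (rule tensor_module_module[OF Ms(2) Ns])
  let ?w = "tensor_map R M M' N k z"
  have w: "?w \<in> carrier (tensor_module R M' N)"
    by (rule linmap_closed[OF tensor_map_linmap(1)[OF Ms Ns kl] z])
  \<comment> \<open>The zero map is the sum of two copies of itself, so additivity makes
    \<open>?w\<close> equal to its double.\<close>
  have "?w = ?w \<oplus>\<^bsub>tensor_module R M' N\<^esub> ?w"
    by (rule tensor_map_add[OF Ms Ns kl kl _ z]) (simp add: k)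
  then show ?thesis using w by (metis T'.add.r_cancel_one')
qed

section \<open>Tor from an arbitrary free resolution\<close>

definition tor_Z where
  "tor_Z R X Bs d i = (case i of
     0 \<Rightarrow> carrier (tensor_module R (free_module R (Bs 0)) X)
   | Suc j \<Rightarrow> a_kernel (tensor_module R (free_module R (Bs (Suc j))) X)
       (tensor_module R (free_module R (Bs j)) X)
       (tensor_map R (free_module R (Bs (Suc j))) (free_module R (Bs j)) X (d j)))"

definition tor_B where
  "tor_B R X Bs d i =
     tensor_map R (free_module R (Bs (Suc i))) (free_module R (Bs i)) X (d i) `
       carrier (tensor_module R (free_module R (Bs (Suc i))) X)"

definition tor_res where
  "tor_res R X Bs d i =
     quot_module ((tensor_module R (free_module R (Bs i)) X)\<lparr>carrier := tor_Z R X Bs d i\<rparr>)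
       (tor_B R X Bs d i)"

lemma Tor_eq_tor_res: "Tor R i N X = tor_res R X (res_basis R N) (res_diff R N) i"
proof -
  have "tor_cycles R i N X = tor_Z R X (res_basis R N) (res_diff R N) i"
    unfolding tor_cycles_def tor_Z_def res_mod_def tor_diff_def by simp
  moreover have "tor_boundaries R i N X = tor_B R X (res_basis R N) (res_diff R N) i"
    unfolding tor_boundaries_def tor_B_def res_mod_def tor_diff_def by simp
  ultimately show ?thesis by (simp add: Tor_def tor_res_def res_mod_def)
qed

context coeff_res
begin

abbreviation T :: "nat \<Rightarrow> ('r, (('b \<Rightarrow> 'r) \<times> 'x \<Rightarrow> 'r) set) module" where
  "T i \<equiv> tensor_module R (F i) X"
abbreviation td where "td i \<equiv> tensor_map R (F (Suc i)) (F i) X (d i)"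
abbreviation TZ where "TZ i \<equiv> tor_Z R X Bs d i"
abbreviation TB where "TB i \<equiv> tor_B R X Bs d i"
abbreviation TZm where "TZm i \<equiv> (T i)\<lparr>carrier := TZ i\<rparr>"

lemma T: "module R (T i)"
  by (rule tensor_module_module[OF F X])

lemma td: "linmap R (T (Suc i)) (T i) (td i)"
  by (rule tensor_map_linmap(1)[OF F F X d])

lemma tdd:
  assumes "z \<in> carrier (T (Suc (Suc i)))"
  shows "td i (td (Suc i) z) = \<zero>\<^bsub>T i\<^esub>"
proof -
  have "tensor_map R (F (Suc (Suc i))) (F i) X (\<lambda>x. d i (d (Suc i) x)) z = td i (td (Suc i) z)"
    by (rule tensor_map_comp[OF F F F X d d _ assms]) simp
  moreover have "tensor_map R (F (Suc (Suc i))) (F i) X (\<lambda>x. d i (d (Suc i) x)) z = \<zero>\<^bsub>T i\<^esub>"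
    by (rule tensor_map_zero[OF F F X _ assms]) (rule dd)
  ultimately show ?thesis by simp
qed

lemma mem_TZ: "z \<in> TZ i \<longleftrightarrow> z \<in> carrier (T i) \<and> (\<forall>j. i = Suc j \<longrightarrow> td j z = \<zero>\<^bsub>T j\<^esub>)"
  by (cases i) (auto simp: tor_Z_def a_kernel_eq)

lemma TZ: "submodule (TZ i) R (T i)"
proof (cases i)
  case 0
  then show ?thesis using submodule_carrier[OF T[of 0]] by (simp add: tor_Z_def)
next
  case (Suc j)
  then show ?thesis using submodule_kernel[OF td T T] by (simp add: tor_Z_def)
qed

lemma TB_TZ: "TB i \<subseteq> TZ i"
  using linmap_closed[OF td] tdd by (auto simp: tor_B_def mem_TZ)

lemma TB: "submodule (TB i) R (TZm i)"
  using submodule_image[OF td T T submodule_carrier[OF T]]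
  by (intro submodule_restrict_carrier[OF _ TZ TB_TZ T]) (simp add: tor_B_def)

lemma TTZ: "module R (TZm i)"
  by (rule submodule_module[OF TZ T])

end

lemma tensor_map_square:
  assumes M: "module R A" "module R B" "module R C" "module R D" and X: "module R X"
    and l: "linmap R A B f" "linmap R B D g" "linmap R A C f'" "linmap R C D g'"
    and eq: "\<And>x. x \<in> carrier A \<Longrightarrow> g (f x) = g' (f' x)"
    and z: "z \<in> carrier (tensor_module R A X)"
  shows "tensor_map R B D X g (tensor_map R A B X f z) = tensor_map R C D X g' (tensor_map R A C X f' z)"
  using tensor_map_comp[OF M(1,2,4) X l(1,2) refl z]
    tensor_map_comp[OF M(1,3,4) X l(3,4) eq z] by simp

text \<open>Dual to the case of Ext: on a cycle the summand \<open>h d\<close> of the homotopy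
  identity vanishes and \<open>d h\<close> becomes a boundary, and the map that is onto up to
  boundaries is the one induced by \<open>g\<close>.\<close>

lemma tor_res_comparison:
  fixes R :: "('r, 'e) ring_scheme" and \<D> :: "('r, 'u) module set"
  assumes S: "serre_subcategory R \<D>" and inf: "infinite (UNIV :: 'u set)" and X: "module R X"
    and P: "free_resolution R Ps d C \<epsilon>" and Q: "free_resolution R Qs d' C \<epsilon>'"
    and bel: "belongs_to R (tor_res R X Qs d' i) \<D>"
  shows "belongs_to R (tor_res R X Ps d i) \<D>"
proof -
  interpret P: coeff_res R Ps d C \<epsilon> X by (intro coeff_res.intro free_res.intro coeff_res_axioms.intro P X)
  interpret Q: coeff_res R Qs d' C \<epsilon>' X by (intro coeff_res.intro free_res.intro coeff_res_axioms.intro Q X)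
  obtain f g h where
    f: "\<And>n. linmap R (P.F n) (Q.F n) (f n)" and g: "\<And>n. linmap R (Q.F n) (P.F n) (g n)"
    and h: "\<And>n. linmap R (P.F n) (P.F (Suc n)) (h n)"
    and df: "\<And>n x. x \<in> carrier (P.F (Suc n)) \<Longrightarrow> d' n (f (Suc n) x) = f n (d n x)"
    and dg: "\<And>n x. x \<in> carrier (Q.F (Suc n)) \<Longrightarrow> d n (g (Suc n) x) = g n (d' n x)"
    and e0: "\<And>x. x \<in> carrier (P.F 0) \<Longrightarrow> x = g 0 (f 0 x) \<oplus>\<^bsub>P.F 0\<^esub> d 0 (h 0 x)"
    and eS: "\<And>n x. x \<in> carrier (P.F (Suc n)) \<Longrightarrow> x = g (Suc n) (f (Suc n) x) \<oplus>\<^bsub>P.F (Suc n)\<^esub>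
         (d (Suc n) (h (Suc n) x) \<oplus>\<^bsub>P.F (Suc n)\<^esub> h n (d n x))"
    using resolution_comparison[OF P Q] by blast
  let ?Tf = "\<lambda>n. tensor_map R (P.F n) (Q.F n) X (f n)"
    and ?Tg = "\<lambda>n. tensor_map R (Q.F n) (P.F n) X (g n)"
    and ?Th = "\<lambda>n. tensor_map R (P.F n) (P.F (Suc n)) X (h n)"
  have Tf: "linmap R (P.T n) (Q.T n) (?Tf n)" for n by (rule tensor_map_linmap(1)[OF P.F Q.F X f])
  have Tg: "linmap R (Q.T n) (P.T n) (?Tg n)" for n by (rule tensor_map_linmap(1)[OF Q.F P.F X g])
  have Th: "linmap R (P.T n) (P.T (Suc n)) (?Th n)" for n by (rule tensor_map_linmap(1)[OF P.F P.F X h])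
  have Tdf: "Q.td n (?Tf (Suc n) z) = ?Tf n (P.td n z)" if "z \<in> carrier (P.T (Suc n))" for n z
    by (rule tensor_map_square[OF P.F Q.F P.F Q.F X f Q.d P.d f _ that]) (rule df)
  have Tdg: "P.td n (?Tg (Suc n) z) = ?Tg n (Q.td n z)" if "z \<in> carrier (Q.T (Suc n))" for n z
    by (rule tensor_map_square[OF Q.F P.F Q.F P.F X g P.d Q.d g _ that]) (rule dg)
  have dec: "\<exists>k\<in>P.TB i. z = ?Tg i (?Tf i z) \<oplus>\<^bsub>P.T i\<^esub> k" if z: "z \<in> P.TZ i" for z
  proof -
    have zT: "z \<in> carrier (P.T i)" using z by (simp add: P.mem_TZ)
    have zid: "z = tensor_map R (P.F i) (P.F i) X (\<lambda>x. x) z"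
      using tensor_map_id[OF P.F X _ zT, of "\<lambda>x. x"] by simp
    have gf: "linmap R (P.F n) (P.F n) (\<lambda>x. g n (f n x))" for n by (rule linmap_comp[OF f g])
    have dh: "linmap R (P.F n) (P.F n) (\<lambda>x. d n (h n x))" for n by (rule linmap_comp[OF h P.d])
    have hd: "linmap R (P.F (Suc n)) (P.F (Suc n)) (\<lambda>x. h n (d n x))" for n
      by (rule linmap_comp[OF P.d h])
    have gfz: "tensor_map R (P.F i) (P.F i) X (\<lambda>x. g i (f i x)) z = ?Tg i (?Tf i z)"
      by (rule tensor_map_comp[OF P.F Q.F P.F X f g refl zT])
    have dhz: "tensor_map R (P.F i) (P.F i) X (\<lambda>x. d i (h i x)) z = P.td i (?Th i z)"
      by (rule tensor_map_comp[OF P.F P.F P.F X h P.d refl zT])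
    have B: "P.td i (?Th i z) \<in> P.TB i"
      unfolding tor_B_def using linmap_closed[OF Th zT] by blast
    show ?thesis
    proof (cases i)
      case 0
      have "tensor_map R (P.F 0) (P.F 0) X (\<lambda>x. x) z =
          tensor_map R (P.F 0) (P.F 0) X (\<lambda>x. g 0 (f 0 x)) z \<oplus>\<^bsub>P.T 0\<^esub>
          tensor_map R (P.F 0) (P.F 0) X (\<lambda>x. d 0 (h 0 x)) z"
        by (rule tensor_map_add[OF P.F P.F X gf dh e0 zT[unfolded 0]])
      then show ?thesis using zid gfz dhz B unfolding 0 by metis
    next
      case (Suc j)
      have s: "linmap R (P.F i) (P.F i) (\<lambda>x. d i (h i x) \<oplus>\<^bsub>P.F i\<^esub> h j (d j x))"
        using linmap_add_fun[OF dh hd P.F] Suc by simp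
      have "tensor_map R (P.F i) (P.F i) X (\<lambda>x. x) z =
          tensor_map R (P.F i) (P.F i) X (\<lambda>x. g i (f i x)) z \<oplus>\<^bsub>P.T i\<^esub>
          tensor_map R (P.F i) (P.F i) X (\<lambda>x. d i (h i x) \<oplus>\<^bsub>P.F i\<^esub> h j (d j x)) z"
        by (rule tensor_map_add[OF P.F P.F X gf s _ zT]) (use eS Suc in blast)
      also have "tensor_map R (P.F i) (P.F i) X (\<lambda>x. d i (h i x) \<oplus>\<^bsub>P.F i\<^esub> h j (d j x)) z =
          tensor_map R (P.F i) (P.F i) X (\<lambda>x. d i (h i x)) z \<oplus>\<^bsub>P.T i\<^esub>
          tensor_map R (P.F i) (P.F i) X (\<lambda>x. h j (d j x)) z"
        by (rule tensor_map_add[OF P.F P.F X dh _ refl zT]) (use hd Suc in simp)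
      also have "tensor_map R (P.F i) (P.F i) X (\<lambda>x. h j (d j x)) z = ?Th j (P.td j z)"
        using tensor_map_comp[OF P.F P.F P.F X P.d h refl, of z j] zT Suc by simp
      also have "P.td j z = \<zero>\<^bsub>P.T j\<^esub>" using z Suc by (simp add: P.mem_TZ)
      also have "?Th j \<zero>\<^bsub>P.T j\<^esub> = \<zero>\<^bsub>P.T i\<^esub>" using linmap_zero[OF Th P.T P.T] Suc by simp
      finally have "z = ?Tg i (?Tf i z) \<oplus>\<^bsub>P.T i\<^esub> (P.td i (?Th i z) \<oplus>\<^bsub>P.T i\<^esub> \<zero>\<^bsub>P.T i\<^esub>)"
        using zid gfz dhz by simp
      moreover interpret Ti: module R "P.T i" by (rule P.T)
      have "P.td i (?Th i z) \<oplus>\<^bsub>P.T i\<^esub> \<zero>\<^bsub>P.T i\<^esub> = P.td i (?Th i z)"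
        using linmap_closed[OF P.td linmap_closed[OF Th zT]] by simp
      ultimately show ?thesis using B by metis
    qed
  qed
  have gZ: "?Tg i z \<in> P.TZ i" if z: "z \<in> Q.TZ i" for z
  proof -
    have "P.td j (?Tg i z) = \<zero>\<^bsub>P.T j\<^esub>" if "i = Suc j" for j
      using z that Tdg[of z j] linmap_zero[OF Tg Q.T P.T] by (simp add: Q.mem_TZ)
    then show ?thesis using z linmap_closed[OF Tg] by (simp add: P.mem_TZ Q.mem_TZ)
  qed
  have fZ: "?Tf i z \<in> Q.TZ i" if z: "z \<in> P.TZ i" for z
  proof -
    have "Q.td j (?Tf i z) = \<zero>\<^bsub>Q.T j\<^esub>" if "i = Suc j" for j
      using z that Tdf[of z j] linmap_zero[OF Tf P.T Q.T] by (simp add: P.mem_TZ)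
    then show ?thesis using z linmap_closed[OF Tf] by (simp add: P.mem_TZ Q.mem_TZ)
  qed
  have gB: "?Tg i z \<in> P.TB i" if z: "z \<in> Q.TB i" for z
  proof -
    obtain w where w: "w \<in> carrier (Q.T (Suc i))" "z = Q.td i w" using z unfolding tor_B_def by blast
    then have "?Tg i z = P.td i (?Tg (Suc i) w)" using Tdg[OF w(1)] by simp
    then show ?thesis unfolding tor_B_def using linmap_closed[OF Tg w(1)] by blast
  qed
  have "belongs_to R (quot_module (P.TZm i) (P.TB i)) \<D>"
  proof (rule belongs_to_surj[OF S inf Q.TTZ P.TTZ Q.TB P.TB])
    show "linmap R (Q.TZm i) (P.TZm i) (?Tg i)"
      using Tg[of i] gZ submodule_subset[OF Q.TZ]
      by (auto simp: linmap_def subset_iff)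
    show "belongs_to R (quot_module (Q.TZm i) (Q.TB i)) \<D>"
      using bel by (simp add: tor_res_def)
    show "\<exists>y\<in>carrier (Q.TZm i). \<exists>k\<in>P.TB i. z = ?Tg i y \<oplus>\<^bsub>P.TZm i\<^esub> k"
      if z: "z \<in> carrier (P.TZm i)" for z
    proof -
      have "z \<in> P.TZ i" using z by simp
      then show ?thesis using dec[of z] fZ[of z] by auto
    qed
  qed (rule gB)
  then show ?thesis by (simp add: tor_res_def)
qed

section \<open>The quotient of a free resolution by a subresolution\<close>

definition free_proj :: "('r, 'e) ring_scheme \<Rightarrow> 'b set \<Rightarrow> ('b \<Rightarrow> 'r) \<Rightarrow> ('b \<Rightarrow> 'r)" where
  "free_proj R S c = (\<lambda>b. if b \<in> S then c b else \<zero>\<^bsub>R\<^esub>)"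

text \<open>Sums, scalar multiples and zero are formed in the same way whatever the basis, so
  elements of free modules on different subsets can be mixed in one computation.\<close>

lemma free_module_ops:
  "add (free_module R S) = add (free_module R S')"
  "ring.zero (free_module R S) = ring.zero (free_module R S')"
  "smult (free_module R S) = smult (free_module R S')"
  by (simp_all add: free_module_def)

lemma free_module_mono:
  "S \<subseteq> S' \<Longrightarrow> x \<in> carrier (free_module R S) \<Longrightarrow> x \<in> carrier (free_module R S')"
  by (auto simp: free_module_def)

lemma linmap_incl: "S \<subseteq> S' \<Longrightarrow> linmap R (free_module R S) (free_module R S') (\<lambda>x. x)"
  using free_module_mono by (intro linmapI) (auto simp: free_module_ops[of R S S'])

lemma linmap_free_proj:
  assumes "cring R" "S \<subseteq> S'"
  shows "linmap R (free_module R S') (free_module R S) (free_proj R S)"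
proof -
  interpret cring R by (rule assms)
  have fin: "finite {b. free_proj R S c b \<noteq> \<zero>\<^bsub>R\<^esub>}" if "finite {b. c b \<noteq> \<zero>\<^bsub>R\<^esub>}" for c
    by (rule finite_subset[OF _ that]) (auto simp: free_proj_def)
  show ?thesis
    by (rule linmapI) (use fin in \<open>auto simp: free_module_def free_proj_def image_subset_iff\<close>)
qed

lemma free_proj_id:
  assumes "x \<in> carrier (free_module R S)"
  shows "free_proj R S x = x"
proof
  fix b
  have "b \<notin> S \<Longrightarrow> x b = \<zero>\<^bsub>R\<^esub>" using assms by (auto simp: free_module_def)
  then show "free_proj R S x b = x b" by (simp add: free_proj_def)
qed

lemma free_proj_disjoint:
  "x \<in> carrier (free_module R S) \<Longrightarrow> S \<inter> S' = {} \<Longrightarrow> free_proj R S' x = \<zero>\<^bsub>free_module R S''\<^esub>"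
  by (auto simp: free_proj_def free_module_def fun_eq_iff)

lemma free_proj_split:
  assumes "cring R" "S \<subseteq> S'" "x \<in> carrier (free_module R S')"
  shows "x = free_proj R S x \<oplus>\<^bsub>free_module R S''\<^esub> free_proj R (S' - S) x"
proof -
  interpret cring R by (rule assms)
  show ?thesis
    using assms(3) by (auto simp: free_proj_def free_module_def fun_eq_iff image_subset_iff)
qed

text \<open>The situation that standard resolutions create for a submodule \<open>Hs\<close> of
  \<open>M\<close>. The quotient is represented by any \<open>C\<close> with a surjection whose
  kernel is \<open>Hs\<close>, because it may live over another type.\<close>

locale sub_res =
  fixes R :: "('r, 'e) ring_scheme" and Bs As :: "nat \<Rightarrow> 'b set" and d dA
    and M :: "('r, 'm) module" and \<epsilon> \<epsilon>A and Hs and C :: "('r, 'c) module" and \<pi>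
  assumes BR: "free_resolution R Bs d M \<epsilon>"
    and AR: "free_resolution R As dA (M\<lparr>carrier := Hs\<rparr>) \<epsilon>A"
    and AB: "\<And>n. As n \<subseteq> Bs n"
    and dA: "\<And>n x. x \<in> carrier (free_module R (As (Suc n))) \<Longrightarrow> dA n x = d n x"
    and \<epsilon>A: "\<And>x. x \<in> carrier (free_module R (As 0)) \<Longrightarrow> \<epsilon>A x = \<epsilon> x"
    and C: "module R C" and \<pi>: "linmap R M C \<pi>" and \<pi>_surj: "\<pi> ` carrier M = carrier C"
    and \<pi>_ker: "a_kernel M C \<pi> = Hs"
begin

sublocale A: free_res R As dA "M\<lparr>carrier := Hs\<rparr>" \<epsilon>A by unfold_locales (rule AR)
sublocale B: free_res R Bs d M \<epsilon> by unfold_locales (rule BR)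

abbreviation "FA n \<equiv> free_module R (As n)"
abbreviation "FB n \<equiv> free_module R (Bs n)"

definition "Cs n = Bs n - As n"
abbreviation "FC n \<equiv> free_module R (Cs n)"
abbreviation "p n \<equiv> free_proj R (Cs n)"
abbreviation "r n \<equiv> free_proj R (As n)"

text \<open>The differential that \<open>FB\<close> induces on its quotient by \<open>FA\<close>,
  once this quotient is identified with the free module on the complementary basis.\<close>

definition "dC n x = p n (d n x)"
definition "\<epsilon>C x = \<pi> (\<epsilon> x)"

lemma CB: "Cs n \<subseteq> Bs n" by (auto simp: Cs_def)

lemma FC: "module R (FC n)" by (rule free_module_is_module[OF A.cring])

lemma inclA: "linmap R (FA n) (FB n) (\<lambda>x. x)" by (rule linmap_incl[OF AB])
lemma inclC: "linmap R (FC n) (FB n) (\<lambda>x. x)" by (rule linmap_incl[OF CB])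
lemma p: "linmap R (FB n) (FC n) (p n)" by (rule linmap_free_proj[OF A.cring CB])
lemma r: "linmap R (FB n) (FA n) (r n)" by (rule linmap_free_proj[OF A.cring AB])

lemma memA: "x \<in> carrier (FA n) \<Longrightarrow> x \<in> carrier (FB n)" by (rule linmap_closed[OF inclA])
lemma memC: "x \<in> carrier (FC n) \<Longrightarrow> x \<in> carrier (FB n)" by (rule linmap_closed[OF inclC])

lemma split: "x \<in> carrier (FB n) \<Longrightarrow> x = r n x \<oplus>\<^bsub>FB n\<^esub> p n x"
  unfolding Cs_def by (rule free_proj_split[OF A.cring AB])

lemma rA: "x \<in> carrier (FA n) \<Longrightarrow> r n x = x" by (rule free_proj_id)
lemma pC: "x \<in> carrier (FC n) \<Longrightarrow> p n x = x" by (rule free_proj_id)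
lemma pA: "x \<in> carrier (FA n) \<Longrightarrow> p n x = \<zero>\<^bsub>FC n\<^esub>"
  by (rule free_proj_disjoint) (auto simp: Cs_def)

lemma dA_mem: "x \<in> carrier (FA (Suc n)) \<Longrightarrow> d n x \<in> carrier (FA n)"
  using linmap_closed[OF A.d] dA by metis

text \<open>The differential maps \<open>FA\<close> to itself, so the part of \<open>x\<close> in
  \<open>FA\<close> contributes nothing after projection. Thus \<open>p\<close> is a chain map onto
  the quotient complex.\<close>

lemma p_d:
  assumes x: "x \<in> carrier (FB (Suc n))"
  shows "p n (d n x) = dC n (p (Suc n) x)"
proof -
  interpret FC: module R "FC n" by (rule FC)
  have m: "r (Suc n) x \<in> carrier (FA (Suc n))" "p (Suc n) x \<in> carrier (FC (Suc n))"
    using linmap_closed[OF r x] linmap_closed[OF p x] by auto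
  have "d n x = d n (r (Suc n) x) \<oplus>\<^bsub>FB n\<^esub> d n (p (Suc n) x)"
    using arg_cong[OF split[OF x], of "d n"] linmap_add[OF B.d memA[OF m(1)] memC[OF m(2)]] by simp
  then have "p n (d n x) = p n (d n (r (Suc n) x)) \<oplus>\<^bsub>FC n\<^esub> p n (d n (p (Suc n) x))"
    using linmap_add[OF p linmap_closed[OF B.d memA[OF m(1)]] linmap_closed[OF B.d memC[OF m(2)]]]
    by simp
  then show ?thesis
    using pA[OF dA_mem[OF m(1)]] linmap_closed[OF p linmap_closed[OF B.d memC[OF m(2)]]]
    by (simp add: dC_def)
qed

lemma d_split:
  assumes q: "q \<in> carrier (FC (Suc n))"
  shows "d n q = r n (d n q) \<oplus>\<^bsub>FB n\<^esub> dC n q"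
  unfolding dC_def by (rule split[OF linmap_closed[OF B.d memC[OF q]]])

lemma dC: "linmap R (FC (Suc n)) (FC n) (dC n)"
  unfolding dC_def by (rule linmap_comp[OF linmap_comp[OF inclC B.d] p])

lemma \<epsilon>C: "linmap R (FC 0) C \<epsilon>C"
  unfolding \<epsilon>C_def by (rule linmap_comp[OF linmap_comp[OF inclC B.aug] \<pi>])

lemma \<epsilon>_A: "x \<in> carrier (FA 0) \<Longrightarrow> \<epsilon> x \<in> Hs"
  using linmap_closed[OF A.aug] \<epsilon>A by force

lemma \<pi>_H: "x \<in> Hs \<Longrightarrow> \<pi> x = \<zero>\<^bsub>C\<^esub>" and \<pi>_HD: "x \<in> carrier M \<Longrightarrow> \<pi> x = \<zero>\<^bsub>C\<^esub> \<Longrightarrow> x \<in> Hs"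
  using \<pi>_ker by (auto simp: a_kernel_eq)

lemma \<epsilon>C_p:
  assumes x: "x \<in> carrier (FB 0)"
  shows "\<epsilon>C (p 0 x) = \<pi> (\<epsilon> x)"
proof -
  interpret C: module R C by (rule C)
  have m: "r 0 x \<in> carrier (FA 0)" "p 0 x \<in> carrier (FC 0)"
    using linmap_closed[OF r x] linmap_closed[OF p x] by auto
  have "\<epsilon> x = \<epsilon> (r 0 x) \<oplus>\<^bsub>M\<^esub> \<epsilon> (p 0 x)"
    using arg_cong[OF split[OF x], of \<epsilon>] linmap_add[OF B.aug memA[OF m(1)] memC[OF m(2)]] by simp
  then have "\<pi> (\<epsilon> x) = \<pi> (\<epsilon> (r 0 x)) \<oplus>\<^bsub>C\<^esub> \<pi> (\<epsilon> (p 0 x))"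
    using linmap_add[OF \<pi> linmap_closed[OF B.aug memA[OF m(1)]] linmap_closed[OF B.aug memC[OF m(2)]]]
    by simp
  then show ?thesis
    using \<pi>_H[OF \<epsilon>_A[OF m(1)]] linmap_closed[OF \<epsilon>C m(2)] by (simp add: \<epsilon>C_def)
qed

lemma p_minus:
  assumes q: "q \<in> carrier (FC n)" and a: "a \<in> carrier (FA n)"
  shows "p n (q \<ominus>\<^bsub>FB n\<^esub> a) = q"
proof -
  interpret FC: module R "FC n" by (rule FC)
  have "p n (q \<ominus>\<^bsub>FB n\<^esub> a) = p n q \<ominus>\<^bsub>FC n\<^esub> p n a"
    by (rule linmap_minus[OF p B.F FC memC[OF q] memA[OF a]])
  then show ?thesis
    using FC.minus_add_cancel[OF q FC.zero_closed] q by (simp add: pC[OF q] pA[OF a])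
qed

text \<open>A cycle of the quotient is also an element \<open>q\<close> of \<open>FB\<close>. Its
  defect, \<open>\<epsilon> q\<close> or \<open>d q\<close>, lies on the side of \<open>Hs\<close>,
  where exactness provides \<open>a\<close> with the same defect. Then \<open>q - a\<close> is a
  cycle of \<open>FB\<close>, hence a boundary \<open>d b\<close>, and projecting removes
  \<open>a\<close>.\<close>

lemma quotient_resolution: "free_resolution R Cs dC C \<epsilon>C"
  unfolding free_resolution_def
proof (intro conjI allI)
  interpret C: module R C by (rule C)
  interpret M: module R M by (rule B.C)
  show "module R C" by (rule C)
  show "linmap R (FC 0) C \<epsilon>C" by (rule \<epsilon>C)
  show "linmap R (FC (Suc n)) (FC n) (dC n)" for n by (rule dC)
  show "\<epsilon>C ` carrier (FC 0) = carrier C"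
  proof
    show "\<epsilon>C ` carrier (FC 0) \<subseteq> carrier C" using linmap_closed[OF \<epsilon>C] by auto
    show "carrier C \<subseteq> \<epsilon>C ` carrier (FC 0)"
    proof
      fix c assume "c \<in> carrier C"
      then obtain x where x: "x \<in> carrier (FB 0)" "c = \<pi> (\<epsilon> x)"
        using \<pi>_surj B.aug_surj by (metis (no_types, lifting) imageE)
      then show "c \<in> \<epsilon>C ` carrier (FC 0)" using \<epsilon>C_p[OF x(1)] linmap_closed[OF p x(1)] by force
    qed
  qed
  show "dC 0 ` carrier (FC (Suc 0)) = a_kernel (FC 0) C \<epsilon>C"
  proof
    show "dC 0 ` carrier (FC (Suc 0)) \<subseteq> a_kernel (FC 0) C \<epsilon>C"
    proof
      fix y assume "y \<in> dC 0 ` carrier (FC (Suc 0))"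
      then obtain q where q: "q \<in> carrier (FC (Suc 0))" "y = p 0 (d 0 q)" by (auto simp: dC_def)
      have "\<epsilon>C y = \<pi> (\<epsilon> (d 0 q))"
        unfolding q(2) by (rule \<epsilon>C_p[OF linmap_closed[OF B.d memC[OF q(1)]]])
      then have "\<epsilon>C y = \<zero>\<^bsub>C\<^esub>" using B.aug_d[OF memC[OF q(1)]] linmap_zero[OF \<pi> B.C C] by simp
      then show "y \<in> a_kernel (FC 0) C \<epsilon>C"
        using linmap_closed[OF dC q(1)] q(2) by (simp add: a_kernel_eq dC_def)
    qed
    show "a_kernel (FC 0) C \<epsilon>C \<subseteq> dC 0 ` carrier (FC (Suc 0))"
    proof
      fix q assume "q \<in> a_kernel (FC 0) C \<epsilon>C"
      then have q: "q \<in> carrier (FC 0)" "\<pi> (\<epsilon> q) = \<zero>\<^bsub>C\<^esub>" by (auto simp: a_kernel_eq \<epsilon>C_def)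
      note qB = memC[OF q(1)]
      have "\<epsilon> q \<in> Hs" by (rule \<pi>_HD[OF linmap_closed[OF B.aug qB] q(2)])
      then have "\<epsilon> q \<in> \<epsilon>A ` carrier (FA 0)" using A.aug_surj by simp
      then obtain a where a: "a \<in> carrier (FA 0)" "\<epsilon> q = \<epsilon> a" using \<epsilon>A by auto
      interpret F0: module R "FB 0" by (rule B.F)
      have "\<epsilon> (q \<ominus>\<^bsub>FB 0\<^esub> a) = \<zero>\<^bsub>M\<^esub>"
        using linmap_minus[OF B.aug B.F B.C qB memA[OF a(1)]] a(2)
          M.minus_self[OF linmap_closed[OF B.aug memA[OF a(1)]]] by simp
      then have "q \<ominus>\<^bsub>FB 0\<^esub> a \<in> d 0 ` carrier (FB (Suc 0))"
        using qB memA[OF a(1)] by (intro B.ex0D) auto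
      then obtain b where b: "b \<in> carrier (FB (Suc 0))" "q \<ominus>\<^bsub>FB 0\<^esub> a = d 0 b" by blast
      have "q = dC 0 (p (Suc 0) b)" using p_minus[OF q(1) a(1)] p_d[OF b(1)] b(2) by simp
      then show "q \<in> dC 0 ` carrier (FC (Suc 0))" using linmap_closed[OF p b(1)] by blast
    qed
  qed
  fix n
  show "dC (Suc n) ` carrier (FC (Suc (Suc n))) = a_kernel (FC (Suc n)) (FC n) (dC n)"
  proof
    show "dC (Suc n) ` carrier (FC (Suc (Suc n))) \<subseteq> a_kernel (FC (Suc n)) (FC n) (dC n)"
    proof
      fix y assume "y \<in> dC (Suc n) ` carrier (FC (Suc (Suc n)))"
      then obtain q where q: "q \<in> carrier (FC (Suc (Suc n)))" "y = p (Suc n) (d (Suc n) q)"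
        by (auto simp: dC_def)
      have "dC n y = p n (d n (d (Suc n) q))"
        unfolding q(2) by (rule p_d[OF linmap_closed[OF B.d memC[OF q(1)]], symmetric])
      then have "dC n y = \<zero>\<^bsub>FC n\<^esub>"
        using B.dd[OF memC[OF q(1)]] linmap_zero[OF p B.F FC] by simp
      then show "y \<in> a_kernel (FC (Suc n)) (FC n) (dC n)"
        using linmap_closed[OF dC q(1)] q(2) by (simp add: a_kernel_eq dC_def)
    qed
    show "a_kernel (FC (Suc n)) (FC n) (dC n) \<subseteq> dC (Suc n) ` carrier (FC (Suc (Suc n)))"
    proof
      fix q assume "q \<in> a_kernel (FC (Suc n)) (FC n) (dC n)"
      then have q: "q \<in> carrier (FC (Suc n))" "dC n q = \<zero>\<^bsub>FC n\<^esub>" by (auto simp: a_kernel_eq)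
      note qB = memC[OF q(1)]
      interpret Fn: module R "FB n" by (rule B.F)
      interpret FS: module R "FB (Suc n)" by (rule B.F)
      have rd: "r n (d n q) \<in> carrier (FA n)" by (rule linmap_closed[OF r linmap_closed[OF B.d qB]])
      \<comment> \<open>A vanishing projection means that all nonzero coordinates of
        \<open>d n q\<close> lie in \<open>As n\<close>.\<close>
      have "dC n q = \<zero>\<^bsub>FB n\<^esub>" using q(2) free_module_ops(2) by metis
      then have dq: "d n q = r n (d n q)" using d_split[OF q(1)] memA[OF rd] by simp
      then have dqA: "d n q \<in> carrier (FA n)" using rd by simp
      \<comment> \<open>Exactness over \<open>As\<close> applies because \<open>d n q\<close> is a
        cycle there, as is seen by the augmentation for \<open>n = 0\<close> and by the preceding
        differential otherwise.\<close>
      have "d n q \<in> dA n ` carrier (FA (Suc n))"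
      proof (cases n)
        case 0
        have "\<epsilon>A (d 0 q) = \<zero>\<^bsub>M\<^esub>" using \<epsilon>A dqA B.aug_d qB 0 by simp
        then show ?thesis using A.ex0D[of "d 0 q"] dqA 0 by simp
      next
        case (Suc m)
        have "dA m (d (Suc m) q) = \<zero>\<^bsub>FB m\<^esub>" using dA dqA B.dd qB Suc by simp
        then have "dA m (d (Suc m) q) = \<zero>\<^bsub>FA m\<^esub>" using free_module_ops(2) by metis
        then show ?thesis using A.exD[of "d (Suc m) q" m] dqA Suc by simp
      qed
      then obtain a where a: "a \<in> carrier (FA (Suc n))" "d n q = d n a" using dA by auto
      have "d n (q \<ominus>\<^bsub>FB (Suc n)\<^esub> a) = \<zero>\<^bsub>FB n\<^esub>"
        using linmap_minus[OF B.d B.F B.F qB memA[OF a(1)]] a(2)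
          Fn.minus_self[OF linmap_closed[OF B.d memA[OF a(1)]]] by simp
      then have "q \<ominus>\<^bsub>FB (Suc n)\<^esub> a \<in> d (Suc n) ` carrier (FB (Suc (Suc n)))"
        using qB memA[OF a(1)] by (intro B.exD) auto
      then obtain b where b: "b \<in> carrier (FB (Suc (Suc n)))" "q \<ominus>\<^bsub>FB (Suc n)\<^esub> a = d (Suc n) b"
        by blast
      have "q = dC (Suc n) (p (Suc (Suc n)) b)"
        using p_minus[OF q(1) a(1)] p_d[OF b(1)] b(2) by simp
      then show "q \<in> dC (Suc n) ` carrier (FC (Suc (Suc n)))" using linmap_closed[OF p b(1)] by blast
    qed
  qed
qed

end

section \<open>Exactness of Ext and Tor\<close>

locale sub_res_coeff = sub_res R Bs As d dA M \<epsilon> \<epsilon>A Hs C \<pi>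
  for R :: "('r, 'e) ring_scheme" and Bs As :: "nat \<Rightarrow> 'b set" and d dA
    and M :: "('r, 'm) module" and \<epsilon> \<epsilon>A and Hs and C :: "('r, 'c) module" and \<pi> +
  fixes X :: "('r, 'x) module" and \<D> :: "('r, 'u) module set"
  assumes X: "module R X" and S: "serre_subcategory R \<D>" and inf: "infinite (UNIV :: 'u set)"
begin

sublocale XA: coeff_res R As dA "M\<lparr>carrier := Hs\<rparr>" \<epsilon>A X
  by (intro coeff_res.intro free_res.intro coeff_res_axioms.intro AR X)
sublocale XB: coeff_res R Bs d M \<epsilon> X
  by (intro coeff_res.intro free_res.intro coeff_res_axioms.intro BR X)
sublocale XC: coeff_res R Cs dC C \<epsilon>C X
  by (intro coeff_res.intro free_res.intro coeff_res_axioms.intro quotient_resolution X)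

sublocale X: module R X by (rule X)

section \<open>Ext along the degreewise split sequence\<close>

lemma hom_split:
  assumes f: "linmap R (FB n) X f" and x: "x \<in> carrier (FB n)"
  shows "f x = f (r n x) \<oplus>\<^bsub>X\<^esub> f (p n x)"
  using arg_cong[OF split[OF x], of f]
    linmap_add[OF f memA[OF linmap_closed[OF r x]] memC[OF linmap_closed[OF p x]]] by simp

lemma hom_d_split:
  assumes f: "linmap R (FB n) X f" and q: "q \<in> carrier (FC (Suc n))"
  shows "f (d n q) = f (r n (d n q)) \<oplus>\<^bsub>X\<^esub> f (dC n q)"
  using hom_split[OF f linmap_closed[OF B.d memC[OF q]]] by (simp add: dC_def)

lemma compose_p: "\<phi> \<in> mod_hom R (FC i) X \<Longrightarrow> compose (carrier (FB i)) \<phi> (p i) \<in> mod_hom R (FB i) X"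
  by (rule compose_mod_hom[OF p B.F])

lemma compose_p_Z:
  assumes \<phi>: "\<phi> \<in> XC.Z i"
  shows "compose (carrier (FB i)) \<phi> (p i) \<in> XB.Z i"
proof -
  have "\<phi> (p i (d i x)) = \<zero>\<^bsub>X\<^esub>" if x: "x \<in> carrier (FB (Suc i))" for x
    using \<phi> linmap_closed[OF p x] unfolding p_d[OF x] XC.mem_Z by blast
  then show ?thesis
    using \<phi> compose_p linmap_closed[OF B.d] by (simp add: XC.mem_Z XB.mem_Z compose_def)
qed

lemma compose_p_B:
  assumes \<phi>: "\<phi> \<in> XC.B i"
  shows "compose (carrier (FB i)) \<phi> (p i) \<in> XB.B i"
proof (cases i)
  case 0
  then show ?thesis
    using \<phi> compose_p[of \<phi>] linmap_closed[OF p] by (simp add: XC.mem_B0 XB.mem_B0 compose_def)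
next
  case (Suc j)
  then obtain \<psi> where *: "\<phi> \<in> mod_hom R (FC (Suc j)) X" "\<psi> \<in> mod_hom R (FC j) X"
    "\<And>x. x \<in> carrier (FC (Suc j)) \<Longrightarrow> \<phi> x = \<psi> (dC j x)" using XC.mem_BSuc \<phi> by blast
  have "compose (carrier (FB (Suc j))) \<phi> (p (Suc j)) x = compose (carrier (FB j)) \<psi> (p j) (d j x)"
    if x: "x \<in> carrier (FB (Suc j))" for x
    using x *(3)[OF linmap_closed[OF p x]] p_d[OF x] linmap_closed[OF B.d x]
    by (simp add: compose_def)
  then show ?thesis unfolding Suc XB.mem_BSuc using compose_p[OF *(1)] compose_p[OF *(2)] by blast
qed

lemma linmap_compose_p:
  "linmap R (XC.Zm i) (XB.Zm i)
     (\<lambda>\<phi>. compose (carrier (FB i)) \<phi> (p i))"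
  using linmap_pull[OF p B.F, of i X] compose_p_Z submodule_subset[OF XC.Z]
  by (auto simp: linmap_def subset_iff)

lemma restrict_A: "\<phi> \<in> mod_hom R (FB i) X \<Longrightarrow> compose (carrier (FA i)) \<phi> (\<lambda>x. x) \<in> mod_hom R (FA i) X"
  by (rule compose_mod_hom[OF inclA A.F])

lemma restrict_A_Z:
  assumes \<phi>: "\<phi> \<in> XB.Z i"
  shows "compose (carrier (FA i)) \<phi> (\<lambda>x. x) \<in> XA.Z i"
proof -
  have "\<phi> (dA i x) = \<zero>\<^bsub>X\<^esub>" if x: "x \<in> carrier (FA (Suc i))" for x
    using \<phi> memA[OF x] unfolding dA[OF x] XB.mem_Z by blast
  then show ?thesis
    using \<phi> restrict_A linmap_closed[OF A.d] by (simp add: XB.mem_Z XA.mem_Z compose_def)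
qed

lemma restrict_A_B:
  assumes \<phi>: "\<phi> \<in> XB.B i"
  shows "compose (carrier (FA i)) \<phi> (\<lambda>x. x) \<in> XA.B i"
proof (cases i)
  case 0
  then show ?thesis
    using \<phi> restrict_A[of \<phi>] memA by (simp add: XB.mem_B0 XA.mem_B0 compose_def)
next
  case (Suc j)
  then obtain \<psi> where *: "\<phi> \<in> mod_hom R (FB (Suc j)) X" "\<psi> \<in> mod_hom R (FB j) X"
    "\<And>x. x \<in> carrier (FB (Suc j)) \<Longrightarrow> \<phi> x = \<psi> (d j x)" using XB.mem_BSuc \<phi> by blast
  have "compose (carrier (FA (Suc j))) \<phi> (\<lambda>x. x) x = compose (carrier (FA j)) \<psi> (\<lambda>x. x) (dA j x)"
    if x: "x \<in> carrier (FA (Suc j))" for x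
    using x *(3)[OF memA[OF x]] dA[OF x] linmap_closed[OF A.d x] by (simp add: compose_def)
  then show ?thesis unfolding Suc XA.mem_BSuc using restrict_A[OF *(1)] restrict_A[OF *(2)] by blast
qed

text \<open>Let the restriction of a cocycle \<open>z\<close> to \<open>FA\<close> be a coboundary.
  Extending its primitive by zero along \<open>r\<close> produces a coboundary \<open>k\<close> of
  the middle complex with the same restriction. Then \<open>z - k\<close> vanishes on
  \<open>FA\<close>, so it factors through \<open>p\<close> and is a cocycle of the
  quotient.\<close>

lemma ext_middle:
  assumes bA: "belongs_to R (ext_res R X As dA i) \<D>" and bC: "belongs_to R (ext_res R X Cs dC i) \<D>"
  shows "belongs_to R (ext_res R X Bs d i) \<D>"
proof -
  let ?\<alpha> = "\<lambda>\<phi>. compose (carrier (FB i)) \<phi> (p i)" and ?\<beta> = "\<lambda>\<phi>. compose (carrier (FA i)) \<phi> (\<lambda>x. x)"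
  have "belongs_to R (quot_module (XB.Zm i) (XB.B i)) \<D>"
  proof (rule belongs_to_exact[OF S inf XC.HZ XB.HZ XA.HZ XC.B XB.B XA.B linmap_compose_p compose_p_B])
    show "linmap R (XB.Zm i) (XA.Zm i) ?\<beta>"
      using linmap_pull[OF inclA A.F, of i X] restrict_A_Z submodule_subset[OF XB.Z]
      by (auto simp: linmap_def subset_iff)
    show "belongs_to R (quot_module (XC.Zm i) (XC.B i)) \<D>"
      using bC by (simp add: ext_res_def)
    show "belongs_to R (quot_module (XA.Zm i) (XA.B i)) \<D>"
      using bA by (simp add: ext_res_def)
    fix z assume "z \<in> carrier (XB.Zm i)" and \<beta>z: "?\<beta> z \<in> XA.B i"
    then have z: "z \<in> XB.Z i" by simp
    then have zh: "z \<in> mod_hom R (FB i) X" by (simp add: XB.mem_Z)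
    have "\<exists>k\<in>XB.B i. \<forall>x\<in>carrier (FA i). k x = z x"
    proof (cases i)
      case 0
      have "(\<lambda>x\<in>carrier (FB 0). \<zero>\<^bsub>X\<^esub>) \<in> XB.B 0"
        using restrict_mod_hom[OF linmap_zero_fun[OF X] B.F] by (simp add: XB.mem_B0)
      moreover have "z x = \<zero>\<^bsub>X\<^esub>" if "x \<in> carrier (FA 0)" for x
        using \<beta>z that 0 by (simp add: XA.mem_B0 compose_def)
      ultimately show ?thesis using memA 0 by (intro bexI[of _ "\<lambda>x\<in>carrier (FB 0). \<zero>\<^bsub>X\<^esub>"]) auto
    next
      case (Suc j)
      then obtain \<psi> where *: "\<psi> \<in> mod_hom R (FA j) X"
        "\<And>x. x \<in> carrier (FA (Suc j)) \<Longrightarrow> ?\<beta> z x = \<psi> (dA j x)" using XA.mem_BSuc \<beta>z by blast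
      \<comment> \<open>\<open>\<psi>\<close> extended by zero on the complementary generators; its
        coboundary \<open>?k\<close> agrees with \<open>z\<close> on \<open>FA\<close>.\<close>
      let ?w = "compose (carrier (FB j)) \<psi> (r j)"
      have w: "?w \<in> mod_hom R (FB j) X" by (rule compose_mod_hom[OF r B.F *(1)])
      let ?k = "compose (carrier (FB (Suc j))) ?w (d j)"
      have kh: "?k \<in> mod_hom R (FB (Suc j)) X" by (rule compose_mod_hom[OF B.d B.F w])
      have kB: "?k \<in> XB.B (Suc j)"
        unfolding XB.mem_BSuc using kh by (intro conjI bexI[OF _ w] ballI) (simp_all add: compose_eq)
      have "?k x = z x" if x: "x \<in> carrier (FA (Suc j))" for x
        using *(2)[OF x] x memA[OF x] linmap_closed[OF B.d memA[OF x]] dA[OF x] rA[OF dA_mem[OF x]] Suc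
        by (simp add: compose_def)
      then show ?thesis using kB Suc by blast
    qed
    then obtain k where k: "k \<in> XB.B i" and kz: "\<And>x. x \<in> carrier (FA i) \<Longrightarrow> k x = z x" by blast
    have kZ: "k \<in> XB.Z i" by (rule subsetD[OF XB.B_Z k])
    then have kh: "k \<in> mod_hom R (FB i) X" by (simp add: XB.mem_Z)
    let ?v = "\<lambda>x. z x \<ominus>\<^bsub>X\<^esub> k x"
    have v: "linmap R (FB i) X ?v"
      by (rule linmap_minus_fun[OF linmap_mod_hom[OF zh] linmap_mod_hom[OF kh] X])
    have vA: "?v x = \<zero>\<^bsub>X\<^esub>" if "x \<in> carrier (FA i)" for x
      using kz[OF that] X.minus_self linmap_closed[OF linmap_mod_hom[OF zh] memA[OF that]] by simp
    have vd: "?v (d i x) = \<zero>\<^bsub>X\<^esub>" if "x \<in> carrier (FB (Suc i))" for x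
      using z kZ that X.minus_self[OF X.zero_closed] by (simp add: XB.mem_Z)
    let ?y = "compose (carrier (FC i)) (\<lambda>x\<in>carrier (FB i). ?v x) (\<lambda>x. x)"
    have vh: "(\<lambda>x\<in>carrier (FB i). ?v x) \<in> mod_hom R (FB i) X" by (rule restrict_mod_hom[OF v B.F])
    have yh: "?y \<in> mod_hom R (FC i) X" by (rule compose_mod_hom[OF inclC FC vh])
    have yv: "?y q = ?v q" if "q \<in> carrier (FC i)" for q
      using that memC[OF that] by (simp add: compose_def)
    have y: "?y \<in> XC.Z i"
    proof -
      \<comment> \<open>On \<open>FC\<close> the quotient differential differs from \<open>d\<close>
        only by a term in \<open>FA\<close>, where \<open>?v\<close> vanishes.\<close>
      have "?y (dC i q) = \<zero>\<^bsub>X\<^esub>" if q: "q \<in> carrier (FC (Suc i))" for q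
        using hom_d_split[OF v q] vd[OF memC[OF q]] yv[OF linmap_closed[OF dC q]]
          vA[OF linmap_closed[OF r linmap_closed[OF B.d memC[OF q]]]]
          linmap_closed[OF v memC[OF linmap_closed[OF dC q]]] by simp
      then show ?thesis using yh by (simp add: XC.mem_Z)
    qed
    have zx: "z x = ?\<alpha> ?y x \<oplus>\<^bsub>X\<^esub> k x" if x: "x \<in> carrier (FB i)" for x
    proof -
      have "?v x = ?\<alpha> ?y x"
        using hom_split[OF v x] vA[OF linmap_closed[OF r x]] yv[OF linmap_closed[OF p x]] x
          linmap_closed[OF v memC[OF linmap_closed[OF p x]]] by (simp add: compose_def)
      then show ?thesis
        using X.minus_add_cancel[OF linmap_closed[OF linmap_mod_hom[OF zh] x]
          linmap_closed[OF linmap_mod_hom[OF kh] x]] by simp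
    qed
    have "z = (\<lambda>x\<in>carrier (FB i). ?\<alpha> ?y x \<oplus>\<^bsub>X\<^esub> k x)"
      by (rule mod_hom_eqI[OF zh restrict_mod_hom[OF linmap_add_fun[OF linmap_mod_hom[OF compose_p[OF yh]]
        linmap_mod_hom[OF kh] X] B.F]]) (simp only: zx restrict_apply')
    then show "\<exists>y\<in>carrier (XC.Zm i). \<exists>k\<in>XB.B i.
        z = ?\<alpha> y \<oplus>\<^bsub>XB.Zm i\<^esub> k"
      using y k by (auto simp: Hom_module_simps)
  qed (assumption | erule restrict_A_B)+
  then show ?thesis by (simp add: ext_res_def)
qed

text \<open>In the splitting of \<open>FB\<close>, the map \<open>r d\<close> from \<open>FC\<close>
  to \<open>FA\<close> is the off-diagonal block of the differential. The equation is this block of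
  the relation that \<open>d\<close> after \<open>d\<close> is zero: the block anticommutes with
  \<open>dA\<close> and \<open>dC\<close>, and so induces the connecting map.\<close>

lemma d_r_d:
  assumes q: "q \<in> carrier (FC (Suc (Suc n)))"
  shows "dA n (r (Suc n) (d (Suc n) q)) \<oplus>\<^bsub>FA n\<^esub> r n (d n (dC (Suc n) q)) = \<zero>\<^bsub>FA n\<^esub>"
proof -
  let ?a = "r (Suc n) (d (Suc n) q)"
  have a: "?a \<in> carrier (FA (Suc n))" by (rule linmap_closed[OF r linmap_closed[OF B.d memC[OF q]]])
  have c: "dC (Suc n) q \<in> carrier (FC (Suc n))" by (rule linmap_closed[OF dC q])
  have "d n (d (Suc n) q) = d n ?a \<oplus>\<^bsub>FB n\<^esub> d n (dC (Suc n) q)"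
    using arg_cong[OF d_split[OF q], of "d n"] linmap_add[OF B.d memA[OF a] memC[OF c]] by simp
  then have "\<zero>\<^bsub>FB n\<^esub> = d n ?a \<oplus>\<^bsub>FB n\<^esub> d n (dC (Suc n) q)" using B.dd[OF memC[OF q]] by simp
  then have "r n \<zero>\<^bsub>FB n\<^esub> = r n (d n ?a) \<oplus>\<^bsub>FA n\<^esub> r n (d n (dC (Suc n) q))"
    using linmap_add[OF r linmap_closed[OF B.d memA[OF a]] linmap_closed[OF B.d memC[OF c]]] by simp
  then show ?thesis
    using rA[OF dA_mem[OF a]] dA[OF a] linmap_zero[OF r B.F A.F] by simp
qed

text \<open>The connecting map is composition with the block \<open>r d\<close>. If
  \<open>z p\<close> is the coboundary of \<open>\<psi>\<close>, then \<open>\<psi>\<close>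
  restricted to \<open>FA\<close> is a cocycle because \<open>p\<close> vanishes there, and
  splitting \<open>d\<close> on \<open>FC\<close> expresses \<open>z\<close> as the connecting image
  of this cocycle plus the coboundary of \<open>\<psi>\<close> restricted to
  \<open>FC\<close>.\<close>

lemma ext_right:
  assumes bB: "belongs_to R (ext_res R X Bs d i) \<D>"
    and bA: "\<And>j. i = Suc j \<Longrightarrow> belongs_to R (ext_res R X As dA j) \<D>"
  shows "belongs_to R (ext_res R X Cs dC i) \<D>"
proof -
  let ?\<beta> = "\<lambda>i \<phi>. compose (carrier (FB i)) \<phi> (p i)"
  have bB': "belongs_to R (quot_module (XB.Zm i) (XB.B i)) \<D>"
    using bB by (simp add: ext_res_def)
  have \<beta>q: "?\<beta> i z q = z q" if "q \<in> carrier (FC i)" for i z q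
    using that memC[OF that] pC[OF that] by (simp add: compose_def)
  have "belongs_to R (quot_module (XC.Zm i) (XC.B i)) \<D>"
  proof (cases i)
    case 0
    \<comment> \<open>No connecting map reaches degree 0. There, \<open>p\<close> being onto makes
      composition with it injective, and zero is the only coboundary.\<close>
    show ?thesis
    proof (rule belongs_to_inj[OF S inf XC.HZ XB.HZ XC.B XB.B linmap_compose_p compose_p_B _ bB'])
      fix z assume "z \<in> carrier (XC.Zm i)" and b: "?\<beta> i z \<in> XB.B i"
      then have "z \<in> mod_hom R (FC 0) X" by (simp add: XC.mem_Z 0)
      moreover have "z q = \<zero>\<^bsub>X\<^esub>" if "q \<in> carrier (FC 0)" for q
        using b memC[OF that] \<beta>q[OF that, of z] unfolding 0 XB.mem_B0 by metis
      ultimately show "z \<in> XC.B i" by (simp add: 0 XC.mem_B0)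
    qed
  next
    case (Suc j)
    let ?\<alpha> = "\<lambda>\<phi>. compose (carrier (FC (Suc j))) \<phi> (\<lambda>q. r j (d j q))"
    have rd: "linmap R (FC (Suc n)) (FA n) (\<lambda>q. r n (d n q))" for n
      by (rule linmap_comp[OF linmap_comp[OF inclC B.d] r])
    have \<alpha>h: "?\<alpha> \<phi> \<in> mod_hom R (FC (Suc j)) X" if "\<phi> \<in> mod_hom R (FA j) X" for \<phi>
      by (rule compose_mod_hom[OF rd FC that])
    have dr: "\<phi> (dA n (r (Suc n) (d (Suc n) q))) \<oplus>\<^bsub>X\<^esub> \<phi> (r n (d n (dC (Suc n) q))) = \<zero>\<^bsub>X\<^esub>"
      if \<phi>: "\<phi> \<in> mod_hom R (FA n) X" and q: "q \<in> carrier (FC (Suc (Suc n)))" for \<phi> n q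
      using arg_cong[OF d_r_d[OF q], of \<phi>] linmap_zero[OF linmap_mod_hom[OF \<phi>] A.F X]
        linmap_add[OF linmap_mod_hom[OF \<phi>] linmap_closed[OF A.d linmap_closed[OF rd q]]
          linmap_closed[OF rd linmap_closed[OF dC q]]] by simp
    have \<alpha>Z: "?\<alpha> \<phi> \<in> XC.Z (Suc j)" if \<phi>: "\<phi> \<in> XA.Z j" for \<phi>
    proof -
      have \<phi>h: "\<phi> \<in> mod_hom R (FA j) X" using \<phi> by (simp add: XA.mem_Z)
      have "?\<alpha> \<phi> (dC (Suc j) q) = \<zero>\<^bsub>X\<^esub>" if q: "q \<in> carrier (FC (Suc (Suc j)))" for q
      proof -
        have "\<phi> (dA j (r (Suc j) (d (Suc j) q))) = \<zero>\<^bsub>X\<^esub>"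
          using \<phi> linmap_closed[OF rd q] by (simp add: XA.mem_Z)
        then show ?thesis
          using dr[OF \<phi>h q] linmap_closed[OF dC q]
            linmap_closed[OF linmap_mod_hom[OF \<phi>h] linmap_closed[OF rd linmap_closed[OF dC q]]]
          by (simp add: compose_def)
      qed
      then show ?thesis using \<alpha>h[OF \<phi>h] by (simp add: XC.mem_Z)
    qed
    have \<alpha>B: "?\<alpha> \<phi> \<in> XC.B (Suc j)" if \<phi>: "\<phi> \<in> XA.B j" for \<phi>
    proof (cases j)
      case 0
      then have \<phi>h: "\<phi> \<in> mod_hom R (FA j) X" and \<phi>0: "\<And>x. x \<in> carrier (FA j) \<Longrightarrow> \<phi> x = \<zero>\<^bsub>X\<^esub>"
        using \<phi> by (simp_all add: XA.mem_B0)
      have "?\<alpha> \<phi> q = (\<lambda>x\<in>carrier (FC j). \<zero>\<^bsub>X\<^esub>) (dC j q)" if q: "q \<in> carrier (FC (Suc j))" for q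
        using q \<phi>0[OF linmap_closed[OF rd q]] linmap_closed[OF dC q] by (simp add: compose_def)
      then show ?thesis
        unfolding XC.mem_BSuc using \<alpha>h[OF \<phi>h] restrict_mod_hom[OF linmap_zero_fun[OF X] FC] by blast
    next
      case (Suc m)
      then obtain \<chi> where *: "\<phi> \<in> mod_hom R (FA (Suc m)) X" "\<chi> \<in> mod_hom R (FA m) X"
        "\<And>x. x \<in> carrier (FA (Suc m)) \<Longrightarrow> \<phi> x = \<chi> (dA m x)" using XA.mem_BSuc \<phi> by blast
      \<comment> \<open>The sign comes from the anticommutation in \<open>d_r_d\<close>: the
        coboundary of \<open>\<chi>\<close>, pulled back along \<open>r d\<close>, is the coboundary
        of \<open>- \<chi> r d\<close>.\<close>
      let ?n = "\<lambda>q. \<zero>\<^bsub>X\<^esub> \<ominus>\<^bsub>X\<^esub> \<chi> (r m (d m q))"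
      have n: "linmap R (FC (Suc m)) X ?n"
        by (rule linmap_minus_fun[OF linmap_zero_fun[OF X] linmap_comp[OF rd linmap_mod_hom[OF *(2)]] X])
      have "?\<alpha> \<phi> q = (\<lambda>x\<in>carrier (FC (Suc m)). ?n x) (dC j q)" if "q \<in> carrier (FC (Suc j))" for q
      proof -
        have q: "q \<in> carrier (FC (Suc (Suc m)))" using that Suc by simp
        note h = linmap_mod_hom[OF *(2)]
        have c: "\<chi> (dA m (r (Suc m) (d (Suc m) q))) \<in> carrier X"
          "\<chi> (r m (d m (dC (Suc m) q))) \<in> carrier X"
          using linmap_closed[OF h] linmap_closed[OF A.d] linmap_closed[OF rd] q linmap_closed[OF dC q]
          by blast+
        have "\<chi> (dA m (r (Suc m) (d (Suc m) q))) = \<zero>\<^bsub>X\<^esub> \<ominus>\<^bsub>X\<^esub> \<chi> (r m (d m (dC (Suc m) q)))"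
          using dr[OF *(2) q] c by (metis X.add.inv_closed X.add.inv_solve_right X.minus_eq X.zero_closed X.l_zero)
        then show ?thesis
          using *(3)[OF linmap_closed[OF rd q]] q linmap_closed[OF dC q] Suc by (simp add: compose_def)
      qed
      moreover have "?\<alpha> \<phi> \<in> mod_hom R (FC (Suc j)) X" using \<alpha>h *(1) Suc by simp
      ultimately show ?thesis unfolding XC.mem_BSuc using restrict_mod_hom[OF n FC] Suc by blast
    qed
    show ?thesis unfolding Suc
    proof (rule belongs_to_exact[OF S inf XA.HZ XC.HZ XB.HZ XA.B XC.B XB.B _ \<alpha>B linmap_compose_p compose_p_B])
      show "linmap R (XA.Zm j) (XC.Zm (Suc j)) ?\<alpha>"
        using linmap_pull[OF rd FC, of j X] \<alpha>Z submodule_subset[OF XA.Z]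
        by (auto simp: linmap_def subset_iff)
      show "belongs_to R (quot_module (XA.Zm j) (XA.B j)) \<D>"
        using bA[OF Suc] by (simp add: ext_res_def)
      show "belongs_to R (quot_module (XB.Zm (Suc j)) (XB.B (Suc j))) \<D>"
        using bB' Suc by simp
      fix z assume "z \<in> carrier (XC.Zm (Suc j))"
        and b: "?\<beta> (Suc j) z \<in> XB.B (Suc j)"
      then have z: "z \<in> mod_hom R (FC (Suc j)) X" by (simp add: XC.mem_Z)
      from b obtain \<psi> where \<psi>: "\<psi> \<in> mod_hom R (FB j) X"
        "\<And>x. x \<in> carrier (FB (Suc j)) \<Longrightarrow> ?\<beta> (Suc j) z x = \<psi> (d j x)" using XB.mem_BSuc by blast
      note \<psi>l = linmap_mod_hom[OF \<psi>(1)]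
      let ?y = "compose (carrier (FA j)) \<psi> (\<lambda>x. x)"
      have "\<psi> (dA j x) = \<zero>\<^bsub>X\<^esub>" if x: "x \<in> carrier (FA (Suc j))" for x
        using \<psi>(2)[OF memA[OF x]] memA[OF x] dA[OF x] pA[OF x] linmap_zero[OF linmap_mod_hom[OF z] FC X]
        by (simp add: compose_def)
      then have y: "?y \<in> XA.Z j"
        using restrict_A[OF \<psi>(1)] linmap_closed[OF A.d] by (simp add: XA.mem_Z compose_def)
      let ?\<psi>C = "compose (carrier (FC j)) \<psi> (\<lambda>x. x)"
      let ?k = "compose (carrier (FC (Suc j))) ?\<psi>C (dC j)"
      have \<psi>C: "?\<psi>C \<in> mod_hom R (FC j) X" by (rule compose_mod_hom[OF inclC FC \<psi>(1)])
      have kh: "?k \<in> mod_hom R (FC (Suc j)) X" by (rule compose_mod_hom[OF dC FC \<psi>C])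
      have k: "?k \<in> XC.B (Suc j)"
        unfolding XC.mem_BSuc using kh by (intro conjI bexI[OF _ \<psi>C] ballI) (simp_all add: compose_eq)
      have zq: "z q = ?\<alpha> ?y q \<oplus>\<^bsub>X\<^esub> ?k q" if q: "q \<in> carrier (FC (Suc j))" for q
        using \<psi>(2)[OF memC[OF q]] \<beta>q[OF q, of z] hom_d_split[OF \<psi>l q] q linmap_closed[OF rd q]
          linmap_closed[OF dC q] by (simp add: compose_def)
      have yh: "?y \<in> mod_hom R (FA j) X" by (rule restrict_A[OF \<psi>(1)])
      have "z = (\<lambda>q\<in>carrier (FC (Suc j)). ?\<alpha> ?y q \<oplus>\<^bsub>X\<^esub> ?k q)"
        by (rule mod_hom_eqI[OF z restrict_mod_hom[OF linmap_add_fun[OF linmap_mod_hom[OF \<alpha>h[OF yh]]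
          linmap_mod_hom[OF kh] X] FC]]) (simp only: zq restrict_apply')
      then show "\<exists>y\<in>carrier (XA.Zm j). \<exists>k\<in>XC.B (Suc j).
          z = ?\<alpha> y \<oplus>\<^bsub>XC.Zm (Suc j)\<^esub> k"
        using y k by (auto simp: Hom_module_simps)
    qed
  qed
  then show ?thesis by (simp add: ext_res_def)
qed

section \<open>Tor along the degreewise split sequence\<close>

abbreviation "T\<iota> n \<equiv> tensor_map R (FA n) (FB n) X (\<lambda>x. x)"
abbreviation "T\<sigma> n \<equiv> tensor_map R (FC n) (FB n) X (\<lambda>x. x)"
abbreviation "Tp n \<equiv> tensor_map R (FB n) (FC n) X (p n)"
abbreviation "Tr n \<equiv> tensor_map R (FB n) (FA n) X (r n)"

lemma T\<iota>: "linmap R (XA.T n) (XB.T n) (T\<iota> n)" by (rule tensor_map_linmap(1)[OF A.F B.F X inclA])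
lemma T\<sigma>: "linmap R (XC.T n) (XB.T n) (T\<sigma> n)" by (rule tensor_map_linmap(1)[OF FC B.F X inclC])
lemma Tp: "linmap R (XB.T n) (XC.T n) (Tp n)" by (rule tensor_map_linmap(1)[OF B.F FC X p])
lemma Tr: "linmap R (XB.T n) (XA.T n) (Tr n)" by (rule tensor_map_linmap(1)[OF B.F A.F X r])

lemma Tr_T\<iota>:
  assumes "z \<in> carrier (XA.T n)" shows "Tr n (T\<iota> n z) = z"
  using tensor_map_comp[OF A.F B.F A.F X inclA r refl assms] tensor_map_id[OF A.F X rA assms] by simp

lemma Tp_T\<sigma>:
  assumes "z \<in> carrier (XC.T n)" shows "Tp n (T\<sigma> n z) = z"
  using tensor_map_comp[OF FC B.F FC X inclC p refl assms] tensor_map_id[OF FC X pC assms] by simp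

lemma Tp_T\<iota>:
  assumes "z \<in> carrier (XA.T n)" shows "Tp n (T\<iota> n z) = \<zero>\<^bsub>XC.T n\<^esub>"
  using tensor_map_comp[OF A.F B.F FC X inclA p refl assms] tensor_map_zero[OF A.F FC X pA assms] by simp

lemma T_split:
  assumes "z \<in> carrier (XB.T n)" shows "z = T\<iota> n (Tr n z) \<oplus>\<^bsub>XB.T n\<^esub> T\<sigma> n (Tp n z)"
proof -
  have rB: "linmap R (FB n) (FB n) (r n)" and pB: "linmap R (FB n) (FB n) (p n)"
    using linmap_comp[OF r inclA] linmap_comp[OF p inclC] by simp_all
  have "tensor_map R (FB n) (FB n) X (\<lambda>x. x) z =
      tensor_map R (FB n) (FB n) X (r n) z \<oplus>\<^bsub>XB.T n\<^esub> tensor_map R (FB n) (FB n) X (p n) z"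
    by (rule tensor_map_add[OF B.F B.F X rB pB _ assms]) (rule split)
  then show ?thesis
    using tensor_map_id[OF B.F X refl assms] tensor_map_comp[OF B.F A.F B.F X r inclA refl assms]
      tensor_map_comp[OF B.F FC B.F X p inclC refl assms] by simp
qed

lemma td_T\<iota>:
  assumes "z \<in> carrier (XA.T (Suc n))" shows "XB.td n (T\<iota> (Suc n) z) = T\<iota> n (XA.td n z)"
  by (rule tensor_map_square[OF A.F B.F A.F B.F X inclA B.d A.d inclA _ assms]) (rule dA[symmetric])

lemma td_Tp:
  assumes "z \<in> carrier (XB.T (Suc n))" shows "XC.td n (Tp (Suc n) z) = Tp n (XB.td n z)"
  by (rule tensor_map_square[OF B.F FC B.F FC X p dC B.d p _ assms]) (rule p_d[symmetric])

lemma T\<iota>_Z: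
  assumes z: "z \<in> XA.TZ i" shows "T\<iota> i z \<in> XB.TZ i"
proof -
  have "XB.td j (T\<iota> i z) = \<zero>\<^bsub>XB.T j\<^esub>" if "i = Suc j" for j
    using z that td_T\<iota>[of z j] linmap_zero[OF T\<iota> XA.T XB.T] by (simp add: XA.mem_TZ)
  then show ?thesis using z linmap_closed[OF T\<iota>] by (simp add: XA.mem_TZ XB.mem_TZ)
qed

lemma Tp_Z:
  assumes z: "z \<in> XB.TZ i" shows "Tp i z \<in> XC.TZ i"
proof -
  have "XC.td j (Tp i z) = \<zero>\<^bsub>XC.T j\<^esub>" if "i = Suc j" for j
    using z that td_Tp[of z j] linmap_zero[OF Tp XB.T XC.T] by (simp add: XB.mem_TZ)
  then show ?thesis using z linmap_closed[OF Tp] by (simp add: XB.mem_TZ XC.mem_TZ)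
qed

lemma T\<iota>_B:
  assumes "z \<in> XA.TB i" shows "T\<iota> i z \<in> XB.TB i"
proof -
  obtain w where "w \<in> carrier (XA.T (Suc i))" "z = XA.td i w" using assms unfolding tor_B_def by blast
  then show ?thesis using td_T\<iota> linmap_closed[OF T\<iota>] unfolding tor_B_def by (metis imageI)
qed

lemma Tp_B:
  assumes "z \<in> XB.TB i" shows "Tp i z \<in> XC.TB i"
proof -
  obtain w where "w \<in> carrier (XB.T (Suc i))" "z = XB.td i w" using assms unfolding tor_B_def by blast
  then show ?thesis using td_Tp linmap_closed[OF Tp] unfolding tor_B_def by (metis imageI)
qed

lemma linmap_Tp: "linmap R (XB.TZm i) (XC.TZm i) (Tp i)"
  using Tp[of i] Tp_Z submodule_subset[OF XB.TZ] by (auto simp: linmap_def subset_iff)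

text \<open>The inclusion stays injective after tensoring because it is split by
  \<open>Tr\<close>.\<close>

lemma T\<iota>_zeroD:
  assumes "z \<in> carrier (XA.T n)" "T\<iota> n z = \<zero>\<^bsub>XB.T n\<^esub>" shows "z = \<zero>\<^bsub>XA.T n\<^esub>"
  using Tr_T\<iota>[OF assms(1)] assms(2) linmap_zero[OF Tr XB.T XA.T] by simp

text \<open>If the image of a cycle \<open>z\<close> in the quotient is the boundary of
  \<open>w\<close>, lift \<open>w\<close> along \<open>T\<sigma>\<close> and subtract its boundary
  from \<open>z\<close>. The difference has no component in the quotient, so it comes from
  \<open>FA\<close>, and injectivity of \<open>T\<iota>\<close> shows that its preimage is a
  cycle.\<close>

lemma tor_middle:
  assumes bA: "belongs_to R (tor_res R X As dA i) \<D>" and bC: "belongs_to R (tor_res R X Cs dC i) \<D>"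
  shows "belongs_to R (tor_res R X Bs d i) \<D>"
proof -
  interpret TB: module R "XB.T i" by (rule XB.T)
  interpret TC: module R "XC.T i" by (rule XC.T)
  have "belongs_to R (quot_module (XB.TZm i) (XB.TB i)) \<D>"
  proof (rule belongs_to_exact[OF S inf XA.TTZ XB.TTZ XC.TTZ XA.TB XB.TB XC.TB _ T\<iota>_B linmap_Tp Tp_B])
    show "linmap R (XA.TZm i) (XB.TZm i) (T\<iota> i)"
      using T\<iota>[of i] T\<iota>_Z submodule_subset[OF XA.TZ] by (auto simp: linmap_def subset_iff)
    show "belongs_to R (quot_module (XA.TZm i) (XA.TB i)) \<D>"
      using bA by (simp add: tor_res_def)
    show "belongs_to R (quot_module (XC.TZm i) (XC.TB i)) \<D>"
      using bC by (simp add: tor_res_def)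
    fix z assume "z \<in> carrier (XB.TZm i)" and Pz: "Tp i z \<in> XC.TB i"
    then have z: "z \<in> XB.TZ i" "z \<in> carrier (XB.T i)" by (simp_all add: XB.mem_TZ)
    from Pz obtain w where w: "w \<in> carrier (XC.T (Suc i))" "Tp i z = XC.td i w"
      unfolding tor_B_def by blast
    let ?k = "XB.td i (T\<sigma> (Suc i) w)"
    have \<sigma>w: "T\<sigma> (Suc i) w \<in> carrier (XB.T (Suc i))" by (rule linmap_closed[OF T\<sigma> w(1)])
    have k: "?k \<in> XB.TB i" unfolding tor_B_def using \<sigma>w by blast
    have kZ: "?k \<in> XB.TZ i" by (rule subsetD[OF XB.TB_TZ k])
    have kc: "?k \<in> carrier (XB.T i)" by (rule linmap_closed[OF XB.td \<sigma>w])
    let ?v = "z \<ominus>\<^bsub>XB.T i\<^esub> ?k"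
    have v: "?v \<in> XB.TZ i" by (rule submodule_minus[OF XB.TZ XB.T z(1) kZ])
    have vc: "?v \<in> carrier (XB.T i)" using z kc by simp
    have "Tp i ?k = Tp i z" using td_Tp[OF \<sigma>w] Tp_T\<sigma>[OF w(1)] w(2) by simp
    then have "Tp i ?v = \<zero>\<^bsub>XC.T i\<^esub>"
      using linmap_minus[OF Tp XB.T XC.T z(2) kc] TC.minus_self[OF linmap_closed[OF Tp z(2)]] by simp
    then have \<iota>r: "T\<iota> i (Tr i ?v) = ?v"
      using T_split[OF vc] linmap_zero[OF T\<sigma> XC.T XB.T]
        linmap_closed[OF T\<iota> linmap_closed[OF Tr vc]] by simp
    have "XA.td j (Tr i ?v) = \<zero>\<^bsub>XA.T j\<^esub>" if i: "i = Suc j" for j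
    proof (rule T\<iota>_zeroD)
      have m: "Tr i ?v \<in> carrier (XA.T (Suc j))" using linmap_closed[OF Tr vc] i by simp
      show "XA.td j (Tr i ?v) \<in> carrier (XA.T j)" by (rule linmap_closed[OF XA.td m])
      show "T\<iota> j (XA.td j (Tr i ?v)) = \<zero>\<^bsub>XB.T j\<^esub>"
        using td_T\<iota>[OF m] \<iota>r v i by (simp add: XB.mem_TZ)
    qed
    then have "Tr i ?v \<in> XA.TZ i" using linmap_closed[OF Tr vc] by (simp add: XA.mem_TZ)
    moreover have "z = T\<iota> i (Tr i ?v) \<oplus>\<^bsub>XB.T i\<^esub> ?k"
      unfolding \<iota>r using TB.minus_add_cancel[OF z(2) kc] by simp
    ultimately show "\<exists>y\<in>carrier (XA.TZm i). \<exists>k\<in>XB.TB i.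
        z = T\<iota> i y \<oplus>\<^bsub>XB.TZm i\<^esub> k"
      using k by auto
  qed
  then show ?thesis by (simp add: tor_res_def)
qed

text \<open>On chains, the connecting map lifts along \<open>T\<sigma>\<close>, takes the boundary
  and reads off the component from \<open>FA\<close>. If it sends \<open>z\<close> to the boundary
  of \<open>v\<close>, then \<open>T\<sigma> z - T\<iota> v\<close> is a cycle of the middle complex
  over \<open>z\<close>.\<close>

lemma tor_right:
  assumes bB: "belongs_to R (tor_res R X Bs d i) \<D>"
    and bA: "\<And>j. i = Suc j \<Longrightarrow> belongs_to R (tor_res R X As dA j) \<D>"
  shows "belongs_to R (tor_res R X Cs dC i) \<D>"
proof -
  have bB': "belongs_to R (quot_module (XB.TZm i) (XB.TB i)) \<D>"
    using bB by (simp add: tor_res_def)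
  interpret TCi: module R "XC.T i" by (rule XC.T)
  have zB: "\<zero>\<^bsub>XC.T i\<^esub> \<in> XC.TB i" using submodule_zero[OF XC.TB] by simp
  have "belongs_to R (quot_module (XC.TZm i) (XC.TB i)) \<D>"
  proof (cases i)
    case 0
    show ?thesis
    proof (rule belongs_to_surj[OF S inf XB.TTZ XC.TTZ XB.TB XC.TB linmap_Tp Tp_B _ bB'])
      fix z assume "z \<in> carrier (XC.TZm i)"
      then have z: "z \<in> carrier (XC.T i)" by (simp add: XC.mem_TZ)
      \<comment> \<open>In degree 0 everything is a cycle, so the right inverse
        \<open>T\<sigma>\<close> of \<open>Tp\<close> yields preimages at once.\<close>
      have "T\<sigma> i z \<in> XB.TZ i" using linmap_closed[OF T\<sigma> z] 0 by (simp add: XB.mem_TZ)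
      moreover have "z = Tp i (T\<sigma> i z) \<oplus>\<^bsub>XC.T i\<^esub> \<zero>\<^bsub>XC.T i\<^esub>" using Tp_T\<sigma>[OF z] z by simp
      ultimately show "\<exists>y\<in>carrier (XB.TZm i). \<exists>k\<in>XC.TB i.
          z = Tp i y \<oplus>\<^bsub>XC.TZm i\<^esub> k" using zB by auto
    qed
  next
    case (Suc j)
    interpret TA: module R "XA.T j" by (rule XA.T)
    interpret TB: module R "XB.T j" by (rule XB.T)
    interpret TBS: module R "XB.T (Suc j)" by (rule XB.T)
    interpret TCS: module R "XC.T (Suc j)" by (rule XC.T)
    let ?\<beta> = "\<lambda>c. Tr j (XB.td j (T\<sigma> (Suc j) c))"
    have td\<sigma>: "linmap R (XC.T (Suc n)) (XB.T n) (\<lambda>c. XB.td n (T\<sigma> (Suc n) c))" for n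
      by (rule linmap_comp[OF T\<sigma> XB.td])
    have \<beta>: "linmap R (XC.T (Suc j)) (XA.T j) ?\<beta>" by (rule linmap_comp[OF td\<sigma> Tr])
    have tsplit: "XB.td n (T\<sigma> (Suc n) c) = T\<iota> n (Tr n (XB.td n (T\<sigma> (Suc n) c))) \<oplus>\<^bsub>XB.T n\<^esub> T\<sigma> n (XC.td n c)"
      if c: "c \<in> carrier (XC.T (Suc n))" for n c
      using T_split[OF linmap_closed[OF td\<sigma> c]] td_Tp[OF linmap_closed[OF T\<sigma> c]] Tp_T\<sigma>[OF c] by simp
    \<comment> \<open>On a cycle the component from \<open>FC\<close> disappears, so the boundary of
      the lift is exactly the image of its component from \<open>FA\<close>.\<close>
    have \<iota>\<beta>: "T\<iota> j (?\<beta> c) = XB.td j (T\<sigma> (Suc j) c)" if c: "c \<in> XC.TZ (Suc j)" for c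
    proof -
      have cc: "c \<in> carrier (XC.T (Suc j))" "XC.td j c = \<zero>\<^bsub>XC.T j\<^esub>" using c by (simp_all add: XC.mem_TZ)
      show ?thesis
        using tsplit[OF cc(1)] cc(2) linmap_zero[OF T\<sigma> XC.T XB.T]
          linmap_closed[OF T\<iota> linmap_closed[OF \<beta> cc(1)]] by simp
    qed
    have \<beta>Z: "?\<beta> c \<in> XA.TZ j" if c: "c \<in> XC.TZ (Suc j)" for c
    proof -
      have cc: "c \<in> carrier (XC.T (Suc j))" using c by (simp add: XC.mem_TZ)
      have "XA.td m (?\<beta> c) = \<zero>\<^bsub>XA.T m\<^esub>" if j: "j = Suc m" for m
      proof (rule T\<iota>_zeroD)
        have b: "?\<beta> c \<in> carrier (XA.T (Suc m))" using linmap_closed[OF \<beta> cc] j by simp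
        show "XA.td m (?\<beta> c) \<in> carrier (XA.T m)" by (rule linmap_closed[OF XA.td b])
        have "T\<iota> m (XA.td m (?\<beta> c)) = XB.td m (XB.td j (T\<sigma> (Suc j) c))"
          using td_T\<iota>[OF b] \<iota>\<beta>[OF c] j by simp
        then show "T\<iota> m (XA.td m (?\<beta> c)) = \<zero>\<^bsub>XB.T m\<^esub>"
          using XB.tdd[of "T\<sigma> (Suc j) c" m] linmap_closed[OF T\<sigma> cc] j by simp
      qed
      then show ?thesis using linmap_closed[OF \<beta> cc] by (simp add: XA.mem_TZ)
    qed
    have \<beta>B: "?\<beta> c \<in> XA.TB j" if c: "c \<in> XC.TB (Suc j)" for c
    proof -
      obtain w where w: "w \<in> carrier (XC.T (Suc (Suc j)))" "c = XC.td (Suc j) w"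
        using c unfolding tor_B_def by blast
      \<comment> \<open>The boundary of the lifted \<open>w\<close> is the image of
        \<open>?u\<close> plus the lift of \<open>c\<close>. Taking boundaries once more gives zero,
        so \<open>?\<beta> c\<close> is the negative of the boundary of \<open>?u\<close>.\<close>
      let ?u = "Tr (Suc j) (XB.td (Suc j) (T\<sigma> (Suc (Suc j)) w))"
      have u: "?u \<in> carrier (XA.T (Suc j))" by (rule linmap_closed[OF Tr linmap_closed[OF td\<sigma> w(1)]])
      have cc: "c \<in> carrier (XC.T (Suc j))" using w linmap_closed[OF XC.td] by simp
      have "XB.td j (XB.td (Suc j) (T\<sigma> (Suc (Suc j)) w)) = \<zero>\<^bsub>XB.T j\<^esub>"
        by (rule XB.tdd[OF linmap_closed[OF T\<sigma> w(1)]])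
      moreover have "XB.td j (XB.td (Suc j) (T\<sigma> (Suc (Suc j)) w)) =
          XB.td j (T\<iota> (Suc j) ?u) \<oplus>\<^bsub>XB.T j\<^esub> XB.td j (T\<sigma> (Suc j) c)"
        using arg_cong[OF tsplit[OF w(1)], of "XB.td j"] w(2)
          linmap_add[OF XB.td linmap_closed[OF T\<iota> u] linmap_closed[OF T\<sigma> cc]] by simp
      ultimately have "T\<iota> j (XA.td j ?u) \<oplus>\<^bsub>XB.T j\<^esub> XB.td j (T\<sigma> (Suc j) c) = \<zero>\<^bsub>XB.T j\<^esub>"
        using td_T\<iota>[OF u] by simp
      then have "Tr j (T\<iota> j (XA.td j ?u)) \<oplus>\<^bsub>XA.T j\<^esub> ?\<beta> c = \<zero>\<^bsub>XA.T j\<^esub>"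
        using linmap_add[OF Tr linmap_closed[OF T\<iota> linmap_closed[OF XA.td u]] linmap_closed[OF td\<sigma> cc]]
          linmap_zero[OF Tr XB.T XA.T] by simp
      then have e: "XA.td j ?u \<oplus>\<^bsub>XA.T j\<^esub> ?\<beta> c = \<zero>\<^bsub>XA.T j\<^esub>"
        using Tr_T\<iota>[OF linmap_closed[OF XA.td u]] by simp
      have "?\<beta> c \<oplus>\<^bsub>XA.T j\<^esub> XA.td j ?u = \<zero>\<^bsub>XA.T j\<^esub>"
        using e linmap_closed[OF XA.td u] linmap_closed[OF \<beta> cc] by (simp add: TA.a_comm)
      then have "?\<beta> c = \<ominus>\<^bsub>XA.T j\<^esub> (XA.td j ?u)"
        using TA.minus_equality[OF _ linmap_closed[OF XA.td u] linmap_closed[OF \<beta> cc]] by simp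
      then have "?\<beta> c = \<zero>\<^bsub>XA.T j\<^esub> \<ominus>\<^bsub>XA.T j\<^esub> XA.td j ?u"
        using linmap_closed[OF XA.td u] by (simp add: TA.minus_eq)
      moreover have "submodule (XA.TB j) R (XA.T j)"
        using submodule_image[OF XA.td XA.T XA.T submodule_carrier[OF XA.T]] by (simp add: tor_B_def)
      moreover have "XA.td j ?u \<in> XA.TB j" using u unfolding tor_B_def by blast
      ultimately show ?thesis using submodule_minus[OF _ XA.T submodule_zero] by metis
    qed
    show ?thesis unfolding Suc
    proof (rule belongs_to_exact[OF S inf XB.TTZ XC.TTZ XA.TTZ XB.TB XC.TB XA.TB linmap_Tp Tp_B _ \<beta>B])
      show "linmap R (XC.TZm (Suc j)) (XA.TZm j) ?\<beta>"
        using \<beta> \<beta>Z submodule_subset[OF XC.TZ] by (auto simp: linmap_def subset_iff)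
      show "belongs_to R (quot_module (XA.TZm j) (XA.TB j)) \<D>"
        using bA[OF Suc] by (simp add: tor_res_def)
      show "belongs_to R (quot_module (XB.TZm (Suc j)) (XB.TB (Suc j))) \<D>"
        using bB' Suc by simp
      fix z assume "z \<in> carrier (XC.TZm (Suc j))" and b: "?\<beta> z \<in> XA.TB j"
      then have z: "z \<in> XC.TZ (Suc j)" "z \<in> carrier (XC.T (Suc j))" by (simp_all add: XC.mem_TZ)
      from b obtain v where v: "v \<in> carrier (XA.T (Suc j))" "?\<beta> z = XA.td j v"
        unfolding tor_B_def by blast
      let ?w = "T\<sigma> (Suc j) z \<ominus>\<^bsub>XB.T (Suc j)\<^esub> T\<iota> (Suc j) v"
      have c: "T\<sigma> (Suc j) z \<in> carrier (XB.T (Suc j))" "T\<iota> (Suc j) v \<in> carrier (XB.T (Suc j))"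
        using linmap_closed[OF T\<sigma> z(2)] linmap_closed[OF T\<iota> v(1)] .
      have "XB.td j ?w = XB.td j (T\<sigma> (Suc j) z) \<ominus>\<^bsub>XB.T j\<^esub> XB.td j (T\<sigma> (Suc j) z)"
        using linmap_minus[OF XB.td XB.T XB.T c] td_T\<iota>[OF v(1)] v(2)[symmetric] \<iota>\<beta>[OF z(1)] by simp
      then have "XB.td j ?w = \<zero>\<^bsub>XB.T j\<^esub>" using TB.minus_self[OF linmap_closed[OF XB.td c(1)]] by simp
      then have w: "?w \<in> XB.TZ (Suc j)" using c by (simp add: XB.mem_TZ)
      have "Tp (Suc j) ?w = z \<ominus>\<^bsub>XC.T (Suc j)\<^esub> \<zero>\<^bsub>XC.T (Suc j)\<^esub>"
        using linmap_minus[OF Tp XB.T XC.T c] Tp_T\<sigma>[OF z(2)] Tp_T\<iota>[OF v(1)] by simp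
      then have "z = Tp (Suc j) ?w \<oplus>\<^bsub>XC.T (Suc j)\<^esub> \<zero>\<^bsub>XC.T (Suc j)\<^esub>"
        using TCS.minus_add_cancel[OF z(2) TCS.zero_closed] by simp
      then show "\<exists>y\<in>carrier (XB.TZm (Suc j)). \<exists>k\<in>XC.TB (Suc j).
          z = Tp (Suc j) y \<oplus>\<^bsub>XC.TZm (Suc j)\<^esub> k"
        using w zB Suc by auto
    qed
  qed
  then show ?thesis by (simp add: tor_res_def)
qed

end

section \<open>The standard resolution\<close>

lemma standard_free_resolution:
  assumes "module R N"
  shows "free_resolution R (res_basis R N) (res_diff R N) N (res_aug R N)"
  unfolding free_resolution_def
  by (intro conjI allI assms linmap_mod_hom standard_resolution[OF assms, unfolded res_mod_def])

lemma lin_ext_incl: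
  assumes "module R M" "module R M'" "linmap R M' M (\<lambda>x. x)" "B' \<subseteq> B"
    and \<phi>: "\<phi> \<in> B' \<rightarrow> carrier M'" "\<phi> \<in> B \<rightarrow> carrier M" and c: "c \<in> carrier (free_module R B')"
  shows "lin_ext R B' M' \<phi> c = lin_ext R B M \<phi> c"
proof -
  have cr: "cring R" using assms(1) by (simp add: module_def)
  have 1: "linmap R (free_module R B') M (lin_ext R B' M' \<phi>)"
    using linmap_comp[OF linmap_mod_hom[OF lin_ext_hom[OF assms(2) \<phi>(1)]] assms(3)] by simp
  have 2: "linmap R (free_module R B') M (lin_ext R B M \<phi>)"
    using linmap_comp[OF linmap_incl[OF assms(4)] linmap_mod_hom[OF lin_ext_hom[OF assms(1) \<phi>(2)]]]
    by simp
  show ?thesis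
  proof (rule free_linmap_eq[OF cr assms(1) 1 2 _ c])
    fix b assume "b \<in> B'"
    then show "lin_ext R B' M' \<phi> (free_gen R b) = lin_ext R B M \<phi> (free_gen R b)"
      using lin_ext_free_gen[OF assms(2) \<phi>(1)] lin_ext_free_gen[OF assms(1) \<phi>(2)] assms(4) by auto
  qed
qed

lemma res_basis_SucE:
  assumes "b \<in> res_basis R N (Suc n)"
  obtains l where "b = Syz l" "set l \<subseteq> carrier R \<times> res_basis R N n"
  using assms by (cases n) auto

lemma syz_value_res_basis:
  assumes "cring R"
  shows "syz_value R \<in> res_basis R N (Suc n) \<rightarrow> carrier (free_module R (res_basis R N n))"
proof
  fix b assume "b \<in> res_basis R N (Suc n)"
  then obtain l where "b = Syz l" "set l \<subseteq> carrier R \<times> res_basis R N n" by (rule res_basis_SucE)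
  then show "syz_value R b \<in> carrier (free_module R (res_basis R N n))"
    using lin_comb_closed[OF assms] by simp
qed

lemma linmap_submodule_incl: "submodule H R N \<Longrightarrow> linmap R (N\<lparr>carrier := H\<rparr>) N (\<lambda>x. x)"
  using submodule_subset by (intro linmapI) auto

lemma res_aug_submodule:
  assumes N: "module R N" and H: "submodule H R N"
    and c: "c \<in> carrier (free_module R (res_basis R (N\<lparr>carrier := H\<rparr>) 0))"
  shows "res_aug R (N\<lparr>carrier := H\<rparr>) c = res_aug R N c"
  unfolding res_aug_def
  by (rule lin_ext_incl[OF N submodule_module[OF H N] linmap_submodule_incl[OF H] _ _ _ c])
    (use submodule_subset[OF H] in auto)

lemma res_diff_submodule:
  assumes N: "module R N" and H: "submodule H R N"
    and sub: "res_basis R (N\<lparr>carrier := H\<rparr>) n \<subseteq> res_basis R N n"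
      "res_basis R (N\<lparr>carrier := H\<rparr>) (Suc n) \<subseteq> res_basis R N (Suc n)"
    and c: "c \<in> carrier (free_module R (res_basis R (N\<lparr>carrier := H\<rparr>) (Suc n)))"
  shows "res_diff R (N\<lparr>carrier := H\<rparr>) n c = res_diff R N n c"
proof -
  have cr: "cring R" using N by (simp add: module_def)
  show ?thesis unfolding res_diff_def res_mod_def
    by (rule lin_ext_incl[OF free_module_is_module[OF cr] free_module_is_module[OF cr]
      linmap_incl[OF sub(1)] sub(2) syz_value_res_basis[OF cr] syz_value_res_basis[OF cr] c])
qed

text \<open>Whether a formal linear combination is a syzygy is decided by its value under the
  preceding map, and this value is the same for the submodule as for \<open>N\<close>.\<close>

lemma res_basis_submodule:
  assumes N: "module R N" and H: "submodule H R N"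
  shows "res_basis R (N\<lparr>carrier := H\<rparr>) n \<subseteq> res_basis R N n"
proof -
  have cr: "cring R" using N by (simp add: module_def)
  let ?A = "N\<lparr>carrier := H\<rparr>"
  have z: "\<zero>\<^bsub>?A\<^esub> = \<zero>\<^bsub>N\<^esub>" by simp
  \<comment> \<open>Two consecutive degrees are carried along, since the syzygies of degree n + 2
    are defined by a map between the terms of degrees n + 1 and n.\<close>
  have "res_basis R ?A n \<subseteq> res_basis R N n \<and> res_basis R ?A (Suc n) \<subseteq> res_basis R N (Suc n)"
  proof (induction n)
    case 0
    have 0: "res_basis R ?A 0 \<subseteq> res_basis R N 0" using submodule_subset[OF H] by auto
    moreover have "res_basis R ?A (Suc 0) \<subseteq> res_basis R N (Suc 0)"
    proof
      fix b assume "b \<in> res_basis R ?A (Suc 0)"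
      then obtain l where l: "b = Syz l" "set l \<subseteq> carrier R \<times> res_basis R ?A 0"
        "res_aug R ?A (lin_comb R l) = \<zero>\<^bsub>N\<^esub>" unfolding res_aug_def by auto
      have "res_aug R N (lin_comb R l) = \<zero>\<^bsub>N\<^esub>"
        using l(3) res_aug_submodule[OF N H lin_comb_closed[OF cr l(2)]] by simp
      moreover have "set l \<subseteq> carrier R \<times> res_basis R N 0" using l(2) 0 by blast
      ultimately show "b \<in> res_basis R N (Suc 0)" using l(1) unfolding res_aug_def by auto
    qed
    ultimately show ?case by simp
  next
    case (Suc n)
    note s = Suc.IH[THEN conjunct1] Suc.IH[THEN conjunct2]
    have "res_basis R ?A (Suc (Suc n)) \<subseteq> res_basis R N (Suc (Suc n))"
    proof
      fix b assume "b \<in> res_basis R ?A (Suc (Suc n))"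
      then obtain l where l: "b = Syz l" "set l \<subseteq> carrier R \<times> res_basis R ?A (Suc n)"
        "res_diff R ?A n (lin_comb R l) = \<zero>\<^bsub>free_module R (res_basis R ?A n)\<^esub>"
        unfolding res_diff_def res_mod_def by auto
      have "res_diff R N n (lin_comb R l) = \<zero>\<^bsub>free_module R (res_basis R N n)\<^esub>"
        using l(3) res_diff_submodule[OF N H s lin_comb_closed[OF cr l(2)]] free_module_ops(2) by metis
      moreover have "set l \<subseteq> carrier R \<times> res_basis R N (Suc n)" using l(2) s(2) by blast
      ultimately show "b \<in> res_basis R N (Suc (Suc n))"
        using l(1) unfolding res_diff_def res_mod_def by auto
    qed
    then show ?case using s(2) by blast
  qed
  then show ?thesis by blast
qed

text \<open>The complex stays and only the augmentation is composed with \<open>f\<close>. In this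
  way isomorphic modules, possibly over different types, acquire resolutions of one and the same
  module, to which the comparison results apply.\<close>

lemma free_resolution_iso:
  assumes res: "free_resolution R Bs d M \<epsilon>" and C: "module R C"
    and f: "linmap R M C f" "inj_on f (carrier M)" "f ` carrier M = carrier C"
  shows "free_resolution R Bs d C (\<lambda>x. f (\<epsilon> x))"
proof -
  interpret P: free_res R Bs d M \<epsilon> by unfold_locales (rule res)
  interpret M: module R M by (rule P.C)
  have "f (\<epsilon> x) = \<zero>\<^bsub>C\<^esub> \<longleftrightarrow> \<epsilon> x = \<zero>\<^bsub>M\<^esub>" if "x \<in> carrier (P.F 0)" for x
    using inj_on_eq_iff[OF f(2) linmap_closed[OF P.aug that] M.zero_closed]
      linmap_zero[OF f(1) P.C C] by simp
  then have "a_kernel (P.F 0) C (\<lambda>x. f (\<epsilon> x)) = a_kernel (P.F 0) M \<epsilon>" by (auto simp: a_kernel_eq)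
  moreover have "(\<lambda>x. f (\<epsilon> x)) ` carrier (P.F 0) = carrier C"
    using P.aug_surj f(3) by (metis image_image)
  ultimately show ?thesis
    unfolding free_resolution_def
    by (intro conjI allI C linmap_comp[OF P.aug f(1)] P.d P.ex) (simp_all add: P.ex0)
qed

text \<open>\<open>G i M\<close> stands for membership of \<open>Ext\<^sup>i(M, X)\<close> or \<open>Tor\<^sub>i(M, X)\<close> in the Serre subcategory. The
  carrier types of \<open>M\<close> and of \<open>C\<close> may differ, hence two predicates.\<close>

locale half_exact =
  fixes R :: "('r, 'e) ring_scheme"
    and G :: "nat \<Rightarrow> ('r, 'm) module \<Rightarrow> bool" and G' :: "nat \<Rightarrow> ('r, 'c) module \<Rightarrow> bool"
  assumes middle: "\<And>i M H C \<pi>. \<lbrakk>module R M; submodule H R M; module R C; linmap R M C \<pi>;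
      \<pi> ` carrier M = carrier C; a_kernel M C \<pi> = H; G i (M\<lparr>carrier := H\<rparr>); G' i C\<rbrakk> \<Longrightarrow> G i M"
    and right: "\<And>i M H C \<pi>. \<lbrakk>module R M; submodule H R M; module R C; linmap R M C \<pi>;
      \<pi> ` carrier M = carrier C; a_kernel M C \<pi> = H; G i M;
      \<And>j. i = Suc j \<Longrightarrow> G j (M\<lparr>carrier := H\<rparr>)\<rbrakk> \<Longrightarrow> G' i C"
    and iso: "\<And>i M C f. \<lbrakk>module R M; module R C; linmap R M C f; inj_on f (carrier M);
      f ` carrier M = carrier C\<rbrakk> \<Longrightarrow> G i M \<longleftrightarrow> G' i C"

lemma standard_sub_res_coeff:
  fixes M :: "('r, 'm) module" and C :: "('r, 'c) module" and X :: "('r, 'x) module"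
    and \<D> :: "('r, 'u) module set"
  assumes "module R X" "serre_subcategory R \<D>" "infinite (UNIV :: 'u set)"
    and M: "module R M" "submodule H R M" and C: "module R C" "linmap R M C \<pi>"
      "\<pi> ` carrier M = carrier C" "a_kernel M C \<pi> = H"
  shows "sub_res_coeff R (res_basis R M) (res_basis R (M\<lparr>carrier := H\<rparr>)) (res_diff R M)
    (res_diff R (M\<lparr>carrier := H\<rparr>)) M (res_aug R M) (res_aug R (M\<lparr>carrier := H\<rparr>)) H C \<pi> X \<D>"
  by (intro sub_res_coeff.intro sub_res.intro sub_res_coeff_axioms.intro assms
      standard_free_resolution submodule_module res_basis_submodule res_diff_submodule
      res_aug_submodule)

text \<open>\<open>ext_middle\<close> and \<open>ext_right\<close> speak of the quotient resolution
  of \<open>C\<close>; \<open>ext_res_comparison\<close> exchanges it for the standard one, before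
  the first and after the second.\<close>

lemma half_exact_Ext:
  fixes R :: "('r, 'e) ring_scheme" and X :: "('r, 'x) module" and \<D> :: "('r, 'u) module set"
  assumes X: "module R X" and S: "serre_subcategory R \<D>" and inf: "infinite (UNIV :: 'u set)"
  shows "half_exact R (\<lambda>i (M :: ('r, 'm) module). belongs_to R (Ext R i M X) \<D>)
    (\<lambda>i (C :: ('r, 'c) module). belongs_to R (Ext R i C X) \<D>)"
proof
  fix i and M :: "('r, 'm) module" and H and C :: "('r, 'c) module" and \<pi>
  assume *: "module R M" "submodule H R M" "module R C" "linmap R M C \<pi>" "\<pi> ` carrier M = carrier C"
    "a_kernel M C \<pi> = H"
  interpret sub_res_coeff R "res_basis R M" "res_basis R (M\<lparr>carrier := H\<rparr>)" "res_diff R M"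
    "res_diff R (M\<lparr>carrier := H\<rparr>)" M "res_aug R M" "res_aug R (M\<lparr>carrier := H\<rparr>)" H C \<pi> X \<D>
    by (rule standard_sub_res_coeff[OF assms *])
  note cmp = ext_res_comparison[OF S inf X]
  show "belongs_to R (Ext R i M X) \<D>"
    if "belongs_to R (Ext R i (M\<lparr>carrier := H\<rparr>) X) \<D>" "belongs_to R (Ext R i C X) \<D>"
    using ext_middle[OF that(1)[unfolded Ext_eq_ext_res]
      cmp[OF quotient_resolution standard_free_resolution[OF *(3)] that(2)[unfolded Ext_eq_ext_res]]]
    unfolding Ext_eq_ext_res .
  show "belongs_to R (Ext R i C X) \<D>"
    if "belongs_to R (Ext R i M X) \<D>"
      "\<And>j. i = Suc j \<Longrightarrow> belongs_to R (Ext R j (M\<lparr>carrier := H\<rparr>) X) \<D>"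
    using cmp[OF standard_free_resolution[OF *(3)] quotient_resolution
      ext_right[OF that(1)[unfolded Ext_eq_ext_res] that(2)[unfolded Ext_eq_ext_res]]]
    unfolding Ext_eq_ext_res .
next
  fix i and M :: "('r, 'm) module" and C :: "('r, 'c) module" and f
  assume *: "module R M" "module R C" "linmap R M C f" "inj_on f (carrier M)" "f ` carrier M = carrier C"
  note r = free_resolution_iso[OF standard_free_resolution[OF *(1)] *(2-5)] standard_free_resolution[OF *(2)]
  show "belongs_to R (Ext R i M X) \<D> \<longleftrightarrow> belongs_to R (Ext R i C X) \<D>"
    unfolding Ext_eq_ext_res
    using ext_res_comparison[OF S inf X r(1) r(2)] ext_res_comparison[OF S inf X r(2) r(1)] by blast
qed

lemma half_exact_Tor:
  fixes R :: "('r, 'e) ring_scheme" and X :: "('r, 'x) module" and \<D> :: "('r, 'u) module set"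
  assumes X: "module R X" and S: "serre_subcategory R \<D>" and inf: "infinite (UNIV :: 'u set)"
  shows "half_exact R (\<lambda>i (M :: ('r, 'm) module). belongs_to R (Tor R i M X) \<D>)
    (\<lambda>i (C :: ('r, 'c) module). belongs_to R (Tor R i C X) \<D>)"
proof
  fix i and M :: "('r, 'm) module" and H and C :: "('r, 'c) module" and \<pi>
  assume *: "module R M" "submodule H R M" "module R C" "linmap R M C \<pi>" "\<pi> ` carrier M = carrier C"
    "a_kernel M C \<pi> = H"
  interpret sub_res_coeff R "res_basis R M" "res_basis R (M\<lparr>carrier := H\<rparr>)" "res_diff R M"
    "res_diff R (M\<lparr>carrier := H\<rparr>)" M "res_aug R M" "res_aug R (M\<lparr>carrier := H\<rparr>)" H C \<pi> X \<D>
    by (rule standard_sub_res_coeff[OF assms *])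
  note cmp = tor_res_comparison[OF S inf X]
  show "belongs_to R (Tor R i M X) \<D>"
    if "belongs_to R (Tor R i (M\<lparr>carrier := H\<rparr>) X) \<D>" "belongs_to R (Tor R i C X) \<D>"
    using tor_middle[OF that(1)[unfolded Tor_eq_tor_res]
      cmp[OF quotient_resolution standard_free_resolution[OF *(3)] that(2)[unfolded Tor_eq_tor_res]]]
    unfolding Tor_eq_tor_res .
  show "belongs_to R (Tor R i C X) \<D>"
    if "belongs_to R (Tor R i M X) \<D>"
      "\<And>j. i = Suc j \<Longrightarrow> belongs_to R (Tor R j (M\<lparr>carrier := H\<rparr>) X) \<D>"
    using cmp[OF standard_free_resolution[OF *(3)] quotient_resolution
      tor_right[OF that(1)[unfolded Tor_eq_tor_res] that(2)[unfolded Tor_eq_tor_res]]]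
    unfolding Tor_eq_tor_res .
next
  fix i and M :: "('r, 'm) module" and C :: "('r, 'c) module" and f
  assume *: "module R M" "module R C" "linmap R M C f" "inj_on f (carrier M)" "f ` carrier M = carrier C"
  note r = free_resolution_iso[OF standard_free_resolution[OF *(1)] *(2-5)] standard_free_resolution[OF *(2)]
  show "belongs_to R (Tor R i M X) \<D> \<longleftrightarrow> belongs_to R (Tor R i C X) \<D>"
    unfolding Tor_eq_tor_res
    using tor_res_comparison[OF S inf X r(1) r(2)] tor_res_comparison[OF S inf X r(2) r(1)] by blast
qed

section \<open>Cyclic modules\<close>

lemma ring_module_simps:
  "carrier (ring_module R) = carrier R" "\<zero>\<^bsub>ring_module R\<^esub> = \<zero>\<^bsub>R\<^esub>"
  "x \<oplus>\<^bsub>ring_module R\<^esub> y = x \<oplus>\<^bsub>R\<^esub> y" "x \<odot>\<^bsub>ring_module R\<^esub> y = x \<otimes>\<^bsub>R\<^esub> y"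
  "x \<ominus>\<^bsub>ring_module R\<^esub> y = x \<ominus>\<^bsub>R\<^esub> y"
  by (simp_all add: ring_module_def a_minus_def a_inv_def m_inv_def)

lemma ring_module_module:
  assumes "cring R"
  shows "module R (ring_module R)"
proof -
  interpret cring R by (rule assms)
  show ?thesis
  proof (rule moduleI)
    show "abelian_group (ring_module R)"
    proof (rule abelian_groupI)
      show "\<exists>y\<in>carrier (ring_module R). y \<oplus>\<^bsub>ring_module R\<^esub> x = \<zero>\<^bsub>ring_module R\<^esub>"
        if "x \<in> carrier (ring_module R)" for x
        using that l_neg by (intro bexI[of _ "\<ominus>\<^bsub>R\<^esub> x"]) (auto simp: ring_module_simps)
    qed (auto simp: ring_module_simps a_ac)
  qed (auto simp: ring_module_simps l_distr r_distr m_assoc assms)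
qed

lemma ideal_submodule_iff:
  assumes "cring R"
  shows "ideal J R \<longleftrightarrow> submodule J R (ring_module R)"
proof
  interpret cring R by (rule assms)
  assume "ideal J R"
  then interpret ideal J R .
  show "submodule J R (ring_module R)"
    by (rule submoduleI'[OF ring_module_module[OF assms]])
      (auto simp: ring_module_simps I_l_closed)
next
  interpret cring R by (rule assms)
  assume J: "submodule J R (ring_module R)"
  have c: "J \<subseteq> carrier R" using submodule_subset[OF J] by (simp add: ring_module_simps)
  have m: "r \<otimes>\<^bsub>R\<^esub> x \<in> J" if "r \<in> carrier R" "x \<in> J" for r x
    using submodule_smult[OF J that] by (simp add: ring_module_simps)
  show "ideal J R"
  proof (rule idealI)
    show "subgroup J (add_monoid R)"
    proof (rule add.subgroupI)
      show "J \<noteq> {}" using submodule_zero[OF J] by auto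
      show "\<ominus>\<^bsub>R\<^esub> x \<in> J" if "x \<in> J" for x
        using m[of "\<ominus>\<^bsub>R\<^esub> \<one>\<^bsub>R\<^esub>" x] that c by (auto simp: l_minus)
      show "x \<oplus>\<^bsub>R\<^esub> y \<in> J" if "x \<in> J" "y \<in> J" for x y
        using submodule_add[OF J that] by (simp add: ring_module_simps)
    qed (use c in simp)
    show "x \<otimes>\<^bsub>R\<^esub> a \<in> J" if "a \<in> J" "x \<in> carrier R" for a x using m that by blast
    show "a \<otimes>\<^bsub>R\<^esub> x \<in> J" if "a \<in> J" "x \<in> carrier R" for a x
      using m[of x a] that c m_comm[of a x] by auto
  qed (rule ring_axioms)
qed

lemma cyclic_module_module: "cring R \<Longrightarrow> ideal J R \<Longrightarrow> module R (cyclic_module R J)"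
  unfolding cyclic_module_def using ideal_submodule_iff ring_module_module quot_module_module by blast

text \<open>The annihilator of the image of \<open>x\<close> in \<open>N/H\<close>.\<close>

definition colon :: "('r, 'e) ring_scheme \<Rightarrow> ('r, 'm) module \<Rightarrow> 'm set \<Rightarrow> 'm \<Rightarrow> 'r set" where
  "colon R N H x = {r \<in> carrier R. r \<odot>\<^bsub>N\<^esub> x \<in> H}"

text \<open>The submodule \<open>H + R x\<close>; \<open>adjoinI\<close> and \<open>adjoinE\<close>
  translate to sums.\<close>

definition adjoin :: "('r, 'e) ring_scheme \<Rightarrow> ('r, 'm) module \<Rightarrow> 'm set \<Rightarrow> 'm \<Rightarrow> 'm set" where
  "adjoin R N H x = {y \<in> carrier N. \<exists>r\<in>carrier R. y \<ominus>\<^bsub>N\<^esub> r \<odot>\<^bsub>N\<^esub> x \<in> H}"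

context
  fixes R :: "('r, 'e) ring_scheme" and N :: "('r, 'm) module" and H x
  assumes N: "module R N" and H: "submodule H R N" and x: "x \<in> carrier N"
begin

interpretation N: module R N by (rule N)

lemma colon_ideal: "ideal (colon R N H x) R"
proof -
  have "linmap R (ring_module R) N (\<lambda>r. r \<odot>\<^bsub>N\<^esub> x)"
    using x by (intro linmapI) (auto simp: ring_module_simps N.smult_l_distr N.smult_assoc1)
  from submodule_preimage[OF this ring_module_module[OF N.is_cring] N H]
  show ?thesis
    unfolding ideal_submodule_iff[OF N.is_cring] by (simp add: colon_def ring_module_simps)
qed

lemma adjoinI: "h \<in> H \<Longrightarrow> r \<in> carrier R \<Longrightarrow> h \<oplus>\<^bsub>N\<^esub> r \<odot>\<^bsub>N\<^esub> x \<in> adjoin R N H x"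
proof -
  assume h: "h \<in> H" and r: "r \<in> carrier R"
  have "h \<in> carrier N" using h submodule_subset[OF H] by blast
  then have "(h \<oplus>\<^bsub>N\<^esub> r \<odot>\<^bsub>N\<^esub> x) \<ominus>\<^bsub>N\<^esub> r \<odot>\<^bsub>N\<^esub> x = h"
    using r x by (simp add: N.minus_eq N.a_assoc N.r_neg)
  then show ?thesis
    unfolding adjoin_def using h r x \<open>h \<in> carrier N\<close> by (intro CollectI conjI bexI[of _ r]) auto
qed

lemma adjoinE:
  assumes "y \<in> adjoin R N H x"
  obtains h r where "h \<in> H" "r \<in> carrier R" "y = h \<oplus>\<^bsub>N\<^esub> r \<odot>\<^bsub>N\<^esub> x"
proof -
  obtain r where r: "r \<in> carrier R" "y \<ominus>\<^bsub>N\<^esub> r \<odot>\<^bsub>N\<^esub> x \<in> H" "y \<in> carrier N"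
    using assms by (auto simp: adjoin_def)
  then show ?thesis
    using that[of "y \<ominus>\<^bsub>N\<^esub> r \<odot>\<^bsub>N\<^esub> x" r] N.minus_add_cancel[of y "r \<odot>\<^bsub>N\<^esub> x"] x by auto
qed

lemma adjoin_superset: "H \<subseteq> adjoin R N H x"
proof
  fix h assume h: "h \<in> H"
  then have "h \<in> carrier N" using submodule_subset[OF H] by blast
  then show "h \<in> adjoin R N H x" using adjoinI[OF h N.R.zero_closed] x by simp
qed

lemma adjoin_mem: "x \<in> adjoin R N H x"
  using adjoinI[OF submodule_zero[OF H] N.R.one_closed] x by simp

lemma adjoin_least:
  assumes "submodule K R N" "H \<subseteq> K" "x \<in> K"
  shows "adjoin R N H x \<subseteq> K"
proof
  fix y assume "y \<in> adjoin R N H x"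
  then obtain h r where "h \<in> H" "r \<in> carrier R" "y = h \<oplus>\<^bsub>N\<^esub> r \<odot>\<^bsub>N\<^esub> x" by (rule adjoinE)
  then show "y \<in> K" using assms submodule_add[OF assms(1)] submodule_smult[OF assms(1)] by blast
qed

lemma adjoin_submodule: "submodule (adjoin R N H x) R N"
proof (rule submoduleI'[OF N])
  have c: "\<And>h. h \<in> H \<Longrightarrow> h \<in> carrier N" using submodule_subset[OF H] by blast
  show "adjoin R N H x \<subseteq> carrier N" by (auto simp: adjoin_def)
  show "\<zero>\<^bsub>N\<^esub> \<in> adjoin R N H x" using adjoin_superset submodule_zero[OF H] by blast
  show "y \<oplus>\<^bsub>N\<^esub> z \<in> adjoin R N H x" if y: "y \<in> adjoin R N H x" and z: "z \<in> adjoin R N H x" for y z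
  proof -
    obtain h r where h: "h \<in> H" "r \<in> carrier R" "y = h \<oplus>\<^bsub>N\<^esub> r \<odot>\<^bsub>N\<^esub> x" using y by (rule adjoinE)
    obtain k s where k: "k \<in> H" "s \<in> carrier R" "z = k \<oplus>\<^bsub>N\<^esub> s \<odot>\<^bsub>N\<^esub> x" using z by (rule adjoinE)
    have "y \<oplus>\<^bsub>N\<^esub> z = (h \<oplus>\<^bsub>N\<^esub> k) \<oplus>\<^bsub>N\<^esub> (r \<oplus>\<^bsub>R\<^esub> s) \<odot>\<^bsub>N\<^esub> x"
      using h k x c by (simp add: N.smult_l_distr N.a_ac)
    then show ?thesis using adjoinI[OF submodule_add[OF H h(1) k(1)]] h k by simp
  qed
  show "s \<odot>\<^bsub>N\<^esub> y \<in> adjoin R N H x" if s: "s \<in> carrier R" and y: "y \<in> adjoin R N H x" for s y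
  proof -
    obtain h r where h: "h \<in> H" "r \<in> carrier R" "y = h \<oplus>\<^bsub>N\<^esub> r \<odot>\<^bsub>N\<^esub> x" using y by (rule adjoinE)
    have "s \<odot>\<^bsub>N\<^esub> y = s \<odot>\<^bsub>N\<^esub> h \<oplus>\<^bsub>N\<^esub> (s \<otimes>\<^bsub>R\<^esub> r) \<odot>\<^bsub>N\<^esub> x"
      using h s x c by (simp add: N.smult_r_distr N.smult_assoc1)
    then show ?thesis using adjoinI[OF submodule_smult[OF H s h(1)]] h s by simp
  qed
qed

text \<open>The projection of \<open>H + R x\<close> onto \<open>R / (H : x)\<close> sends \<open>y\<close> to the coset of all \<open>r\<close> with
  \<open>y - r x \<in> H\<close>.\<close>

lemma adjoin_cyclic_quotient:
  "\<exists>\<pi>. linmap R (N\<lparr>carrier := adjoin R N H x\<rparr>) (cyclic_module R (colon R N H x)) \<pi> \<and>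
     \<pi> ` adjoin R N H x = carrier (cyclic_module R (colon R N H x)) \<and>
     a_kernel (N\<lparr>carrier := adjoin R N H x\<rparr>) (cyclic_module R (colon R N H x)) \<pi> = H"
proof -
  let ?J = "colon R N H x" and ?K = "adjoin R N H x" and ?R = "ring_module R"
  define \<pi> where "\<pi> y = {r \<in> carrier R. y \<ominus>\<^bsub>N\<^esub> r \<odot>\<^bsub>N\<^esub> x \<in> H}" for y
  note cr = N.is_cring
  note R = ring_module_module[OF cr]
  have J: "submodule ?J R ?R" using colon_ideal ideal_submodule_iff[OF cr] by blast
  have cH: "\<And>h. h \<in> H \<Longrightarrow> h \<in> carrier N" using submodule_subset[OF H] by blast
  have coset: "\<pi> (h \<oplus>\<^bsub>N\<^esub> r \<odot>\<^bsub>N\<^esub> x) = ?J +>\<^bsub>?R\<^esub> r" if h: "h \<in> H" and r: "r \<in> carrier R" for h r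
  proof (intro equalityI subsetI)
    \<comment> \<open>Writing the element as \<open>h\<close> plus a multiple by \<open>r\<close>
      turns the condition on \<open>s\<close> into one on \<open>s - r\<close>, and \<open>h\<close>
      can then be dropped because it lies in \<open>H\<close>.\<close>
    have e: "(h \<oplus>\<^bsub>N\<^esub> r \<odot>\<^bsub>N\<^esub> x) \<ominus>\<^bsub>N\<^esub> s \<odot>\<^bsub>N\<^esub> x = h \<ominus>\<^bsub>N\<^esub> (s \<ominus>\<^bsub>R\<^esub> r) \<odot>\<^bsub>N\<^esub> x"
      if s: "s \<in> carrier R" for s
      using h r s x cH
      by (simp add: N.minus_eq N.R.minus_eq N.smult_l_distr N.smult_l_minus N.minus_add N.a_ac)
    fix s
    { assume "s \<in> \<pi> (h \<oplus>\<^bsub>N\<^esub> r \<odot>\<^bsub>N\<^esub> x)"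
      then have s: "s \<in> carrier R" "h \<ominus>\<^bsub>N\<^esub> (s \<ominus>\<^bsub>R\<^esub> r) \<odot>\<^bsub>N\<^esub> x \<in> H" using e by (auto simp: \<pi>_def)
      let ?v = "(s \<ominus>\<^bsub>R\<^esub> r) \<odot>\<^bsub>N\<^esub> x"
      have v: "?v \<in> carrier N" using s r x by simp
      have "h \<ominus>\<^bsub>N\<^esub> (h \<ominus>\<^bsub>N\<^esub> ?v) = ?v"
        using cH[OF h] v by (simp add: N.minus_eq N.minus_add N.a_assoc[symmetric] N.r_neg)
      then have "?v \<in> H" using submodule_minus[OF H N h s(2)] by simp
      then have "s \<ominus>\<^bsub>R\<^esub> r \<in> ?J" using s r by (simp add: colon_def)
      then have "?J +>\<^bsub>?R\<^esub> s = ?J +>\<^bsub>?R\<^esub> r"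
        using coset_eq_iff[OF J R, of s r] s r by (simp add: ring_module_simps)
      then show "s \<in> ?J +>\<^bsub>?R\<^esub> r" using coset_self[OF J R, of s] s by (simp add: ring_module_simps) }
    { assume s: "s \<in> ?J +>\<^bsub>?R\<^esub> r"
      have r': "r \<in> carrier ?R" using r by (simp add: ring_module_simps)
      have sR: "s \<in> carrier R" using coset_memD(1)[OF J R r' s] by (simp add: ring_module_simps)
      have "s \<ominus>\<^bsub>R\<^esub> r \<in> ?J"
        using coset_memD[OF J R r' s] coset_eq_iff[OF J R _ r', of s] by (simp add: ring_module_simps)
      then have "(s \<ominus>\<^bsub>R\<^esub> r) \<odot>\<^bsub>N\<^esub> x \<in> H" by (simp add: colon_def)
      then show "s \<in> \<pi> (h \<oplus>\<^bsub>N\<^esub> r \<odot>\<^bsub>N\<^esub> x)"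
        using e[OF sR] submodule_minus[OF H N h] sR by (simp add: \<pi>_def) }
  qed
  have q: "carrier (cyclic_module R ?J) = (\<lambda>r. ?J +>\<^bsub>?R\<^esub> r) ` carrier R"
    by (simp add: cyclic_module_def quot_carrier ring_module_simps)
  have "linmap R (N\<lparr>carrier := ?K\<rparr>) (cyclic_module R ?J) \<pi>"
  proof (rule linmapI)
    fix y assume "y \<in> carrier (N\<lparr>carrier := ?K\<rparr>)"
    then have y: "y \<in> ?K" by simp
    then obtain h r where h: "h \<in> H" "r \<in> carrier R" "y = h \<oplus>\<^bsub>N\<^esub> r \<odot>\<^bsub>N\<^esub> x" by (rule adjoinE)
    then show "\<pi> y \<in> carrier (cyclic_module R ?J)" using coset q by simp
    { fix z assume "z \<in> carrier (N\<lparr>carrier := ?K\<rparr>)"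
      then have "z \<in> ?K" by simp
      then obtain k s where k: "k \<in> H" "s \<in> carrier R" "z = k \<oplus>\<^bsub>N\<^esub> s \<odot>\<^bsub>N\<^esub> x" by (rule adjoinE)
      have "y \<oplus>\<^bsub>N\<^esub> z = (h \<oplus>\<^bsub>N\<^esub> k) \<oplus>\<^bsub>N\<^esub> (r \<oplus>\<^bsub>R\<^esub> s) \<odot>\<^bsub>N\<^esub> x"
        using h k x cH by (simp add: N.smult_l_distr N.a_ac)
      then have "\<pi> (y \<oplus>\<^bsub>N\<^esub> z) = ?J +>\<^bsub>?R\<^esub> (r \<oplus>\<^bsub>R\<^esub> s)"
        using coset[OF submodule_add[OF H h(1) k(1)]] h k by simp
      then show "\<pi> (y \<oplus>\<^bsub>N\<lparr>carrier := ?K\<rparr>\<^esub> z) = \<pi> y \<oplus>\<^bsub>cyclic_module R ?J\<^esub> \<pi> z"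
        using quot_add[OF J R, of r s] coset h k by (simp add: cyclic_module_def ring_module_simps) }
    { fix s assume s: "s \<in> carrier R"
      have "s \<odot>\<^bsub>N\<^esub> y = s \<odot>\<^bsub>N\<^esub> h \<oplus>\<^bsub>N\<^esub> (s \<otimes>\<^bsub>R\<^esub> r) \<odot>\<^bsub>N\<^esub> x"
        using h s x cH by (simp add: N.smult_r_distr N.smult_assoc1)
      then have "\<pi> (s \<odot>\<^bsub>N\<^esub> y) = ?J +>\<^bsub>?R\<^esub> (s \<otimes>\<^bsub>R\<^esub> r)"
        using coset[OF submodule_smult[OF H s h(1)]] h s by simp
      then show "\<pi> (s \<odot>\<^bsub>N\<lparr>carrier := ?K\<rparr>\<^esub> y) = s \<odot>\<^bsub>cyclic_module R ?J\<^esub> \<pi> y"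
        using quot_smult[OF J R s, of r] coset h by (simp add: cyclic_module_def ring_module_simps) }
  qed
  moreover have "\<pi> ` ?K = carrier (cyclic_module R ?J)"
  proof
    show "\<pi> ` ?K \<subseteq> carrier (cyclic_module R ?J)"
      using linmap_closed[OF calculation] by auto
    show "carrier (cyclic_module R ?J) \<subseteq> \<pi> ` ?K"
    proof
      fix A assume "A \<in> carrier (cyclic_module R ?J)"
      then obtain r where r: "r \<in> carrier R" "A = ?J +>\<^bsub>?R\<^esub> r" using q by auto
      then show "A \<in> \<pi> ` ?K"
        using coset[OF submodule_zero[OF H] r(1)] adjoinI[OF submodule_zero[OF H] r(1)]
        by (intro image_eqI) simp_all
    qed
  qed
  moreover have "a_kernel (N\<lparr>carrier := ?K\<rparr>) (cyclic_module R ?J) \<pi> = H"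
  proof -
    have "\<pi> y = ?J \<longleftrightarrow> y \<in> H" if y: "y \<in> ?K" for y
    proof -
      obtain h r where h: "h \<in> H" "r \<in> carrier R" "y = h \<oplus>\<^bsub>N\<^esub> r \<odot>\<^bsub>N\<^esub> x"
        using y by (rule adjoinE)
      have "\<pi> y = ?J \<longleftrightarrow> r \<in> ?J"
        using coset[OF h(1,2)] h(3) coset_eq_self_iff[OF J R, of r] h(2) by (simp add: ring_module_simps)
      also have "\<dots> \<longleftrightarrow> r \<odot>\<^bsub>N\<^esub> x \<in> H" using h(2) by (simp add: colon_def)
      also have "\<dots> \<longleftrightarrow> y \<in> H"
      proof
        show "r \<odot>\<^bsub>N\<^esub> x \<in> H \<Longrightarrow> y \<in> H" using h submodule_add[OF H] by simp
        assume "y \<in> H"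
        then have "y \<ominus>\<^bsub>N\<^esub> h \<in> H" using submodule_minus[OF H N] h(1) by blast
        moreover have "y \<ominus>\<^bsub>N\<^esub> h = r \<odot>\<^bsub>N\<^esub> x"
          using cH[OF h(1)] h x by (simp add: N.minus_eq N.a_ac N.r_neg1 N.r_neg2 N.r_neg)
        ultimately show "r \<odot>\<^bsub>N\<^esub> x \<in> H" by simp
      qed
      finally show ?thesis .
    qed
    then show ?thesis
      using adjoin_superset by (auto simp: a_kernel_eq cyclic_module_def quot_zero)
  qed
  ultimately show ?thesis by blast
qed

end

section \<open>Modules with cyclic quotients\<close>

locale half_exact_cyclic = half_exact R G G'
  for R :: "('r, 'e) ring_scheme"
    and G :: "nat \<Rightarrow> ('r, 'm) module \<Rightarrow> bool" and G' :: "nat \<Rightarrow> ('r, 'r set) module \<Rightarrow> bool"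
begin

lemma
  assumes N: "module R N" "submodule H R N" "x \<in> carrier N"
  shows adjoin_middle: "G i (N\<lparr>carrier := H\<rparr>) \<Longrightarrow> G' i (cyclic_module R (colon R N H x)) \<Longrightarrow>
      G i (N\<lparr>carrier := adjoin R N H x\<rparr>)"
    and adjoin_right: "G i (N\<lparr>carrier := adjoin R N H x\<rparr>) \<Longrightarrow>
      (\<And>j. i = Suc j \<Longrightarrow> G j (N\<lparr>carrier := H\<rparr>)) \<Longrightarrow> G' i (cyclic_module R (colon R N H x))"
proof -
  have cr: "cring R" using N(1) by (simp add: module_def)
  let ?K = "N\<lparr>carrier := adjoin R N H x\<rparr>" and ?C = "cyclic_module R (colon R N H x)"
  obtain \<pi> where \<pi>: "linmap R ?K ?C \<pi>" "\<pi> ` adjoin R N H x = carrier ?C" "a_kernel ?K ?C \<pi> = H"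
    using adjoin_cyclic_quotient[OF N] by blast
  have K: "module R ?K" by (rule submodule_module[OF adjoin_submodule[OF N] N(1)])
  have C: "module R ?C" by (rule cyclic_module_module[OF cr colon_ideal[OF N]])
  have H: "submodule H R ?K"
    by (rule submodule_restrict_carrier[OF N(2) adjoin_submodule[OF N] adjoin_superset[OF N] N(1)])
  show "G i ?K" if "G i (N\<lparr>carrier := H\<rparr>)" "G' i ?C"
    by (rule middle[OF K H C \<pi>(1) _ \<pi>(3)]) (use \<pi>(2) that in simp_all)
  show "G' i ?C" if "G i ?K" "\<And>j. i = Suc j \<Longrightarrow> G j (N\<lparr>carrier := H\<rparr>)"
    by (rule right[OF K H C \<pi>(1) _ \<pi>(3)]) (use \<pi>(2) that in simp_all)
qed

text \<open>For \<open>H = 0\<close> the projection has trivial kernel, so \<open>R x\<close> is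
  isomorphic to \<open>R/(0 : x)\<close>. This is where membership passes between the types of
  \<open>G\<close> and \<open>G'\<close>.\<close>

lemma adjoin_zero_iff:
  assumes N: "module R N" and x: "x \<in> carrier N"
  shows "G i (N\<lparr>carrier := adjoin R N {\<zero>\<^bsub>N\<^esub>} x\<rparr>) \<longleftrightarrow> G' i (cyclic_module R (colon R N {\<zero>\<^bsub>N\<^esub>} x))"
proof -
  have cr: "cring R" using N by (simp add: module_def)
  note Z = submodule_zero_set[OF N]
  let ?K = "N\<lparr>carrier := adjoin R N {\<zero>\<^bsub>N\<^esub>} x\<rparr>" and ?C = "cyclic_module R (colon R N {\<zero>\<^bsub>N\<^esub>} x)"
  obtain \<pi> where \<pi>: "linmap R ?K ?C \<pi>" "\<pi> ` adjoin R N {\<zero>\<^bsub>N\<^esub>} x = carrier ?C"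
    "a_kernel ?K ?C \<pi> = {\<zero>\<^bsub>N\<^esub>}"
    using adjoin_cyclic_quotient[OF N Z x] by blast
  have K: "module R ?K" by (rule submodule_module[OF adjoin_submodule[OF N Z x] N])
  have C: "module R ?C" by (rule cyclic_module_module[OF cr colon_ideal[OF N Z x]])
  have "inj_on \<pi> (carrier ?K)"
    by (rule linmap_inj_iff[OF \<pi>(1) K C]) (use \<pi>(3) in \<open>auto simp: a_kernel_eq\<close>)
  then show ?thesis by (intro iso[OF K C \<pi>(1)]) (use \<pi>(2) in simp_all)
qed

text \<open>Adding the generators one at a time filters the span; each layer is
  \<open>R/(H : x)\<close>, with \<open>H\<close> the span reached so far.\<close>

lemma mod_span_G:
  assumes N: "module R N" and "finite S" "S \<subseteq> carrier N"
    and G': "\<And>H x. submodule H R N \<Longrightarrow> x \<in> carrier N \<Longrightarrow> G' i (cyclic_module R (colon R N H x))"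
  shows "G i (N\<lparr>carrier := mod_span R N S\<rparr>)"
  using assms(2,3)
proof (induction S)
  case empty
  interpret N: module R N by (rule N)
  note Z = submodule_zero_set[OF N]
  \<comment> \<open>The zero module counts as \<open>R x\<close> for \<open>x = 0\<close>, so its
    membership too is an instance of the hypothesis on cyclic modules.\<close>
  have "adjoin R N {\<zero>\<^bsub>N\<^esub>} \<zero>\<^bsub>N\<^esub> = {\<zero>\<^bsub>N\<^esub>}"
    using adjoin_least[OF N Z N.zero_closed Z] adjoin_superset[OF N Z N.zero_closed] by blast
  moreover have "mod_span R N {} = {\<zero>\<^bsub>N\<^esub>}"
    using mod_span_least[OF Z, of "{}"] submodule_zero[OF mod_span_submodule[OF N, of "{}"]] by auto
  ultimately show ?case
    using adjoin_zero_iff[OF N N.zero_closed, of i] G'[OF Z N.zero_closed] by simp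
next
  case (insert x S)
  then have x: "x \<in> carrier N" and S: "S \<subseteq> carrier N" by auto
  note sp = mod_span_submodule[OF N S]
  have sp': "submodule (mod_span R N (insert x S)) R N"
    using mod_span_submodule[OF N, of "insert x S"] x S by simp
  have "mod_span R N (insert x S) = adjoin R N (mod_span R N S) x"
  proof
    have "insert x S \<subseteq> adjoin R N (mod_span R N S) x"
      using adjoin_mem[OF N sp x] adjoin_superset[OF N sp x] mod_span_superset[of S R N] by blast
    then show "mod_span R N (insert x S) \<subseteq> adjoin R N (mod_span R N S) x"
      by (rule mod_span_least[OF adjoin_submodule[OF N sp x]])
    have i: "insert x S \<subseteq> mod_span R N (insert x S)" by (rule mod_span_superset)
    have "mod_span R N S \<subseteq> mod_span R N (insert x S)" by (rule mod_span_least[OF sp']) (use i in blast)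
    then show "adjoin R N (mod_span R N S) x \<subseteq> mod_span R N (insert x S)"
      using i by (intro adjoin_least[OF N sp x sp']) auto
  qed
  then show ?case using adjoin_middle[OF N sp x insert.IH[OF S] G'[OF sp x]] by simp
qed

end

section \<open>Noetherian induction on the annihilator\<close>

text \<open>In a Noetherian ring a nonempty chain of ideals contains its own union, so Zorn's lemma
  applies to any property of ideals.\<close>

lemma noetherian_maximal:
  assumes "noetherian_ring R" "P I0" and P: "\<And>I. P I \<Longrightarrow> ideal I R"
  obtains M where "P M" "\<And>I. P I \<Longrightarrow> M \<subseteq> I \<Longrightarrow> I = M"
proof -
  interpret noetherian_ring R by (rule assms)
  have "\<exists>M\<in>Collect P. \<forall>I\<in>Collect P. M \<subseteq> I \<longrightarrow> I = M"
  proof (rule subset_Zorn)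
    fix C assume C: "subset.chain (Collect P) C"
    show "\<exists>U\<in>Collect P. \<forall>I\<in>C. I \<subseteq> U"
    proof (cases "C = {}")
      case True
      then show ?thesis using assms(2) by auto
    next
      case False
      have "subset.chain {I. ideal I R} C"
        using C P unfolding subset.chain_def by blast
      then have "\<Union>C \<in> C" by (rule ideal_chain_is_trivial[OF False])
      moreover have "C \<subseteq> Collect P" using C unfolding subset.chain_def by (rule conjunct1)
      ultimately have "\<Union>C \<in> Collect P" by (rule rev_subsetD)
      then show ?thesis by (rule bexI[rotated]) (simp add: Union_upper)
    qed
  qed
  then obtain M where M: "M \<in> Collect P" "\<forall>I\<in>Collect P. M \<subseteq> I \<longrightarrow> I = M" by (rule bexE)
  show ?thesis
  proof (rule that)
    show "P M" using M(1) by simp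
    show "I = M" if "P I" "M \<subseteq> I" for I using M(2) that by simp
  qed
qed

text \<open>This and \<open>ideal_adjoin\<close> are \<open>colon\<close> and \<open>adjoin\<close>
  for the submodule \<open>J\<close> of the ring, written with ring operations so that they can be
  matched against ideals computed inside \<open>R/J\<close>.\<close>

definition ideal_colon :: "('r, 'e) ring_scheme \<Rightarrow> 'r set \<Rightarrow> 'r \<Rightarrow> 'r set" where
  "ideal_colon R J x = {r \<in> carrier R. r \<otimes>\<^bsub>R\<^esub> x \<in> J}"

definition ideal_adjoin :: "('r, 'e) ring_scheme \<Rightarrow> 'r set \<Rightarrow> 'r \<Rightarrow> 'r set" where
  "ideal_adjoin R J x = {r \<in> carrier R. \<exists>s\<in>carrier R. r \<ominus>\<^bsub>R\<^esub> s \<otimes>\<^bsub>R\<^esub> x \<in> J}"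

section \<open>The ideals J : x and J + xR, and their role in R/J\<close>

context
  fixes R :: "('r, 'e) ring_scheme" and J x
  assumes cr: "cring R" and J: "ideal J R" and x: "x \<in> carrier R"
begin

lemma ideal_submodule: "submodule J R (ring_module R)"
  using J ideal_submodule_iff[OF cr] by blast

lemma ideal_colon_ideal: "ideal (ideal_colon R J x) R"
  using colon_ideal[OF ring_module_module[OF cr] ideal_submodule, of x] x
  by (simp add: colon_def ideal_colon_def ring_module_simps)

lemma ideal_adjoin_eq: "ideal_adjoin R J x = adjoin R (ring_module R) J x"
  by (simp add: adjoin_def ideal_adjoin_def ring_module_simps)

lemma ideal_adjoin_ideal: "ideal (ideal_adjoin R J x) R"
  unfolding ideal_adjoin_eq ideal_submodule_iff[OF cr]
  by (rule adjoin_submodule[OF ring_module_module[OF cr] ideal_submodule])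
    (simp add: ring_module_simps x)

lemma ideal_adjoin_superset: "J \<subseteq> ideal_adjoin R J x"
  unfolding ideal_adjoin_eq
  by (rule adjoin_superset[OF ring_module_module[OF cr] ideal_submodule])
    (simp add: ring_module_simps x)

lemma ideal_adjoin_mem: "x \<in> ideal_adjoin R J x"
  unfolding ideal_adjoin_eq
  by (rule adjoin_mem[OF ring_module_module[OF cr] ideal_submodule])
    (simp add: ring_module_simps x)

lemma ideal_adjoin_least: "ideal K R \<Longrightarrow> J \<subseteq> K \<Longrightarrow> x \<in> K \<Longrightarrow> ideal_adjoin R J x \<subseteq> K"
  unfolding ideal_adjoin_eq ideal_submodule_iff[OF cr]
  by (rule adjoin_least[OF ring_module_module[OF cr] ideal_submodule])
    (simp add: ring_module_simps x)

lemma ideal_colon_superset: "J \<subseteq> ideal_colon R J x"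
proof -
  interpret ideal J R by (rule J)
  show ?thesis using x by (auto simp: ideal_colon_def I_r_closed)
qed

lemma cyclic_coset_smult:
  assumes "r \<in> carrier R" "s \<in> carrier R"
  shows "r \<odot>\<^bsub>cyclic_module R J\<^esub> (J +>\<^bsub>ring_module R\<^esub> s) = J +>\<^bsub>ring_module R\<^esub> (r \<otimes>\<^bsub>R\<^esub> s)"
  using quot_smult[OF ideal_submodule ring_module_module[OF cr] assms(1), of s] assms
  by (simp add: cyclic_module_def ring_module_simps)

lemma cyclic_coset_mem:
  "r \<in> carrier R \<Longrightarrow> J +>\<^bsub>ring_module R\<^esub> r \<in> carrier (cyclic_module R J)"
  by (simp add: cyclic_module_def quot_carrier ring_module_simps)

lemma cyclic_coset_zero_iff:
  "r \<in> carrier R \<Longrightarrow> J +>\<^bsub>ring_module R\<^esub> r = \<zero>\<^bsub>cyclic_module R J\<^esub> \<longleftrightarrow> r \<in> J"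
  using coset_eq_self_iff[OF ideal_submodule ring_module_module[OF cr], of r]
  by (simp add: cyclic_module_def quot_zero ring_module_simps)

lemma cyclic_coset_minus:
  assumes "r \<in> carrier R" "s \<in> carrier R"
  shows "(J +>\<^bsub>ring_module R\<^esub> r) \<ominus>\<^bsub>cyclic_module R J\<^esub> (J +>\<^bsub>ring_module R\<^esub> s) =
    J +>\<^bsub>ring_module R\<^esub> (r \<ominus>\<^bsub>R\<^esub> s)"
  using linmap_minus[OF linmap_coset[OF ideal_submodule ring_module_module[OF cr]]
      ring_module_module[OF cr] quot_module_module[OF ideal_submodule ring_module_module[OF cr]],
      of r s] assms
  by (simp add: cyclic_module_def ring_module_simps)

lemma colon_cyclic_zero:
  "colon R (cyclic_module R J) {\<zero>\<^bsub>cyclic_module R J\<^esub>} (J +>\<^bsub>ring_module R\<^esub> x) = ideal_colon R J x"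
proof -
  interpret cring R by (rule cr)
  show ?thesis
    using x by (simp add: colon_def ideal_colon_def cyclic_coset_smult cyclic_coset_zero_iff
      cong: conj_cong)
qed

text \<open>The quotient of \<open>R/J\<close> by the submodule generated by the coset of
  \<open>x\<close> is cyclic on the coset of 1, with annihilator \<open>J + x R\<close>.\<close>

lemma colon_cyclic_adjoin:
  "colon R (cyclic_module R J)
     (adjoin R (cyclic_module R J) {\<zero>\<^bsub>cyclic_module R J\<^esub>} (J +>\<^bsub>ring_module R\<^esub> x))
     (J +>\<^bsub>ring_module R\<^esub> \<one>\<^bsub>R\<^esub>) = ideal_adjoin R J x"
proof -
  interpret cring R by (rule cr)
  show ?thesis
    using x by (simp add: colon_def adjoin_def ideal_adjoin_def cyclic_coset_smult
      cyclic_coset_zero_iff cyclic_coset_minus cyclic_coset_mem cong: conj_cong)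
qed

lemma adjoin_cyclic_one:
  assumes "submodule H R (cyclic_module R J)"
  shows "adjoin R (cyclic_module R J) H (J +>\<^bsub>ring_module R\<^esub> \<one>\<^bsub>R\<^esub>) = carrier (cyclic_module R J)"
proof (intro equalityI subsetI)
  interpret cring R by (rule cr)
  note C = cyclic_module_module[OF cr J]
  have u: "J +>\<^bsub>ring_module R\<^esub> \<one>\<^bsub>R\<^esub> \<in> carrier (cyclic_module R J)" by (rule cyclic_coset_mem) simp
  fix y assume "y \<in> carrier (cyclic_module R J)"
  then obtain r where r: "r \<in> carrier R" "y = J +>\<^bsub>ring_module R\<^esub> r"
    by (auto simp: cyclic_module_def quot_carrier ring_module_simps)
  then have "y = r \<odot>\<^bsub>cyclic_module R J\<^esub> (J +>\<^bsub>ring_module R\<^esub> \<one>\<^bsub>R\<^esub>)" by (simp add: cyclic_coset_smult)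
  then show "y \<in> adjoin R (cyclic_module R J) H (J +>\<^bsub>ring_module R\<^esub> \<one>\<^bsub>R\<^esub>)"
    using submodule_smult[OF adjoin_submodule[OF C assms u] r(1) adjoin_mem[OF C assms u]] by simp
qed (simp add: adjoin_def)

end

section \<open>Passing from one ideal to another\<close>

locale half_exact_ideals = half_exact_cyclic R G G
  for R :: "('r, 'e) ring_scheme" and G :: "nat \<Rightarrow> ('r, 'r set) module \<Rightarrow> bool"
begin

text \<open>Two adjunctions inside \<open>R/J\<close>: the coset of \<open>x\<close> adjoined to
  zero gives a copy of \<open>R/(J : x)\<close>, and the coset of 1 adjoined to that gives all of
  \<open>R/J\<close>, with quotient \<open>R/(J + x R)\<close>. The same two stages underlie
  \<open>ideal_right\<close>.\<close>

lemma ideal_middle: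
  assumes cr: "cring R" and J: "ideal J R" and x: "x \<in> carrier R"
    and G: "G i (cyclic_module R (ideal_colon R J x))" "G i (cyclic_module R (ideal_adjoin R J x))"
  shows "G i (cyclic_module R J)"
proof -
  interpret cring R by (rule cr)
  let ?N = "cyclic_module R J"
  let ?H = "adjoin R ?N {\<zero>\<^bsub>?N\<^esub>} (J +>\<^bsub>ring_module R\<^esub> x)"
  note N = cyclic_module_module[OF cr J]
  note xN = cyclic_coset_mem[OF cr J x x] and uN = cyclic_coset_mem[OF cr J x one_closed]
  have H: "submodule ?H R ?N" by (rule adjoin_submodule[OF N submodule_zero_set[OF N] xN])
  have "G i (?N\<lparr>carrier := ?H\<rparr>)"
    using G(1) adjoin_zero_iff[OF N xN] colon_cyclic_zero[OF cr J x] by simp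
  from adjoin_middle[OF N H uN this] show ?thesis
    using G(2) colon_cyclic_adjoin[OF cr J x] adjoin_cyclic_one[OF cr J x H] by simp
qed

lemma ideal_right:
  assumes cr: "cring R" and J: "ideal J R" and x: "x \<in> carrier R"
    and G: "G i (cyclic_module R J)" "\<And>j. i = Suc j \<Longrightarrow> G j (cyclic_module R (ideal_colon R J x))"
  shows "G i (cyclic_module R (ideal_adjoin R J x))"
proof -
  interpret cring R by (rule cr)
  let ?N = "cyclic_module R J"
  let ?H = "adjoin R ?N {\<zero>\<^bsub>?N\<^esub>} (J +>\<^bsub>ring_module R\<^esub> x)"
  note N = cyclic_module_module[OF cr J]
  note xN = cyclic_coset_mem[OF cr J x x] and uN = cyclic_coset_mem[OF cr J x one_closed]
  have H: "submodule ?H R ?N" by (rule adjoin_submodule[OF N submodule_zero_set[OF N] xN])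
  have "G j (?N\<lparr>carrier := ?H\<rparr>)" if "i = Suc j" for j
    using G(2)[OF that] adjoin_zero_iff[OF N xN] colon_cyclic_zero[OF cr J x] by simp
  from adjoin_right[OF N H uN _ this] show ?thesis
    using G(1) colon_cyclic_adjoin[OF cr J x] adjoin_cyclic_one[OF cr J x H] by simp
qed

text \<open>The climb is replaced by a maximal stage: take \<open>K\<close> largest between
  \<open>\<aa>\<close> and \<open>J\<close> with the property in degree \<open>i\<close>. Adjoining
  any element of \<open>J\<close> preserves the property, so \<open>K\<close> already contains
  it.\<close>

lemma superideal:
  assumes cr: "cring R" and no: "noetherian_ring R" and a: "ideal \<aa> R"
    and G: "\<And>i. i \<le> t \<Longrightarrow> G i (cyclic_module R \<aa>)"
    and i: "i \<le> t" and J: "ideal J R" "\<aa> \<subseteq> J"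
  shows "G i (cyclic_module R J)"
  using i J
proof (induction i arbitrary: J rule: less_induct)
  case (less i)
  interpret cring R by (rule cr)
  define P where "P K \<longleftrightarrow> ideal K R \<and> \<aa> \<subseteq> K \<and> K \<subseteq> J \<and> G i (cyclic_module R K)" for K
  have P: "ideal K R" "\<aa> \<subseteq> K" "K \<subseteq> J" "G i (cyclic_module R K)" if "P K" for K
    using that by (simp_all add: P_def)
  have "P \<aa>" unfolding P_def using a G[OF less.prems(1)] less.prems(3) by simp
  then obtain K where K: "P K" and max: "\<And>I. P I \<Longrightarrow> K \<subseteq> I \<Longrightarrow> I = K"
    using noetherian_maximal[OF no _ P(1)] by metis
  note KI = P(1)[OF K]
  have "J \<subseteq> K"
  proof
    fix x assume xJ: "x \<in> J"
    then have x: "x \<in> carrier R" using ideal.Icarr[OF less.prems(2)] by blast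
    have "G i (cyclic_module R (ideal_adjoin R K x))"
    proof (rule ideal_right[OF cr KI x])
      show "G i (cyclic_module R K)" by (rule P(4)[OF K])
      fix j assume j: "i = Suc j"
      \<comment> \<open>The colon ideal need not lie in \<open>J\<close>, which is why the induction
        on the degree ranges over all ideals containing \<open>\<aa>\<close>.\<close>
      show "G j (cyclic_module R (ideal_colon R K x))"
      proof (rule less.IH[OF _ _ ideal_colon_ideal[OF cr KI x]])
        show "\<aa> \<subseteq> ideal_colon R K x"
          by (rule order_trans[OF P(2)[OF K] ideal_colon_superset[OF cr KI x]])
      qed (use j less.prems(1) in simp_all)
    qed
    then have "P (ideal_adjoin R K x)"
      unfolding P_def
      by (intro conjI ideal_adjoin_ideal[OF cr KI x] ideal_adjoin_least[OF cr KI x less.prems(2) P(3)[OF K] xJ]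
          order_trans[OF P(2)[OF K] ideal_adjoin_superset[OF cr KI x]])
    then have "ideal_adjoin R K x = K" using ideal_adjoin_superset[OF cr KI x] by (rule max)
    then show "x \<in> K" using ideal_adjoin_mem[OF cr KI x] by simp
  qed
  then have "K = J" using P(3)[OF K] by blast
  then show ?case using P(4)[OF K] by simp
qed

lemma radical_superideal:
  assumes cr: "cring R" and no: "noetherian_ring R" and a: "ideal \<aa> R"
    and G: "\<And>i. i \<le> t \<Longrightarrow> G i (cyclic_module R \<aa>)"
    and i: "i \<le> t" and J: "ideal J R" "\<And>x. x \<in> \<aa> \<Longrightarrow> \<exists>k :: nat. x [^]\<^bsub>R\<^esub> k \<in> J"
  shows "G i (cyclic_module R J)"
proof (rule ccontr)
  interpret cring R by (rule cr)
  define P where "P K \<longleftrightarrow> ideal K R \<and> (\<forall>x\<in>\<aa>. \<exists>k :: nat. x [^]\<^bsub>R\<^esub> k \<in> K) \<and>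
    \<not> G i (cyclic_module R K)" for K
  have P: "ideal K R" "\<not> G i (cyclic_module R K)" if "P K" for K
    using that by (simp_all add: P_def)
  have Ppow: "\<exists>k :: nat. x [^]\<^bsub>R\<^esub> k \<in> K" if "P K" "x \<in> \<aa>" for K x
    using that by (simp add: P_def)
  assume "\<not> G i (cyclic_module R J)"
  then have "P J" unfolding P_def using J by simp
  then obtain K where K: "P K" and max: "\<And>I. P I \<Longrightarrow> K \<subseteq> I \<Longrightarrow> I = K"
    using noetherian_maximal[OF no _ P(1)] by metis
  note KI = P(1)[OF K]
  interpret K: ideal K R by (rule KI)
  have "\<not> \<aa> \<subseteq> K" using P(2)[OF K] superideal[OF cr no a G i KI] by blast
  then obtain x where x: "x \<in> \<aa>" "x \<notin> K" by blast
  have xR: "x \<in> carrier R" using ideal.Icarr[OF a x(1)] .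
  have ex: "\<exists>k :: nat. x [^]\<^bsub>R\<^esub> k \<in> K" by (rule Ppow[OF K x(1)])
  define k where "k = (LEAST k :: nat. x [^]\<^bsub>R\<^esub> k \<in> K)"
  have k: "x [^]\<^bsub>R\<^esub> k \<in> K" unfolding k_def using ex by (rule LeastI_ex)
  have least: "x [^]\<^bsub>R\<^esub> l \<notin> K" if "l < k" for l using that not_less_Least unfolding k_def by blast
  \<comment> \<open>Exponent 0 or 1 would put \<open>x\<close> into \<open>K\<close>; hence
    \<open>k - 2\<close> below is a true subtraction.\<close>
  have "k \<noteq> 0"
  proof
    assume "k = 0"
    then have "\<one>\<^bsub>R\<^esub> \<in> K" using k by simp
    then show False using K.I_l_closed[of "\<one>\<^bsub>R\<^esub>" x] xR x(2) by simp
  qed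
  moreover have "k \<noteq> 1" using k x(2) xR by auto
  ultimately have k2: "2 \<le> k" by simp
  let ?y = "x [^]\<^bsub>R\<^esub> (k - 1)"
  have y: "?y \<in> carrier R" "?y \<notin> K" using xR least[of "k - 1"] k2 by auto
  \<comment> \<open>The exponent 2(k - 1) is split as (k - 2) + k to exhibit the factor that lies in
    \<open>K\<close>.\<close>
  have "?y \<otimes>\<^bsub>R\<^esub> ?y = x [^]\<^bsub>R\<^esub> (k - 2) \<otimes>\<^bsub>R\<^esub> x [^]\<^bsub>R\<^esub> k"
    using xR k2 by (simp add: nat_pow_mult numeral_2_eq_2)
  then have yy: "?y \<otimes>\<^bsub>R\<^esub> ?y \<in> K" using K.I_l_closed[OF k, of "x [^]\<^bsub>R\<^esub> (k - 2)"] xR by simp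
  \<comment> \<open>A failing \<open>I\<close> would again be a counterexample, since it contains
    \<open>K\<close> and hence the same powers; maximality would give \<open>I = K\<close>, against
    \<open>?y \<notin> K\<close>.\<close>
  have big: "G i (cyclic_module R I)" if I: "ideal I R" "K \<subseteq> I" "?y \<in> I" for I
  proof (rule ccontr)
    assume "\<not> G i (cyclic_module R I)"
    moreover have "\<exists>k :: nat. x [^]\<^bsub>R\<^esub> k \<in> I" if "x \<in> \<aa>" for x
      using Ppow[OF K that] I(2) by blast
    ultimately have "P I" unfolding P_def using I(1) by simp
    then have "I = K" using I(2) by (rule max)
    then show False using I(3) y(2) by simp
  qed
  have "G i (cyclic_module R (ideal_colon R K ?y))"
    by (rule big[OF ideal_colon_ideal[OF cr KI y(1)] ideal_colon_superset[OF cr KI y(1)]])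
      (use y yy in \<open>simp add: ideal_colon_def\<close>)
  moreover have "G i (cyclic_module R (ideal_adjoin R K ?y))"
    by (rule big[OF ideal_adjoin_ideal[OF cr KI y(1)] ideal_adjoin_superset[OF cr KI y(1)]
        ideal_adjoin_mem[OF cr KI y(1)]])
  ultimately have "G i (cyclic_module R K)" by (rule ideal_middle[OF cr KI y(1)])
  then show False using P(2)[OF K] by simp
qed

end

section \<open>Supports\<close>

text \<open>An ideal \<open>p\<close> maximal among those that contain \<open>J\<close> and miss all
  powers of \<open>x\<close> is prime: for \<open>b\<close> and \<open>c\<close> outside
  \<open>p\<close>, both \<open>p + b R\<close> and \<open>p + c R\<close> contain a power of
  \<open>x\<close>, and the product of the two powers lies in \<open>p + b c R\<close>.\<close>

lemma prime_avoiding_powers: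
  assumes cr: "cring R" and no: "noetherian_ring R" and J: "ideal J R" and x: "x \<in> carrier R"
    and pow: "\<And>k :: nat. x [^]\<^bsub>R\<^esub> k \<notin> J"
  obtains p where "primeideal p R" "J \<subseteq> p" "x \<notin> p"
proof -
  interpret cring R by (rule cr)
  define P where "P I \<longleftrightarrow> ideal I R \<and> J \<subseteq> I \<and> (\<forall>k :: nat. x [^]\<^bsub>R\<^esub> k \<notin> I)" for I
  have P: "ideal I R" "J \<subseteq> I" "x [^]\<^bsub>R\<^esub> k \<notin> I" if "P I" for I and k :: nat
    using that by (simp_all add: P_def)
  have "P J" unfolding P_def using J pow by simp
  then obtain p where p: "P p" and max: "\<And>I. P I \<Longrightarrow> p \<subseteq> I \<Longrightarrow> I = p"
    using noetherian_maximal[OF no _ P(1)] by metis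
  note pI = P(1)[OF p]
  interpret p: ideal p R by (rule pI)
  have hit: "\<exists>k :: nat. \<exists>s\<in>carrier R. x [^]\<^bsub>R\<^esub> k \<ominus>\<^bsub>R\<^esub> s \<otimes>\<^bsub>R\<^esub> b \<in> p"
    if b: "b \<in> carrier R" "b \<notin> p" for b
  proof (rule ccontr)
    assume "\<not> ?thesis"
    then have "\<forall>k :: nat. x [^]\<^bsub>R\<^esub> k \<notin> ideal_adjoin R p b" by (auto simp: ideal_adjoin_def)
    then have "P (ideal_adjoin R p b)"
      unfolding P_def by (intro conjI ideal_adjoin_ideal[OF cr pI b(1)]
          order_trans[OF P(2)[OF p] ideal_adjoin_superset[OF cr pI b(1)]])
    then have "ideal_adjoin R p b = p" using ideal_adjoin_superset[OF cr pI b(1)] by (rule max)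
    then show False using ideal_adjoin_mem[OF cr pI b(1)] b(2) by simp
  qed
  have "primeideal p R"
  proof (rule primeidealI[OF pI cr])
    have "x [^]\<^bsub>R\<^esub> (0::nat) \<notin> p" by (rule P(3)[OF p])
    then show "carrier R \<noteq> p" using one_closed by auto
    fix b c assume bc: "b \<in> carrier R" "c \<in> carrier R" "b \<otimes>\<^bsub>R\<^esub> c \<in> p"
    show "b \<in> p \<or> c \<in> p"
    proof (rule ccontr)
      assume "\<not> (b \<in> p \<or> c \<in> p)"
      then obtain k s l r where s: "s \<in> carrier R" "x [^]\<^bsub>R\<^esub> (k::nat) \<ominus>\<^bsub>R\<^esub> s \<otimes>\<^bsub>R\<^esub> b \<in> p"
        and r: "r \<in> carrier R" "x [^]\<^bsub>R\<^esub> (l::nat) \<ominus>\<^bsub>R\<^esub> r \<otimes>\<^bsub>R\<^esub> c \<in> p"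
        using hit bc by metis
      define u where "u = x [^]\<^bsub>R\<^esub> k \<ominus>\<^bsub>R\<^esub> s \<otimes>\<^bsub>R\<^esub> b"
      define v where "v = x [^]\<^bsub>R\<^esub> l \<ominus>\<^bsub>R\<^esub> r \<otimes>\<^bsub>R\<^esub> c"
      have uv: "u \<in> p" "v \<in> p" using s r by (simp_all add: u_def v_def)
      then have uvR: "u \<in> carrier R" "v \<in> carrier R" by auto
      have xk: "x [^]\<^bsub>R\<^esub> k = u \<oplus>\<^bsub>R\<^esub> s \<otimes>\<^bsub>R\<^esub> b" and xl: "x [^]\<^bsub>R\<^esub> l = v \<oplus>\<^bsub>R\<^esub> r \<otimes>\<^bsub>R\<^esub> c"
        using minus_add_cancel x s r bc by (simp_all add: u_def v_def)
      have "x [^]\<^bsub>R\<^esub> (k + l) = (u \<oplus>\<^bsub>R\<^esub> s \<otimes>\<^bsub>R\<^esub> b) \<otimes>\<^bsub>R\<^esub> (v \<oplus>\<^bsub>R\<^esub> r \<otimes>\<^bsub>R\<^esub> c)"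
        using nat_pow_mult[OF x, of k l] by (simp add: xk xl)
      \<comment> \<open>In the product, \<open>u\<close> is kept against the whole second factor,
        which is again a power of \<open>x\<close>; each of the three summands then contains
        \<open>u\<close>, \<open>v\<close> or \<open>b c\<close>.\<close>
      also have "\<dots> = x [^]\<^bsub>R\<^esub> l \<otimes>\<^bsub>R\<^esub> u \<oplus>\<^bsub>R\<^esub> ((s \<otimes>\<^bsub>R\<^esub> b) \<otimes>\<^bsub>R\<^esub> v \<oplus>\<^bsub>R\<^esub> (s \<otimes>\<^bsub>R\<^esub> r) \<otimes>\<^bsub>R\<^esub> (b \<otimes>\<^bsub>R\<^esub> c))"
        unfolding xl using uvR s r bc by (simp add: l_distr r_distr m_ac a_ac)
      also have "\<dots> \<in> p"
        by (rule p.a_closed[OF p.I_l_closed[OF uv(1)]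
              p.a_closed[OF p.I_l_closed[OF uv(2)] p.I_l_closed[OF bc(3)]]])
          (use bc s r x in simp_all)
      finally show False using P(3)[OF p] by blast
    qed
  qed
  moreover have "J \<subseteq> p" by (rule P(2)[OF p])
  moreover have "x \<notin> p"
  proof -
    have "x [^]\<^bsub>R\<^esub> (1::nat) \<notin> p" by (rule P(3)[OF p])
    then show ?thesis using x by simp
  qed
  ultimately show ?thesis by (rule that)
qed

text \<open>The fraction \<open>n/1\<close> is nonzero in the localization at \<open>p\<close>,
  because no element outside \<open>p\<close> kills \<open>n\<close>.\<close>

lemma mem_supportI:
  assumes N: "module R N" and p: "primeideal p R" and n: "n \<in> carrier N"
    and ann: "\<And>u. u \<in> carrier R \<Longrightarrow> u \<odot>\<^bsub>N\<^esub> n = \<zero>\<^bsub>N\<^esub> \<Longrightarrow> u \<in> p"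
  shows "p \<in> support R N"
proof -
  interpret N: module R N by (rule N)
  interpret p: primeideal p R by (rule p)
  let ?S = "carrier R - p"
  let ?rel = "loc_rel R ?S N" and ?L = "localization R ?S N"
  have one: "\<one>\<^bsub>R\<^esub> \<in> ?S"
  proof -
    have "\<one>\<^bsub>R\<^esub> \<notin> p" using p.I_notcarr p.one_imp_carrier by blast
    then show ?thesis by simp
  qed
  have "?rel `` {(n, \<one>\<^bsub>R\<^esub>)} \<noteq> ?rel `` {(\<zero>\<^bsub>N\<^esub>, \<one>\<^bsub>R\<^esub>)}"
  proof
    assume eq: "?rel `` {(n, \<one>\<^bsub>R\<^esub>)} = ?rel `` {(\<zero>\<^bsub>N\<^esub>, \<one>\<^bsub>R\<^esub>)}"
    have "(n, \<one>\<^bsub>R\<^esub>) \<in> ?rel `` {(n, \<one>\<^bsub>R\<^esub>)}" using n one by (auto simp: loc_rel_def)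
    then have "(n, \<one>\<^bsub>R\<^esub>) \<in> ?rel `` {(\<zero>\<^bsub>N\<^esub>, \<one>\<^bsub>R\<^esub>)}" using eq by simp
    then obtain u where u: "u \<in> ?S" "u \<odot>\<^bsub>N\<^esub> (\<one>\<^bsub>R\<^esub> \<odot>\<^bsub>N\<^esub> \<zero>\<^bsub>N\<^esub>) = u \<odot>\<^bsub>N\<^esub> (\<one>\<^bsub>R\<^esub> \<odot>\<^bsub>N\<^esub> n)"
      unfolding loc_rel_def by blast
    then have "u \<odot>\<^bsub>N\<^esub> n = \<zero>\<^bsub>N\<^esub>" using n by simp
    then show False using ann[of u] u(1) by blast
  qed
  moreover have "?rel `` {(n, \<one>\<^bsub>R\<^esub>)} \<in> carrier ?L"
    unfolding localization_def using n one by (auto intro!: quotientI)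
  moreover have "\<zero>\<^bsub>?L\<^esub> = ?rel `` {(\<zero>\<^bsub>N\<^esub>, \<one>\<^bsub>R\<^esub>)}" by (simp add: localization_def)
  ultimately have "carrier ?L \<noteq> {\<zero>\<^bsub>?L\<^esub>}" by auto
  then show ?thesis using p by (simp add: support_def)
qed

text \<open>Otherwise the powers of \<open>x\<close> avoid the annihilator of \<open>n\<close>, and
  some prime contains this annihilator but not \<open>x\<close>. Such a prime lies in the support,
  hence contains \<open>\<aa>\<close> and with it \<open>x\<close>.\<close>

lemma support_nilpotent:
  assumes no: "noetherian_ring R" and N: "module R N" and sup: "support R N \<subseteq> zero_locus R \<aa>"
    and a: "ideal \<aa> R" and x: "x \<in> \<aa>" and n: "n \<in> carrier N"
  shows "\<exists>k :: nat. x [^]\<^bsub>R\<^esub> k \<odot>\<^bsub>N\<^esub> n = \<zero>\<^bsub>N\<^esub>"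
proof (rule ccontr)
  interpret N: module R N by (rule N)
  assume neg: "\<not> ?thesis"
  have xR: "x \<in> carrier R" using ideal.Icarr[OF a x] .
  note I = colon_ideal[OF N submodule_zero_set[OF N] n]
  have "x [^]\<^bsub>R\<^esub> k \<notin> colon R N {\<zero>\<^bsub>N\<^esub>} n" for k :: nat using neg by (auto simp: colon_def)
  then obtain p where p: "primeideal p R" "colon R N {\<zero>\<^bsub>N\<^esub>} n \<subseteq> p" "x \<notin> p"
    using prime_avoiding_powers[OF N.is_cring no I xR] by blast
  have "p \<in> support R N" by (rule mem_supportI[OF N p(1) n]) (use p(2) in \<open>auto simp: colon_def\<close>)
  then have "\<aa> \<subseteq> p" using sup by (auto simp: zero_locus_def)
  then show False using x p(3) by blast
qed

text \<open>Half-exactness is used twice: with \<open>G\<close> on the carrier type of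
  \<open>N\<close> for the filtration by generators, and with \<open>G'\<close> alone for the
  passage between ideals.\<close>

lemma fg_supported_G:
  fixes G :: "nat \<Rightarrow> ('r, 'n) module \<Rightarrow> bool" and G' :: "nat \<Rightarrow> ('r, 'r set) module \<Rightarrow> bool"
  assumes ex: "half_exact R G G'" "half_exact R G' G'"
    and cr: "cring R" and no: "noetherian_ring R" and a: "ideal \<aa> R"
    and G': "\<And>i. i \<le> t \<Longrightarrow> G' i (cyclic_module R \<aa>)"
    and i: "i \<le> t" and N: "fg_supported R \<aa> N"
  shows "G i N"
proof -
  interpret I: half_exact_ideals R G' by (intro half_exact_ideals.intro half_exact_cyclic.intro ex)
  interpret half_exact_cyclic R G G' by (intro half_exact_cyclic.intro ex)
  have M: "module R N" and sup: "support R N \<subseteq> zero_locus R \<aa>" using N by (simp_all add: fg_supported_def)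
  obtain S where S: "finite S" "S \<subseteq> carrier N" "mod_span R N S = carrier N"
    using N by (auto simp: fg_supported_def finitely_generated_def)
  have "G' i (cyclic_module R (colon R N H x))" if H: "submodule H R N" and x: "x \<in> carrier N" for H x
  proof (rule I.radical_superideal[OF cr no a G' i colon_ideal[OF M H x]])
    fix y assume y: "y \<in> \<aa>"
    interpret cring R by (rule cr)
    obtain k :: nat where k: "y [^]\<^bsub>R\<^esub> k \<odot>\<^bsub>N\<^esub> x = \<zero>\<^bsub>N\<^esub>"
      using support_nilpotent[OF no M sup a y x] by blast
    \<comment> \<open>The annihilator of \<open>x\<close> is contained in every
      \<open>H : x\<close>, since zero lies in \<open>H\<close>.\<close>
    then have "y [^]\<^bsub>R\<^esub> k \<in> colon R N H x"
      using ideal.Icarr[OF a y] submodule_zero[OF H] by (simp add: colon_def)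
    then show "\<exists>k :: nat. y [^]\<^bsub>R\<^esub> k \<in> colon R N H x" ..
  qed
  from mod_span_G[OF M S(1,2) this] show ?thesis using S(3) by simp
qed

theorem proposition3p4:
  fixes R :: "('r, 'e) ring_scheme"
    and \<aa> \<bb> :: "'r set"
    and X :: "('r, 'u) module"
    and t :: nat
    and \<delta> :: "('r, 'u) module set"
  assumes universe: "infinite (UNIV :: 'u set)"
    and cring: "cring R"
    and noetherian: "noetherian_ring R"
    and ideal_a: "ideal \<aa> R"
    and module_X: "module R X"
    and serre: "serre_subcategory R \<delta>"
    and ideal_b: "ideal \<bb> R"
    and a_subset_b: "\<aa> \<subseteq> \<bb>"
  shows
    "((\<forall>i\<le>t. belongs_to R (Ext R i (cyclic_module R \<aa>) X) \<delta>) \<longrightarrow>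
        (\<forall>i\<le>t. \<forall>N :: ('r, 'n) module. fg_supported R \<aa> N \<longrightarrow> belongs_to R (Ext R i N X) \<delta>) \<and>
        (\<forall>i\<le>t. belongs_to R (Ext R i (cyclic_module R \<bb>) X) \<delta>)) \<and>
     ((\<forall>i\<le>t. belongs_to R (Tor R i (cyclic_module R \<aa>) X) \<delta>) \<longrightarrow>
        (\<forall>i\<le>t. \<forall>N :: ('r, 'n) module. fg_supported R \<aa> N \<longrightarrow> belongs_to R (Tor R i N X) \<delta>) \<and>
        (\<forall>i\<le>t. belongs_to R (Tor R i (cyclic_module R \<bb>) X) \<delta>))"
proof -
  \<comment> \<open>The carrier types of the resolved modules stay schematic in these facts, so they
    serve both for \<open>N\<close> and for cyclic modules.\<close>
  note Ext = half_exact_Ext[OF module_X serre universe] and Tor = half_exact_Tor[OF module_X serre universe]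
  interpret Ext: half_exact_ideals R "\<lambda>i C. belongs_to R (Ext R i C X) \<delta>"
    by (intro half_exact_ideals.intro half_exact_cyclic.intro Ext)
  interpret Tor: half_exact_ideals R "\<lambda>i C. belongs_to R (Tor R i C X) \<delta>"
    by (intro half_exact_ideals.intro half_exact_cyclic.intro Tor)
  show ?thesis
  proof (intro conjI impI allI)
    assume h: "\<forall>i\<le>t. belongs_to R (Ext R i (cyclic_module R \<aa>) X) \<delta>"
    fix i assume i: "i \<le> t"
    show "belongs_to R (Ext R i N X) \<delta>" if "fg_supported R \<aa> N" for N :: "('r, 'n) module"
      by (rule fg_supported_G[OF Ext Ext cring noetherian ideal_a _ i that]) (use h in blast)
    \<comment> \<open>The carrier type of \<open>R/\<bb>\<close> differs in general from the fixed
      type of \<open>N\<close>, so this part is drawn from the result on superideals.\<close>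
    show "belongs_to R (Ext R i (cyclic_module R \<bb>) X) \<delta>"
      by (rule Ext.superideal[OF cring noetherian ideal_a _ i ideal_b a_subset_b]) (use h in blast)
  next
    assume h: "\<forall>i\<le>t. belongs_to R (Tor R i (cyclic_module R \<aa>) X) \<delta>"
    fix i assume i: "i \<le> t"
    show "belongs_to R (Tor R i N X) \<delta>" if "fg_supported R \<aa> N" for N :: "('r, 'n) module"
      by (rule fg_supported_G[OF Tor Tor cring noetherian ideal_a _ i that]) (use h in blast)
    show "belongs_to R (Tor R i (cyclic_module R \<bb>) X) \<delta>"
      by (rule Tor.superideal[OF cring noetherian ideal_a _ i ideal_b a_subset_b]) (use h in blast)
  qed
qed

end
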